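(* Let $d\ge2$ be an integer, let $\kappa_d=\frac{2^{d-1}\zeta(d+1)}{\zeta(d)}$, and let $v_0\in\mathcal{P}_d^\star$ be a fixed primitive generator. The number of occurrences of $v_0$ in a (uniformly random) lattice zonotope inscribed in $[0,n]^d$ is distributed with mean $\mu^n_{\mathrm{occ}}$ and variance $(\sigma^2)^n_{\mathrm{occ}}$ such that, as $n\to+\infty$, $$\mu^n_{\mathrm{occ}}\sim\frac{n^{\frac1{d+1}}}{\kappa_d^{\frac1{d+1}}\|v_0\|_1},\qquad(\sigma^2)^n_{\mathrm{occ}}\sim\left(\frac{n^{\frac1{d+1}}}{\kappa_d^{\frac1{d+1}}\|v_0\|_1}\right)^2.$$
   Context: A lattice zonotope in $\mathbb{R}^d$ is a polytope that, up to translation, has the form $\{\sum_{i=1}^k\alpha_i v_i : \alpha_1,\dots,\alpha_k\in[0,1]\}$ for some $k\in\mathbb{N}$ and $v_1,\dots,v_k\in\mathbb{Z}^d$; lattice zonotopes are considered up to translation. Let $\mathcal{P}_d^\star$ be the set of primitive vectors of $\mathbb{Z}^d$ (non-zero, coordinates with gcd $1$) whose first non-zero coordinate is positive. Lattice zonotopes up to translation are in bijection with finitely supported functions $\omega:\mathcal{P}_d^\star\to\mathbb{Z}_{\ge0}$: the zonotope of $\omega$ has generators $\omega(v)v$, $v\in\operatorname{supp}(\omega)$. The number of occurrences of $v_0$ in the zonotope is $\omega(v_0)$. A lattice zonotope is inscribed in $[0,n]^d$ if its projection on each coordinate axis has length exactly $n$, i.e. $\sum_{v}\omega(v)|v_i|=n$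 for each $i$. $\|v_0\|_1$ is the $\ell^1$ norm and $\zeta$ is the Riemann zeta function. *)

theory Defs
  imports "HOL-Probability.Probability" "HOL-Library.Landau_Symbols"
begin

definition zeta :: "real \<Rightarrow> real" where
  "zeta s = (\<Sum>m. 1 / real (Suc m) powr s)"

definition kappa :: "nat \<Rightarrow> real" where
  "kappa d = 2 ^ (d - 1) * zeta (real d + 1) / zeta (real d)"

definition real_vec :: "int ^ 'd \<Rightarrow> real ^ 'd" where
  "real_vec v = (\<chi> i. real_of_int (v $ i))"

definition l1_norm :: "int ^ 'd \<Rightarrow> real" where
  "l1_norm v = (\<Sum>i\<in>UNIV. \<bar>real_of_int (v $ i)\<bar>)"

text \<open>The index type of the coordinates is linearly ordered, so that the first non-zero
  coordinate of a vector makes sense.\<close>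

definition primitive_vectors :: "(int ^ 'd::{finite,linorder}) set" where
  "primitive_vectors =
     {v. v \<noteq> 0 \<and> Gcd (range (\<lambda>i. v $ i)) = 1 \<and> (\<exists>i. v $ i > 0 \<and> (\<forall>j<i. v $ j = 0))}"

definition zonotope :: "'i set \<Rightarrow> ('i \<Rightarrow> int ^ 'd) \<Rightarrow> (real ^ 'd) set" where
  "zonotope I g = {(\<Sum>i\<in>I. \<alpha> i *\<^sub>R real_vec (g i)) | \<alpha>. \<forall>i\<in>I. \<alpha> i \<in> {0..1}}"

definition translate_of :: "(real ^ 'd) set \<Rightarrow> (real ^ 'd) set \<Rightarrow> bool" where
  "translate_of P Q \<longleftrightarrow> (\<exists>t. Q = (\<lambda>x. t + x) ` P)"

definition lattice_zonotope :: "(real ^ 'd) set \<Rightarrow> bool" where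
  "lattice_zonotope P \<longleftrightarrow>
     (\<exists>(k::nat) (v :: nat \<Rightarrow> int ^ 'd). translate_of (zonotope {..<k} v) P)"

text \<open>The projection on each coordinate axis is required to be a segment of length n; it need
  not be the segment from 0 to n, since zonotopes are considered up to translation.\<close>

definition inscribed :: "nat \<Rightarrow> (real ^ 'd) set \<Rightarrow> bool" where
  "inscribed n P \<longleftrightarrow> (\<forall>i. \<exists>a. (\<lambda>x. x $ i) ` P = {a..a + real n})"

definition inscribed_zonotopes :: "nat \<Rightarrow> (real ^ 'd) set set set" where
  "inscribed_zonotopes n =
     {P. lattice_zonotope P \<and> inscribed n P} // {(P, Q). translate_of P Q}"

definition multiplicity_function :: "((int ^ 'd::{finite,linorder}) \<Rightarrow> nat) \<Rightarrow> bool" where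
  "multiplicity_function \<omega> \<longleftrightarrow>
     finite {v. \<omega> v \<noteq> 0} \<and> {v. \<omega> v \<noteq> 0} \<subseteq> primitive_vectors"

definition zonotope_of :: "((int ^ 'd::{finite,linorder}) \<Rightarrow> nat) \<Rightarrow> (real ^ 'd::{finite,linorder}) set" where
  "zonotope_of \<omega> = zonotope {v. \<omega> v \<noteq> 0} (\<lambda>v. int (\<omega> v) *s v)"

text \<open>A translation class of lattice zonotopes contains the zonotope of exactly one multiplicity
  function, so the description below is proper on such classes.\<close>

definition occurrences ::
  "(int ^ 'd::{finite,linorder}) \<Rightarrow> (real ^ 'd::{finite,linorder}) set set \<Rightarrow> nat" where
  "occurrences v\<^sub>0 C = (THE \<omega>. multiplicity_function \<omega> \<and> zonotope_of \<omega> \<in> C) v\<^sub>0"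

text \<open>For every n there are finitely many, and at least one, inscribed classes, so this is the
  uniform distribution on them.\<close>

definition random_zonotope :: "nat \<Rightarrow> (real ^ 'd) set set pmf" where
  "random_zonotope n = pmf_of_set (inscribed_zonotopes n)"

definition occ_mean :: "(int ^ 'd::{finite,linorder}) \<Rightarrow> nat \<Rightarrow> real" where
  "occ_mean v\<^sub>0 n =
     measure_pmf.expectation (random_zonotope n) (\<lambda>C. real (occurrences v\<^sub>0 C))"

definition occ_variance :: "(int ^ 'd::{finite,linorder}) \<Rightarrow> nat \<Rightarrow> real" where
  "occ_variance v\<^sub>0 n =
     measure_pmf.variance (random_zonotope n) (\<lambda>C. real (occurrences v\<^sub>0 C))"

end

theory Submission
  imports Defs "HOL-Real_Asymp.Real_Asymp"
begin

text \<open>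
  A translation class of lattice zonotopes is the same thing as a multiplicity function
  \<open>\<omega>\<close>: the width of its zonotope in direction \<open>u\<close> is
  \<open>\<Sum>v. \<omega> v * \<bar>v \<bullet> u\<bar>\<close>, and the kinks of this function of \<open>u\<close> recover
  \<open>\<omega>\<close>. Being inscribed in the cube of side \<open>n\<close> means that the total
  \<open>\<Sum>v. \<omega> v * |v|\<close>, with \<open>|v|\<close> the vector of absolute values, is \<open>(n, \<dots>, n)\<close>.
  Let \<open>a N\<close> be the number of multiplicity functions with total \<open>N\<close>. Removing \<open>k\<close> copies of
  the fixed generator shows that it occurs at least \<open>k\<close> times with probability
  \<open>a (N - k|v\<^sub>0|) / a N\<close>, where \<open>N = (n, \<dots>, n)\<close>. The heart of the proof is that this ratio is
  close to \<open>exp (- \<beta> k \<parallel>v\<^sub>0\<parallel>)\<close> for \<open>\<beta> = (\<kappa> / n) powr (1 / (d + 1))\<close>, with the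
  \<open>\<ell>\<^sup>1\<close> norm (\<open>count_ratio_asymptotic\<close>). So the number of occurrences is nearly
  geometric, hence nearly exponential with mean \<open>1 / (\<beta> \<parallel>v\<^sub>0\<parallel>)\<close>; an exponential bound
  on the tail (\<open>survival_exp_decay\<close>) carries the limit over to the first two moments, and an
  exponential variable has the square of its mean as its variance.

  The ratio is found from entropy and monotonicity, at a precision far below that of a local limit
  theorem for \<open>a\<close>. Let \<open>F \<beta>\<close> be the sum of \<open>exp (- \<beta> \<parallel>N\<parallel>) * a N\<close> over all \<open>N\<close>.
  Dividing by it makes the multiplicities independent geometric variables.
  Conditioning on the total \<open>N\<close> multiplies probabilities by at most \<open>exp \<Delta>\<close>,
  where \<open>\<Delta> = \<beta> \<parallel>N\<parallel> + ln (F \<beta>) - ln (a N)\<close>. If \<open>\<Delta>\<close> is small compared with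
  \<open>\<beta> powr (- d)\<close>, then it is small compared with the number of primitive vectors in a box \<open>B\<close>
  of side \<open>\<delta> / \<beta>\<close>, and a large deviation bound shows that the conditional mean of the
  number of \<open>v \<in> B\<close> that occur is nearly the unconditional one
  (\<open>sum_count_diff_le\<close>). In other words, the average over \<open>v \<in> B\<close> of \<open>a (N - |v|) / a N\<close>
  is nearly that of \<open>exp (- \<beta> \<parallel>v\<parallel>)\<close>. Since the axis vectors are generators, \<open>a\<close> is monotone in
  every coordinate, and an average over a small box pins down the ratio at its corners.

  It remains to bound \<open>\<Delta>\<close> (\<open>log_count_lower_bound\<close>). For positive \<open>c\<close> one has
  \<open>ln (F (\<beta> c)) \<sim> \<kappa> \<beta> powr (- d) / (\<Prod>i. c i)\<close> (\<open>log_gf_limit\<close>). Varying \<open>c\<close>, Chernoff's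
  bound shows that under the tilted measure every coordinate of the total is close to
  \<open>\<kappa> \<beta> powr (- d - 1) = n\<close>. Only polynomially many totals are that close, so for one of them, \<open>M\<close>, the
  number \<open>ln (a M)\<close> nearly reaches its upper bound \<open>\<beta> \<parallel>M\<parallel> + ln (F \<beta>)\<close>; for a slightly larger \<open>\<beta>\<close> it satisfies \<open>M \<le> N\<close>, and \<open>a M \<le> a N\<close>.
  The constant arises as follows. Every nonzero lattice vector is, up to sign, a unique multiple of a primitive
  one, so the sums \<open>P c\<close> of \<open>exp (- c \<bullet> |v|)\<close> over primitive vectors satisfy
  \<open>(\<Sum>k\<ge>1. P (k c)) = (\<Sum>m. exp (- c \<bullet> |m|))\<close>, with \<open>m\<close> in half of the lattice. The right side is
  explicit, and inverting the relation yields the factor \<open>1 / \<zeta> d\<close>; then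
  \<open>ln (F c) = (\<Sum>k\<ge>1. P (k c) / k)\<close> yields the factor \<open>\<zeta> (d + 1)\<close>.
\<close>

section \<open>Real analysis\<close>

text \<open>With \<open>q = A / (1 + suminf z)\<close>, the relation bounds \<open>\<bar>p s - q\<bar>\<close> by \<open>\<bar>g s - A\<bar>\<close> plus an average of
  \<open>\<bar>p - q\<bar>\<close> at larger arguments with total mass \<open>suminf z < 1\<close>. A bound \<open>D\<close> that holds near 0 thus
  improves to \<open>suminf z * D + \<delta>\<close> near 0: finitely many arguments are still near 0, and the rest of the mass is
  small. Iteration gives the limit. For \<open>z k = (k + 2) ^ -d\<close> this does the work of Moebius inversion.\<close>

lemma dirichlet_convolution_tauberian:
  fixes p g :: "real \<Rightarrow> real" and z :: "nat \<Rightarrow> real"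
  assumes bnd: "\<And>s. s > 0 \<Longrightarrow> \<bar>p s\<bar> \<le> C"
    and z: "\<And>k. z k \<ge> 0" "summable z" "suminf z < 1"
    and eq: "\<And>s. s > 0 \<Longrightarrow> (\<lambda>k. z k * p (real (k + 2) * s)) sums (g s - p s)"
    and g: "(g \<longlongrightarrow> A) (at_right 0)"
  shows "(p \<longlongrightarrow> A / (1 + suminf z)) (at_right 0)"
proof -
  define Z where "Z = suminf z"
  define q where "q = A / (1 + Z)"
  define C1 where "C1 = C + \<bar>q\<bar>"
  define e where "e = (\<lambda>s. \<bar>p s - q\<bar>)"
  have Z0: "Z \<ge> 0" "Z < 1" using z suminf_nonneg[OF z(2)] by (auto simp: Z_def)
  have "q * (1 + Z) = A" using Z0 by (simp add: q_def)
  hence q: "q + Z * q = A" by (simp add: algebra_simps)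
  have C: "C \<ge> 0" using bnd[of 1] by simp
  have e_bnd: "e s \<le> C1" if "s > 0" for s
    using bnd[OF that] by (auto simp: e_def C1_def)
  have C1: "C1 \<ge> 0" using C by (simp add: C1_def)
  \<comment> \<open>The contraction: one use of the relation improves the bound \<open>D\<close> to \<open>\<delta> + Z * D\<close>.\<close>
  have step: "\<forall>\<^sub>F s in at_right 0. e s \<le> \<delta> + Z * D"
    if D: "\<forall>\<^sub>F s in at_right 0. e s \<le> D" "D \<ge> 0" and \<delta>: "\<delta> > 0" for D \<delta>
  proof -
    have "(\<lambda>K. \<Sum>k<K. z k) \<longlonglongrightarrow> Z" using z(2) summable_LIMSEQ Z_def by blast
    moreover have "Z - \<delta> / 2 / (C1 + 1) < Z" using \<delta> C1 by simp
    ultimately have "\<forall>\<^sub>F K in sequentially. (\<Sum>k<K. z k) > Z - \<delta> / 2 / (C1 + 1)"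
      by (rule order_tendstoD)
    then obtain K where K: "(\<Sum>k<K. z k) > Z - \<delta> / 2 / (C1 + 1)"
      by (auto simp: eventually_sequentially)
    from D obtain b where b: "b > 0" "\<And>s. 0 < s \<Longrightarrow> s < b \<Longrightarrow> e s \<le> D"
      by (auto simp: eventually_at_right_field)
    have "\<forall>\<^sub>F s in at_right 0. dist (g s) A < \<delta> / 2"
      using g \<delta> by (intro tendstoD) auto
    moreover have "\<forall>\<^sub>F s in at_right 0. s < b / real (K + 2)"
      using b eventually_at_right_real[of 0 "b / real (K + 2)"] by (auto elim!: eventually_mono)
    moreover have "\<forall>\<^sub>F s in at_right 0. s > (0::real)" by (simp add: eventually_at_right_less)
    ultimately show ?thesis
    proof eventually_elim
      case (elim s)
      have s1: "(\<lambda>k. z k * p (real (k + 2) * s)) sums (g s - p s)" using eq elim by blast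
      have "(\<lambda>k. z k * q) sums (Z * q)"
        using z(2) by (simp add: Z_def sums_mult2 summable_sums)
      from sums_diff[OF s1 this]
      have s2: "(\<lambda>k. z k * (p (real (k + 2) * s) - q)) sums (g s - p s - Z * q)"
        by (simp add: algebra_simps)
      have sC: "summable (\<lambda>k. z k * C1)" using z(2) by (rule summable_mult2)
      have le: "z k * e (real (k + 2) * s) \<le> z k * C1" for k
        using elim by (intro mult_left_mono e_bnd z) auto
      have sabs: "summable (\<lambda>k. z k * e (real (k + 2) * s))"
        by (rule summable_comparison_test[OF _ sC]) (use le z(1) in \<open>auto simp: e_def abs_mult\<close>)
      have sa': "summable (\<lambda>k. \<bar>z k * (p (real (k + 2) * s) - q)\<bar>)"
        using sabs z(1) by (simp add: e_def abs_mult)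
      have "\<bar>g s - p s - Z * q\<bar> \<le> (\<Sum>k. z k * e (real (k + 2) * s))"
        using summable_rabs[OF sa'] s2 z(1) by (simp add: sums_iff e_def abs_mult)
      also have "\<dots> = (\<Sum>k<K. z k * e (real (k + 2) * s)) + (\<Sum>k. z (k+K) * e (real (k+K + 2) * s))"
        using suminf_split_initial_segment[OF sabs, of K] by simp
      also have "(\<Sum>k<K. z k * e (real (k + 2) * s)) \<le> (\<Sum>k<K. z k * D)"
      proof (intro sum_mono mult_left_mono b z)
        fix k assume "k \<in> {..<K}"
        hence "real (k+2) * s \<le> real (K+2) * s" using elim by (intro mult_right_mono) auto
        also have "\<dots> < b" using elim by (simp add: field_simps)
        finally show "real (k+2) * s < b" .
      qed (use elim in auto)
      also have "\<dots> \<le> Z * D" unfolding sum_distrib_right[symmetric]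
        using D z by (intro mult_right_mono) (auto simp: Z_def intro: sum_le_suminf)
      also have "(\<Sum>k. z (k+K) * e (real (k+K + 2) * s)) \<le> (\<Sum>k. z (k+K) * C1)"
        by (rule suminf_le[OF le summable_ignore_initial_segment[OF sabs, of K]
              summable_ignore_initial_segment[OF sC, of K]])
      also have "\<dots> = (\<Sum>k. z (k+K)) * C1"
        using z by (intro suminf_mult2[symmetric]) simp
      also have "(\<Sum>k. z (k+K)) = Z - (\<Sum>k<K. z k)"
        using suminf_minus_initial_segment[OF z(2)] by (simp add: Z_def)
      also have "(Z - (\<Sum>k<K. z k)) * C1 \<le> \<delta> / 2 / (C1 + 1) * C1"
        using K C1 by (intro mult_right_mono) auto
      also have "\<dots> \<le> \<delta> / 2" using C1 \<delta> by (simp add: field_simps)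
      finally have "\<bar>g s - p s - Z * q\<bar> \<le> Z * D + \<delta> / 2" by simp
      moreover have "\<bar>g s - A\<bar> < \<delta> / 2" using elim by (simp add: dist_real_def)
      ultimately show ?case using q unfolding e_def by linarith
    qed
  qed
  have iter: "\<forall>\<^sub>F s in at_right 0. e s \<le> Z ^ j * C1 + \<delta>" if "\<delta> > 0" for j \<delta>
    using that
  proof (induction j arbitrary: \<delta>)
    case 0
    have "\<forall>\<^sub>F s in at_right 0. s > (0::real)" by (simp add: eventually_at_right_less)
    thus ?case by eventually_elim (use e_bnd 0 in force)
  next
    case (Suc j)
    have "\<forall>\<^sub>F s in at_right 0. e s \<le> \<delta>/2 + Z * (Z ^ j * C1 + \<delta>/2)"
      by (rule step[OF Suc.IH]) (use Suc Z0 C1 in auto)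
    moreover have "\<delta>/2 + Z * (Z ^ j * C1 + \<delta>/2) \<le> Z ^ Suc j * C1 + \<delta>"
    proof -
      have "Z * \<delta> \<le> \<delta>" using Z0 Suc.prems by (simp add: mult_left_le_one_le)
      thus ?thesis by (simp add: algebra_simps)
    qed
    ultimately show ?case by (auto elim: eventually_mono)
  qed
  show ?thesis unfolding Z_def[symmetric] q_def[symmetric]
  proof (rule tendstoI)
    fix \<epsilon> :: real assume "\<epsilon> > 0"
    have "(\<lambda>j. Z ^ j * C1) \<longlonglongrightarrow> 0 * C1"
      using Z0 by (intro tendsto_intros LIMSEQ_power_zero) auto
    hence "\<forall>\<^sub>F j in sequentially. Z ^ j * C1 < \<epsilon> / 2"
      using \<open>\<epsilon> > 0\<close> by (intro order_tendstoD) auto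
    then obtain j where "Z ^ j * C1 < \<epsilon> / 2" by (auto simp: eventually_sequentially)
    with iter[of "\<epsilon>/2" j] \<open>\<epsilon> > 0\<close> show "\<forall>\<^sub>F s in at_right 0. dist (p s) q < \<epsilon>"
      by (auto simp: e_def dist_real_def elim!: eventually_mono)
  qed
qed

text \<open>The bound \<open>1 / (g + 1)\<^sup>2 \<le> 1 / g - 1 / (g + 1)\<close> telescopes.\<close>

lemma sum_inverse_squares_le:
  "n \<ge> 2 \<Longrightarrow> (\<Sum>g=2..n. 1 / real g ^ 2) \<le> 3 / 4 - 1 / real n"
proof (induction n rule: dec_induct)
  case (step n)
  have "1 / real (Suc n) ^ 2 \<le> 1 / (real n * real (Suc n))"
    using step.hyps unfolding power2_eq_square by (intro divide_left_mono mult_right_mono) auto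
  also have "\<dots> = 1 / real n - 1 / real (Suc n)" using step.hyps by (simp add: field_simps)
  finally have "1 / real (Suc n) ^ 2 \<le> 1 / real n - 1 / real (Suc n)" .
  thus ?case using step by simp
qed (simp add: power2_eq_square)

text \<open>In the variable \<open>t = b n * k\<close> the sequence \<open>r n\<close> tends to \<open>exp (- t)\<close> locally uniformly, and the exponential
  domination makes \<open>(1 + t) ^ 3 * \<bar>r n k - exp (- t)\<bar>\<close> tend to 0 uniformly in \<open>k\<close>. The two sums have weights
  of size at most \<open>2 * b n * (1 + t)\<close>, and \<open>b n / (1 + t)\<^sup>2\<close> has bounded sum, so \<open>r n\<close> may be replaced by the geometric
  sequence, whose sums are explicit.\<close>

lemma scaled_sums_of_near_geometric:
  fixes r :: "nat \<Rightarrow> nat \<Rightarrow> real" and b :: "nat \<Rightarrow> real"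
  assumes b: "\<And>n. n > 0 \<Longrightarrow> b n > 0" "b \<longlonglongrightarrow> 0"
    and lim: "\<And>C \<eta>. \<eta> > 0 \<Longrightarrow> \<forall>\<^sub>F n in sequentially. \<forall>k. b n * real k \<le> C \<longrightarrow> \<bar>r n k - exp (- b n * real k)\<bar> \<le> \<eta>"
    and dom: "\<forall>\<^sub>F n in sequentially. \<forall>k. \<bar>r n k\<bar> \<le> K * exp (- c * b n * real k)" and c: "c > 0" "K > 0"
  shows "(\<lambda>n. b n * (\<Sum>k. r n (Suc k))) \<longlonglongrightarrow> 1"
    and "(\<lambda>n. b n ^ 2 * (\<Sum>k. (2 * real k + 1) * r n (Suc k))) \<longlonglongrightarrow> 2"
proof -
  \<comment> \<open>Beyond \<open>T\<close> both sequences are small by domination; up to \<open>T\<close> local uniform convergence applies.\<close>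
  have close: "\<forall>\<^sub>F n in sequentially. \<forall>k. (1 + b n * real k) ^ 3 * \<bar>r n k - exp (- b n * real k)\<bar> \<le> \<eta>"
    if \<eta>: "\<eta> > 0" for \<eta>
  proof -
    have "((\<lambda>t::real. (1 + t) ^ 3 * (K * exp (- c * t) + exp (- t))) \<longlongrightarrow> 0) at_top"
    proof -
      have "((\<lambda>t::real. K * ((1 + t) ^ 3 * exp (- (c * t))) + (1 + t) ^ 3 * exp (- t)) \<longlongrightarrow> K * 0 + 0) at_top"
      proof (intro tendsto_intros)
        show "((\<lambda>t::real. (1 + t) ^ 3 * exp (- (c * t))) \<longlongrightarrow> 0) at_top" using c(1) by real_asymp
        show "((\<lambda>t::real. (1 + t) ^ 3 * exp (- t)) \<longlongrightarrow> 0) at_top" by real_asymp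
      qed
      thus ?thesis by (simp add: algebra_simps)
    qed
    hence "\<forall>\<^sub>F t in at_top. (1 + t) ^ 3 * (K * exp (- c * t) + exp (- t)) < \<eta>"
      using \<eta> by (intro order_tendstoD)
    then obtain T0 where T0: "\<And>t. t \<ge> T0 \<Longrightarrow> (1 + t) ^ 3 * (K * exp (- c * t) + exp (- t)) < \<eta>"
      by (auto simp: eventually_at_top_linorder)
    define T where "T = max T0 0"
    have pos: "\<forall>\<^sub>F n in sequentially. n > (0::nat)" by (rule eventually_gt_at_top)
    have "\<forall>\<^sub>F n in sequentially. \<forall>k. b n * real k \<le> T \<longrightarrow> \<bar>r n k - exp (- b n * real k)\<bar> \<le> \<eta> / (1 + T)^3"
      using \<eta> by (intro lim) (auto simp: T_def)
    with dom pos show ?thesis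
    proof eventually_elim
      case (elim n)
      show ?case
      proof
        fix k
        have t0: "b n * real k \<ge> 0" using b(1)[of n] elim by simp
        show "(1 + b n * real k) ^ 3 * \<bar>r n k - exp (- b n * real k)\<bar> \<le> \<eta>"
        proof (cases "b n * real k \<le> T")
          case True
          have "(1 + b n * real k) ^ 3 * \<bar>r n k - exp (- b n * real k)\<bar> \<le> (1 + T) ^ 3 * (\<eta> / (1 + T)^3)"
            using True elim t0 \<eta> by (intro mult_mono power_mono) auto
          also have "\<dots> = \<eta>" by (simp add: T_def)
          finally show ?thesis .
        next
          case False
          have "\<bar>r n k - exp (- b n * real k)\<bar> \<le> \<bar>r n k\<bar> + exp (- b n * real k)"
            using abs_triangle_ineq4[of "r n k" "exp (- b n * real k)"] by simp
          also have "\<dots> \<le> K * exp (- c * (b n * real k)) + exp (- (b n * real k))"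
            using elim by (simp add: mult.assoc)
          finally have "(1 + b n * real k) ^ 3 * \<bar>r n k - exp (- b n * real k)\<bar> \<le>
             (1 + b n * real k) ^ 3 * (K * exp (- c * (b n * real k)) + exp (- (b n * real k)))"
            using t0 by (intro mult_left_mono) auto
          also have "\<dots> < \<eta>" using False by (intro T0) (auto simp: T_def)
          finally show ?thesis by simp
        qed
      qed
    qed
  qed
  \<comment> \<open>The index \<open>j\<close> serves to treat the two weights of the conclusion together.\<close>
  define w where "w = (\<lambda>(j::nat) n k. if j = 0 then b n else b n ^ 2 * (2 * real k + 1))"
  define q where "q = (\<lambda>n k. exp (- b n * real (Suc k)))"
  have main: "(\<lambda>n. (\<Sum>k. w j n k * r n (Suc k)) - (\<Sum>k. w j n k * q n k)) \<longlonglongrightarrow> 0"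
     and smr: "\<forall>\<^sub>F n in sequentially. summable (\<lambda>k. w j n k * r n (Suc k)) \<and> summable (\<lambda>k. w j n k * q n k)" for j
  proof -
    have sq: "summable (\<lambda>k. w j n k * q n k)" if "n > 0" for n
    proof -
      have "b n > 0" using b that by blast
      hence nq: "norm (exp (- b n)) < 1" by simp
      have q: "q n k = exp (- b n) * exp (- b n) ^ k" for k
        by (simp add: q_def exp_of_nat_mult[symmetric] exp_add[symmetric] algebra_simps)
      have s1: "summable (\<lambda>k. exp (- b n) ^ k)" using nq by (rule summable_geometric)
      have s2: "summable (\<lambda>k. of_nat (Suc k) * exp (- b n) ^ k)"
        using geometric_deriv_sums[OF nq] by (simp add: sums_iff)
      have "summable (\<lambda>k. (2 * b n ^ 2 * exp (-b n)) * (of_nat (Suc k) * exp (- b n) ^ k) - (b n ^2 * exp (-b n)) * exp (- b n) ^ k)"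
        by (intro summable_diff summable_mult s1 s2)
      moreover have "summable (\<lambda>k. (b n * exp (-b n)) * exp (- b n) ^ k)"
        by (intro summable_mult s1)
      ultimately show ?thesis by (cases "j = 0") (simp_all add: w_def q algebra_simps)
    qed
    \<comment> \<open>A telescoping majorant of \<open>2 * b n / (1 + t)\<^sup>2\<close>.\<close>
    define h where "h = (\<lambda>n k. 2 * (1 / (1 + b n * real k) - 1 / (1 + b n * real (Suc k))))"
    have h: "h n sums 2" if "n > 0" for n
    proof -
      have bn: "b n > 0" using b that by blast
      have "(\<lambda>k. 1 / (1 + b n * real k)) \<longlonglongrightarrow> 0" using bn by real_asymp
      from telescope_sums'[OF this] have "(\<lambda>k. 1 / (1 + b n * real k) - 1 / (1 + b n * real (Suc k))) sums 1"
        by simp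
      from sums_mult[OF this, of 2] show ?thesis by (simp add: h_def)
    qed
    have wh: "w j n k \<le> h n k * (1 + b n * real (Suc k)) ^ 3" "w j n k \<ge> 0" if "n > 0" "b n < 1" for n k
    proof -
      have bn: "b n > 0" using b that by blast
      let ?x = "1 + b n * real (Suc k)" and ?y = "1 + b n * real k"
      have xy: "?y > 0" "?y \<le> ?x" using bn by (auto simp: field_simps add_pos_nonneg)
      hence x1: "?x \<ge> 1" using bn by simp
      have "1 / ?y - 1 / ?x = b n / (?y * ?x)" using xy bn by (simp add: field_simps)
      also have "\<dots> \<ge> b n / (?x * ?x)" using xy bn by (intro divide_left_mono mult_right_mono mult_pos_pos) (auto intro: less_le_trans)
      finally have 1: "h n k \<ge> 2 * b n / ?x ^ 2" by (simp add: h_def power2_eq_square)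
      have "2 * b n * ?x = 2 * b n / ?x ^ 2 * ?x ^ 3" using x1 by (simp add: power2_eq_square power3_eq_cube)
      also have "\<dots> \<le> h n k * ?x ^ 3" using 1 x1 by (intro mult_right_mono) auto
      finally have 2: "h n k * ?x ^ 3 \<ge> 2 * b n * ?x" .
      have "b n \<le> 2 * b n * ?x" using x1 bn by (simp add: mult_le_cancel_left1)
      moreover have "b n ^ 2 * (2 * real k + 1) \<le> 2 * b n * ?x"
        using bn by (simp add: algebra_simps power2_eq_square)
      ultimately show "w j n k \<le> h n k * ?x ^ 3" using 2 by (auto simp: w_def)
      show "w j n k \<ge> 0" using bn by (simp add: w_def)
    qed
    have b1: "\<forall>\<^sub>F n in sequentially. b n < 1" using b(2) by (rule order_tendstoD) simp
    have pos: "\<forall>\<^sub>F n in sequentially. n > (0::nat)" by (rule eventually_gt_at_top)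
    have key: "\<forall>\<^sub>F n in sequentially. summable (\<lambda>k. w j n k * r n (Suc k)) \<and> summable (\<lambda>k. w j n k * q n k) \<and>
        \<bar>(\<Sum>k. w j n k * r n (Suc k)) - (\<Sum>k. w j n k * q n k)\<bar> \<le> 2 * \<eta>" if "\<eta> > 0" for \<eta>
      using close[OF that] b1 pos
    proof eventually_elim
      case (elim n)
      have bn: "b n > 0" using b elim by blast
      have le: "\<bar>w j n k * r n (Suc k) - w j n k * q n k\<bar> \<le> \<eta> * h n k" for k
      proof -
        let ?x = "1 + b n * real (Suc k)"
        have x: "?x > 0" using bn by (simp add: add_pos_nonneg)
        have h0: "h n k \<ge> 0"
          using wh[OF elim(3,2), of k] x by (meson dual_order.trans zero_le_mult_iff zero_less_power not_le order_less_imp_le)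
        have "\<bar>w j n k * r n (Suc k) - w j n k * q n k\<bar> = w j n k * \<bar>r n (Suc k) - q n k\<bar>"
          using wh(2)[OF elim(3,2), of k] by (simp add: right_diff_distrib[symmetric] abs_mult)
        also have "\<dots> \<le> h n k * ?x ^ 3 * \<bar>r n (Suc k) - q n k\<bar>"
          by (intro mult_right_mono wh elim) auto
        also have "\<dots> = h n k * (?x ^ 3 * \<bar>r n (Suc k) - q n k\<bar>)" by simp
        also have "\<dots> \<le> h n k * \<eta>" using elim(1)[rule_format, of "Suc k"] h0 unfolding q_def by (intro mult_left_mono)
        finally show ?thesis by (simp add: mult.commute)
      qed
      have hs: "(\<lambda>k. \<eta> * h n k) sums (\<eta> * 2)" by (intro sums_mult h elim)
      have sabs: "summable (\<lambda>k. \<bar>w j n k * r n (Suc k) - w j n k * q n k\<bar>)"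
        by (rule summable_comparison_test[OF _ sums_summable[OF hs]]) (use le in auto)
      hence sd: "summable (\<lambda>k. w j n k * r n (Suc k) - w j n k * q n k)" by (rule summable_rabs_cancel)
      from summable_add[OF this sq[OF elim(3)]] have sr: "summable (\<lambda>k. w j n k * r n (Suc k))" by simp
      have "\<bar>(\<Sum>k. w j n k * r n (Suc k)) - (\<Sum>k. w j n k * q n k)\<bar> =
         \<bar>\<Sum>k. w j n k * r n (Suc k) - w j n k * q n k\<bar>"
        by (simp add: suminf_diff[OF sr sq[OF elim(3)]])
      also have "\<dots> \<le> (\<Sum>k. \<bar>w j n k * r n (Suc k) - w j n k * q n k\<bar>)" by (rule summable_rabs[OF sabs])
      also have "\<dots> \<le> (\<Sum>k. \<eta> * h n k)" by (rule suminf_le[OF _ sabs sums_summable[OF hs]]) (rule le)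
      also have "\<dots> = 2 * \<eta>" using hs by (simp add: sums_iff)
      finally show ?case using sr sq[OF elim(3)] by simp
    qed
    show "(\<lambda>n. (\<Sum>k. w j n k * r n (Suc k)) - (\<Sum>k. w j n k * q n k)) \<longlonglongrightarrow> 0"
    proof (rule tendstoI)
      fix \<epsilon> :: real assume "\<epsilon> > 0"
      thus "\<forall>\<^sub>F n in sequentially. dist ((\<Sum>k. w j n k * r n (Suc k)) - (\<Sum>k. w j n k * q n k)) 0 < \<epsilon>"
        using key[of "\<epsilon>/3"] by (auto elim!: eventually_mono)
    qed
    show "\<forall>\<^sub>F n in sequentially. summable (\<lambda>k. w j n k * r n (Suc k)) \<and> summable (\<lambda>k. w j n k * q n k)"
      using key[of 1] by (auto elim!: eventually_mono)
  qed
  have b0: "filterlim b (at_right 0) sequentially"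
  proof -
    have "\<forall>\<^sub>F n in sequentially. b n > 0"
      using eventually_gt_at_top[of 0] by eventually_elim (rule b(1))
    thus ?thesis using b(2) by (simp add: tendsto_imp_filterlim_at_right)
  qed
  have q: "q n k = exp (- b n) * exp (- b n) ^ k" for n k
    by (simp add: q_def exp_of_nat_mult[symmetric] exp_add[symmetric] algebra_simps)
  have Q0: "(\<lambda>n. (\<Sum>k. w 0 n k * q n k)) \<longlonglongrightarrow> 1"
  proof (rule Lim_transform_eventually)
    have "((\<lambda>x::real. x * exp (-x) / (1 - exp (-x))) \<longlongrightarrow> 1) (at_right 0)" by real_asymp
    from filterlim_compose[OF this b0] show "(\<lambda>n. b n * exp (- b n) / (1 - exp (- b n))) \<longlonglongrightarrow> 1" .
    show "\<forall>\<^sub>F n in sequentially. b n * exp (- b n) / (1 - exp (- b n)) = (\<Sum>k. w 0 n k * q n k)"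
      using eventually_gt_at_top[of 0]
    proof eventually_elim
      case (elim n)
      hence nq: "norm (exp (- b n)) < 1" using b(1) by simp
      have "(\<lambda>k. (b n * exp (-b n)) * exp (- b n) ^ k) sums ((b n * exp (-b n)) * (1 / (1 - exp (- b n))))"
        by (intro sums_mult geometric_sums nq)
      thus ?case by (simp add: w_def q sums_iff algebra_simps)
    qed
  qed
  have Q1: "(\<lambda>n. (\<Sum>k. w 1 n k * q n k)) \<longlonglongrightarrow> 2"
  proof (rule Lim_transform_eventually)
    have "((\<lambda>x::real. 2 * x ^ 2 * exp (-x) * (1 / (1 - exp (-x)) ^ 2) - x ^ 2 * exp (-x) * (1 / (1 - exp (-x)))) \<longlongrightarrow> 2) (at_right 0)" by real_asymp
    from filterlim_compose[OF this b0] show "(\<lambda>n. 2 * b n ^ 2 * exp (-b n) * (1 / (1 - exp (-b n)) ^ 2) - b n ^ 2 * exp (-b n) * (1 / (1 - exp (-b n)))) \<longlonglongrightarrow> 2" .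
    show "\<forall>\<^sub>F n in sequentially. 2 * b n ^ 2 * exp (-b n) * (1 / (1 - exp (-b n)) ^ 2) - b n ^ 2 * exp (-b n) * (1 / (1 - exp (-b n))) = (\<Sum>k. w 1 n k * q n k)"
      using eventually_gt_at_top[of 0]
    proof eventually_elim
      case (elim n)
      hence nq: "norm (exp (- b n)) < 1" using b(1) by simp
      have "(\<lambda>k. (2 * b n ^ 2 * exp (-b n)) * (of_nat (Suc k) * exp (- b n) ^ k) - (b n ^2 * exp (-b n)) * exp (- b n) ^ k)
         sums (2 * b n ^ 2 * exp (-b n) * (1 / (1 - exp (-b n)) ^ 2) - b n ^ 2 * exp (-b n) * (1 / (1 - exp (-b n))))"
        by (intro sums_diff sums_mult geometric_sums geometric_deriv_sums nq)
      also have "(\<lambda>k. (2 * b n ^ 2 * exp (-b n)) * (of_nat (Suc k) * exp (- b n) ^ k) - (b n ^2 * exp (-b n)) * exp (- b n) ^ k) = (\<lambda>k. w 1 n k * q n k)"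
        by (simp add: w_def q algebra_simps)
      finally show ?case by (simp add: sums_iff)
    qed
  qed
  show "(\<lambda>n. b n * (\<Sum>k. r n (Suc k))) \<longlonglongrightarrow> 1"
  proof (rule Lim_transform_eventually)
    show "(\<lambda>n. (\<Sum>k. w 0 n k * r n (Suc k))) \<longlonglongrightarrow> 1"
      using tendsto_add[OF main[of 0] Q0] by (simp only: diff_add_cancel add_0)
    show "\<forall>\<^sub>F n in sequentially. (\<Sum>k. w 0 n k * r n (Suc k)) = b n * (\<Sum>k. r n (Suc k))"
      using smr[of 0] eventually_gt_at_top[of 0]
    proof eventually_elim
      case (elim n)
      have "b n \<noteq> 0" using b(1)[OF elim(2)] by simp
      hence "summable (\<lambda>k. r n (Suc k))" using conjunct1[OF elim(1)]
        using summable_cmult_iff[of "b n" "\<lambda>k. r n (Suc k)"] by (simp add: w_def)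
      from suminf_mult[OF this, of "b n"] show ?case unfolding w_def by simp
    qed
  qed
  show "(\<lambda>n. b n ^ 2 * (\<Sum>k. (2 * real k + 1) * r n (Suc k))) \<longlonglongrightarrow> 2"
  proof (rule Lim_transform_eventually)
    show "(\<lambda>n. (\<Sum>k. w 1 n k * r n (Suc k))) \<longlonglongrightarrow> 2"
      using tendsto_add[OF main[of 1] Q1] by (simp only: diff_add_cancel add_0)
    show "\<forall>\<^sub>F n in sequentially. (\<Sum>k. w 1 n k * r n (Suc k)) = b n ^ 2 * (\<Sum>k. (2 * real k + 1) * r n (Suc k))"
      using smr[of 1] eventually_gt_at_top[of 0]
    proof eventually_elim
      case (elim n)
      have "b n ^ 2 \<noteq> 0" using b(1)[OF elim(2)] by simp
      moreover have "summable (\<lambda>k. b n ^ 2 * ((2 * real k + 1) * r n (Suc k)))" using conjunct1[OF elim(1)] by (simp add: w_def mult.assoc)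
      ultimately have "summable (\<lambda>k. (2 * real k + 1) * r n (Suc k))"
        using summable_cmult_iff[of "b n ^ 2" "\<lambda>k. (2 * real k + 1) * r n (Suc k)"] by blast
      from suminf_mult[OF this, of "b n ^ 2"] show ?case by (simp add: w_def mult.assoc)
    qed
  qed
qed

section \<open>Counting multiplicity functions by their total\<close>

text \<open>The scalar product of \<open>c\<close> with the vector of absolute values. On totals of multiplicity functions it is linear.\<close>

definition weight :: "('d::finite \<Rightarrow> real) \<Rightarrow> int ^ 'd \<Rightarrow> real" where
  "weight c m = (\<Sum>i\<in>UNIV. c i * \<bar>real_of_int (m $ i)\<bar>)"

definition vabs :: "int ^ 'd \<Rightarrow> int ^ 'd" where
  "vabs v = (\<chi> i. \<bar>v $ i\<bar>)"

text \<open>Coordinate \<open>i\<close> is the length of the projection of the zonotope of \<open>\<omega>\<close> on axis \<open>i\<close>.\<close>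

definition coord_sum :: "(int ^ 'd::{finite,linorder} \<Rightarrow> nat) \<Rightarrow> int ^ 'd::{finite,linorder}" where
  "coord_sum \<omega> = (\<Sum>v | \<omega> v \<noteq> 0. int (\<omega> v) *s vabs v)"

definition with_total :: "int ^ 'd::{finite,linorder} \<Rightarrow> (int ^ 'd::{finite,linorder} \<Rightarrow> nat) set" where
  "with_total N = {\<omega>. multiplicity_function \<omega> \<and> coord_sum \<omega> = N}"

text \<open>The argument has integer coordinates, possibly negative, so that the count vanishes by itself when too much is
  subtracted from the total.\<close>

definition zono_count :: "int ^ 'd::{finite,linorder} \<Rightarrow> real" where
  "zono_count N = real (card (with_total N))"

lemma vabs_nth [simp]: "vabs v $ i = \<bar>v $ i\<bar>"
  by (simp add: vabs_def)

lemma coord_sum_eq_sum: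
  assumes "finite V" "{v. \<omega> v \<noteq> 0} \<subseteq> V"
  shows "coord_sum \<omega> = (\<Sum>v\<in>V. int (\<omega> v) *s vabs v)"
  unfolding coord_sum_def using assms by (intro sum.mono_neutral_left) auto

lemma coord_sum_nth:
  assumes "finite V" "{v. \<omega> v \<noteq> 0} \<subseteq> V"
  shows "coord_sum \<omega> $ i = (\<Sum>v\<in>V. int (\<omega> v) * \<bar>v $ i\<bar>)"
  by (simp add: coord_sum_eq_sum[OF assms] sum_component)

lemma weight_coord_sum:
  assumes "finite V" "{v. \<omega> v \<noteq> 0} \<subseteq> V"
  shows "weight c (coord_sum \<omega>) = (\<Sum>v\<in>V. real (\<omega> v) * weight c v)"
proof -
  have nn: "coord_sum \<omega> $ i \<ge> 0" for i by (subst coord_sum_nth[OF assms]) (auto intro: sum_nonneg)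
  have "weight c (coord_sum \<omega>) = (\<Sum>i\<in>UNIV. c i * real_of_int (coord_sum \<omega> $ i))"
    using nn by (simp add: weight_def)
  also have "\<dots> = (\<Sum>i\<in>UNIV. \<Sum>v\<in>V. real (\<omega> v) * (c i * \<bar>real_of_int (v $ i)\<bar>))"
    by (simp add: coord_sum_nth[OF assms] sum_distrib_left algebra_simps)
  also have "\<dots> = (\<Sum>v\<in>V. real (\<omega> v) * weight c v)"
    by (subst sum.swap) (simp add: weight_def sum_distrib_left)
  finally show ?thesis .
qed

lemma coord_sum_nonneg: "finite {v. \<omega> v \<noteq> 0} \<Longrightarrow> coord_sum \<omega> $ i \<ge> 0"
  by (subst coord_sum_nth[OF _ order.refl]) (auto intro: sum_nonneg)

lemma multiplicity_functionD:
  "multiplicity_function \<omega> \<Longrightarrow> finite {v. \<omega> v \<noteq> 0}"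
  "multiplicity_function \<omega> \<Longrightarrow> \<omega> v \<noteq> 0 \<Longrightarrow> v \<in> primitive_vectors"
  by (auto simp: multiplicity_function_def)

lemma coord_sum_add:
  assumes "finite {v. \<omega> v \<noteq> 0}" "finite {v. \<omega>' v \<noteq> 0}"
  shows "coord_sum (\<lambda>v. \<omega> v + \<omega>' v) = coord_sum \<omega> + coord_sum \<omega>'"
proof -
  let ?V = "{v. \<omega> v \<noteq> 0} \<union> {v. \<omega>' v \<noteq> 0}"
  have f: "finite ?V" using assms by auto
  show ?thesis
    by (subst (1 2 3) coord_sum_eq_sum[OF f])
       (auto simp: vec_eq_iff sum_component sum.distrib algebra_simps)
qed

lemma coord_sum_single: "coord_sum (\<lambda>v. if v = p then k else 0) = int k *s vabs p"
  by (subst coord_sum_eq_sum[of "{p}"]) auto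

text \<open>This is what makes the counts monotone.\<close>

lemma axis_primitive: "axis i 1 \<in> (primitive_vectors :: (int ^ 'd::{finite,linorder}) set)"
proof -
  have "Gcd (range (\<lambda>j. axis i 1 $ j :: int)) dvd axis i 1 $ i" by (rule Gcd_dvd) (rule rangeI)
  hence "Gcd (range (\<lambda>j. axis i 1 $ j :: int)) = 1"
    by (simp add: axis_def)
  moreover have "\<exists>k. (axis i 1 :: (int, 'd) vec) $ k > 0 \<and> (\<forall>j<k. (axis i 1 :: (int, 'd) vec) $ j = 0)"
    by (rule exI[of _ i]) (auto simp: axis_def)
  ultimately show ?thesis by (auto simp: primitive_vectors_def axis_eq_0_iff)
qed

lemma abs_le_coord_sum:
  assumes "multiplicity_function \<omega>" "\<omega> v \<noteq> 0"
  shows "int (\<omega> v) * \<bar>v $ i\<bar> \<le> coord_sum \<omega> $ i"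
  using assms multiplicity_functionD(1)[OF assms(1)]
  by (subst coord_sum_nth[OF _ order.refl]) (auto intro!: member_le_sum[of v, where f = "\<lambda>v. int (\<omega> v) * \<bar>v $ i\<bar>"])

lemma finite_int_vec_box: "finite {v :: int ^ 'd::finite. \<forall>i. v $ i \<in> S i}" if "\<And>i. finite (S i)"
proof -
  have "{v :: int ^ 'd::finite. \<forall>i. v $ i \<in> S i} \<subseteq> vec_lambda ` (PiE UNIV S)"
    by (auto intro!: image_eqI[where x = "\<lambda>i. _ $ i"] simp: PiE_def)
  thus ?thesis by (rule finite_subset) (intro finite_imageI finite_PiE that, auto)
qed

text \<open>Every copy of a generator uses up a unit in some coordinate of \<open>N\<close>, which bounds both the generators
  that can occur and their multiplicities.\<close>

lemma finite_with_total [simp]: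
  fixes N :: "int ^ 'd::{finite,linorder}"
  shows "finite (with_total N)"
proof -
  define V where "V = {v :: (int, 'd) vec. \<forall>i. v $ i \<in> {-\<bar>N $ i\<bar>..\<bar>N $ i\<bar>}}"
  define K where "K = nat (\<Sum>i\<in>UNIV. \<bar>N $ i\<bar>)"
  have V: "finite V" unfolding V_def by (rule finite_int_vec_box) auto
  have "with_total N \<subseteq> {\<omega>. \<forall>v. (v \<in> V \<longrightarrow> \<omega> v \<in> {..K}) \<and> (v \<notin> V \<longrightarrow> \<omega> v = 0)}"
  proof (clarify, intro conjI impI)
    fix \<omega> v assume w: "\<omega> \<in> with_total N"
    hence mf: "multiplicity_function \<omega>" and N: "coord_sum \<omega> = N" by (auto simp: with_total_def)
    show "\<omega> v \<in> {..K}"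
    proof (cases "\<omega> v = 0")
      case False
      then obtain i where i: "v $ i \<noteq> 0"
        using multiplicity_functionD(2)[OF mf False] by (auto simp: primitive_vectors_def vec_eq_iff)
      have "int (\<omega> v) * 1 \<le> int (\<omega> v) * \<bar>v $ i\<bar>" using i by (intro mult_left_mono) auto
      also have "\<dots> \<le> \<bar>N $ i\<bar>" using abs_le_coord_sum[OF mf False, of i] N by simp
      also have "\<dots> \<le> (\<Sum>i\<in>UNIV. \<bar>N $ i\<bar>)" by (intro member_le_sum) auto
      finally show ?thesis by (simp add: K_def)
    qed auto
    assume "v \<notin> V"
    show "\<omega> v = 0"
    proof (rule ccontr)
      assume nz: "\<omega> v \<noteq> 0"
      have "\<bar>v $ i\<bar> \<le> \<bar>N $ i\<bar>" for i
      proof -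
        have "1 * \<bar>v $ i\<bar> \<le> int (\<omega> v) * \<bar>v $ i\<bar>" using nz by (intro mult_right_mono) auto
        thus ?thesis using abs_le_coord_sum[OF mf nz, of i] N by simp
      qed
      hence "v \<in> V" unfolding V_def by (simp add: abs_le_iff) (metis minus_le_iff)
      with \<open>v \<notin> V\<close> show False by simp
    qed
  qed
  thus ?thesis by (rule finite_subset) (intro finite_set_of_finite_funs V, auto)
qed

text \<open>Removing \<open>k\<close> copies of \<open>p\<close> is a bijection. This turns tail probabilities of a multiplicity into ratios of counts.\<close>

lemma card_multiplicity_ge:
  assumes "p \<in> primitive_vectors"
  shows "real (card {\<omega> \<in> with_total N. \<omega> p \<ge> k}) = zono_count (N - int k *s vabs p)"
proof -
  let ?s = "\<lambda>v. if v = p then k else 0"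
  have fs: "finite {v. ?s v \<noteq> 0}" by (rule finite_subset[of _ "{p}"]) auto
  have add: "multiplicity_function (\<lambda>v. \<omega> v + ?s v) \<and> coord_sum (\<lambda>v. \<omega> v + ?s v) = coord_sum \<omega> + int k *s vabs p"
    if "multiplicity_function \<omega>" for \<omega>
  proof
    have "{v. \<omega> v + ?s v \<noteq> 0} \<subseteq> insert p {v. \<omega> v \<noteq> 0}" by auto
    thus "multiplicity_function (\<lambda>v. \<omega> v + ?s v)" using that assms
      by (auto simp: multiplicity_function_def intro: finite_subset split: if_splits)
    show "coord_sum (\<lambda>v. \<omega> v + ?s v) = coord_sum \<omega> + int k *s vabs p"
      using coord_sum_add[OF multiplicity_functionD(1)[OF that] fs] coord_sum_single[of p k] by simp
  qed
  have "bij_betw (\<lambda>\<omega> v. \<omega> v + ?s v) (with_total (N - int k *s vabs p)) {\<omega> \<in> with_total N. \<omega> p \<ge> k}"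
  proof (rule bij_betwI[where g = "\<lambda>\<omega> v. \<omega> v - ?s v"])
    show "(\<lambda>\<omega> v. \<omega> v + ?s v) \<in> with_total (N - int k *s vabs p) \<rightarrow> {\<omega> \<in> with_total N. \<omega> p \<ge> k}"
      using add by (auto simp: with_total_def)
    show "(\<lambda>\<omega> v. \<omega> v - ?s v) \<in> {\<omega> \<in> with_total N. \<omega> p \<ge> k} \<rightarrow> with_total (N - int k *s vabs p)"
    proof
      fix \<omega> assume w: "\<omega> \<in> {\<omega> \<in> with_total N. \<omega> p \<ge> k}"
      hence "multiplicity_function \<omega>" by (simp add: with_total_def)
      moreover have "{v. \<omega> v - ?s v \<noteq> 0} \<subseteq> {v. \<omega> v \<noteq> 0}" by auto
      ultimately have mf: "multiplicity_function (\<lambda>v. \<omega> v - ?s v)"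
        unfolding multiplicity_function_def by (meson finite_subset order.trans)
      have eq: "(\<lambda>v. (\<omega> v - ?s v) + ?s v) = \<omega>" using w by auto
      have "coord_sum \<omega> = coord_sum (\<lambda>v. \<omega> v - ?s v) + int k *s vabs p"
        using add[OF mf] unfolding eq by simp
      thus "(\<lambda>v. \<omega> v - ?s v) \<in> with_total (N - int k *s vabs p)"
        using mf w by (auto simp: with_total_def algebra_simps)
    qed
  qed auto
  thus ?thesis by (simp add: zono_count_def bij_betw_same_card)
qed

lemma zono_count_add_axis_le:
  fixes N :: "int ^ 'd::{finite,linorder}"
  shows "zono_count N \<le> zono_count (N + int k *s axis i 1)"
proof -
  have "vabs (axis i 1) = (axis i 1 :: (int, 'd) vec)" by (simp add: vec_eq_iff axis_def)
  hence "zono_count N = real (card {\<omega> \<in> with_total (N + int k *s axis i 1). \<omega> (axis i 1) \<ge> k})"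
    by (simp add: card_multiplicity_ge[OF axis_primitive])
  also have "\<dots> \<le> zono_count (N + int k *s axis i 1)"
    unfolding zono_count_def of_nat_le_iff by (intro card_mono) auto
  finally show ?thesis .
qed

text \<open>Adding \<open>M - N\<close> in copies of the axis vectors is injective.\<close>

lemma zono_count_mono:
  assumes "\<And>i. N $ i \<le> M $ i"
  shows "zono_count N \<le> zono_count M"
proof -
  have "zono_count N \<le> zono_count (N + (\<Sum>i\<in>I. int (nat (M $ i - N $ i)) *s axis i 1))" if "finite I" for I
    using that
  proof (induction I rule: finite_induct)
    case (insert j I)
    show ?case
      using order.trans[OF insert.IH zono_count_add_axis_le[where k = "nat (M $ j - N $ j)" and i = j]] insert.hyps
      by (simp add: add_ac)
  qed simp
  from this[of UNIV] have "zono_count N \<le> zono_count (N + (\<Sum>i\<in>UNIV. int (nat (M $ i - N $ i)) *s axis i 1))" by simp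
  also have "N + (\<Sum>i\<in>UNIV. int (nat (M $ i - N $ i)) *s axis i 1) = M"
  proof (subst vec_eq_iff, safe)
    fix j
    have "(\<Sum>i\<in>UNIV. int (nat (M $ i - N $ i)) * axis i 1 $ j) = (\<Sum>i\<in>{j}. int (nat (M $ i - N $ i)) * axis i 1 $ j)"
      by (rule sum.mono_neutral_right) (auto simp: axis_def)
    thus "(N + (\<Sum>i\<in>UNIV. int (nat (M $ i - N $ i)) *s axis i 1)) $ j = M $ j"
      using assms[of j] by (simp add: sum_component)
  qed
  finally show ?thesis .
qed

lemma zono_count_eq_0:
  assumes "N $ i < 0" shows "zono_count N = 0"
proof -
  have "with_total N = {}"
    using assms coord_sum_nonneg[OF multiplicity_functionD(1)] by (fastforce simp: with_total_def not_le[symmetric])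
  thus ?thesis by (simp add: zono_count_def)
qed

lemma zono_count_nonneg: "zono_count N \<ge> 0" by (simp add: zono_count_def)

lemma zono_count_0_ge: "zono_count (0 :: int ^ 'd::{finite,linorder}) \<ge> 1"
proof -
  have "(\<lambda>_. 0) \<in> with_total (0 :: (int, 'd) vec)"
    by (simp add: with_total_def multiplicity_function_def coord_sum_def)
  hence "card (with_total (0 :: (int, 'd) vec)) > 0" by (subst card_gt_0_iff) auto
  thus ?thesis by (simp add: zono_count_def)
qed

lemma zono_count_ge_1:
  fixes N :: "int ^ 'd::{finite,linorder}"
  assumes "\<And>i. N $ i \<ge> 0" shows "zono_count N \<ge> 1"
proof -
  have "zono_count (0 :: (int, 'd) vec) \<le> zono_count N" using assms by (intro zono_count_mono) auto
  with zono_count_0_ge show ?thesis by (rule order.trans)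
qed

section \<open>The generating function near zero\<close>

text \<open>One vector of each pair of nonzero opposite vectors.\<close>

definition half_space :: "(int ^ 'd::{finite,linorder}) set" where
  "half_space = {m. \<exists>i. m $ i > 0 \<and> (\<forall>j<i. m $ j = 0)}"

lemma primitive_vectors_eq: "primitive_vectors = {v \<in> half_space. Gcd (range (\<lambda>i. v $ i)) = 1}"
  by (auto simp: primitive_vectors_def half_space_def)

lemma Gcd_range_smult: "Gcd (range (\<lambda>i. (k *s v) $ i)) = \<bar>k\<bar> * Gcd (range (\<lambda>i. (v :: int ^ 'd::finite) $ i))"
proof -
  have "range (\<lambda>i. (k *s v) $ i) = (*) k ` range (\<lambda>i. v $ i)" by auto
  thus ?thesis by (simp add: Gcd_mult abs_mult del: Gcd_image_normalize)
qed

lemma half_space_smult: "k > 0 \<Longrightarrow> k *s v \<in> half_space \<longleftrightarrow> v \<in> half_space"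
  by (simp add: half_space_def zero_less_mult_iff)

text \<open>Division by the greatest common divisor of the coordinates. The multiple is written \<open>Suc k\<close> to range over the
  positive integers.\<close>

lemma bij_betw_half_space:
  "bij_betw (\<lambda>(k, v). int (Suc k) *s v) (UNIV \<times> primitive_vectors)
     (half_space :: (int ^ 'd::{finite,linorder}) set)"
  unfolding bij_betw_def
proof
  show "inj_on (\<lambda>(k, v). int (Suc k) *s v) (UNIV \<times> (primitive_vectors :: ((int, 'd) vec) set))"
  proof (rule inj_onI, clarify)
    fix k v l w
    assume *: "v \<in> (primitive_vectors :: ((int, 'd) vec) set)" "w \<in> primitive_vectors"
      and eq: "int (Suc k) *s v = int (Suc l) *s w"
    have "int (Suc k) = int (Suc l)"
      using * arg_cong[OF eq, of "\<lambda>v. Gcd (range (\<lambda>i. v $ i))"]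
      unfolding Gcd_range_smult by (simp add: primitive_vectors_eq)
    moreover from this have "v = w" using eq by (simp add: vec_eq_iff del: of_nat_Suc)
    ultimately show "k = l \<and> v = w" by auto
  qed
  show "(\<lambda>(k, v). int (Suc k) *s v) ` (UNIV \<times> primitive_vectors) = (half_space :: ((int, 'd) vec) set)"
  proof (intro equalityI subsetI)
    fix m :: "(int, 'd) vec" assume m: "m \<in> half_space"
    define g where "g = Gcd (range (\<lambda>i. m $ i))"
    define v where "v = (\<chi> i. m $ i div g)"
    have "g \<noteq> 0"
    proof
      assume "g = 0"
      hence "m $ i = 0" for i using rangeI[of "($) m" i] by (auto simp: g_def Gcd_0_iff)
      thus False using m by (auto simp: half_space_def)
    qed
    hence g: "g > 0" using Gcd_int_greater_eq_0[of "range (\<lambda>i. m $ i)"] by (simp add: g_def less_le)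
    have mv: "m = g *s v" by (auto simp: vec_eq_iff v_def g_def)
    have "g = g * Gcd (range (\<lambda>i. v $ i))"
      using arg_cong[OF mv, of "\<lambda>v. Gcd (range (\<lambda>i. v $ i))"] g unfolding Gcd_range_smult by (simp add: g_def)
    hence "v \<in> primitive_vectors" using g m half_space_smult[OF g, of v] mv
      by (auto simp: primitive_vectors_eq)
    moreover have "int (Suc (nat (g - 1))) = g" using g by simp
    ultimately show "m \<in> (\<lambda>(k, v). int (Suc k) *s v) ` (UNIV \<times> primitive_vectors)"
      by (intro image_eqI[of _ _ "(nat (g - 1), v)"]) (auto simp: mv)
  next
    fix m :: "(int, 'd) vec" assume "m \<in> (\<lambda>(k, v). int (Suc k) *s v) ` (UNIV \<times> primitive_vectors)"
    thus "m \<in> half_space" using half_space_smult[of "int (Suc _)"]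
      by (auto simp: primitive_vectors_eq simp del: of_nat_Suc)
  qed
qed

lemma weight_nonneg: "(\<And>i. c i \<ge> 0) \<Longrightarrow> weight c v \<ge> 0"
  by (auto simp: weight_def intro!: sum_nonneg)

lemma weight_ge: "(\<And>i. c i \<ge> 0) \<Longrightarrow> c i * \<bar>real_of_int (v $ i)\<bar> \<le> weight c v"
  unfolding weight_def by (rule member_le_sum) auto

lemma weight_smult: "weight c (int k *s v) = real k * weight c v"
  by (simp add: weight_def sum_distrib_left abs_mult algebra_simps)

lemma weight_scale: "weight (\<lambda>i. s * c i) v = s * weight c v"
  by (simp add: weight_def sum_distrib_left algebra_simps)

lemma weight_pos:
  assumes "\<And>i. c i > 0" "v \<in> primitive_vectors"
  shows "weight c v > 0"
proof -
  from assms obtain i where i: "v $ i > 0" by (auto simp: primitive_vectors_def)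
  have "0 < c i * \<bar>real_of_int (v $ i)\<bar>" using i assms by simp
  also have "\<dots> \<le> weight c v" by (intro weight_ge less_imp_le assms)
  finally show ?thesis .
qed

lemma has_sum_exp_abs_int:
  fixes x :: real assumes x: "x > 0"
  shows "((\<lambda>j::int. exp (- x * \<bar>real_of_int j\<bar>)) has_sum ((1 + exp (-x)) / (1 - exp (-x)))) UNIV"
proof -
  define q where "q = exp (-x)"
  have q: "0 < q" "q < 1" using x by (auto simp: q_def)
  have exp_q: "exp (- (x * real n)) = q ^ n" for n
    by (simp add: q_def exp_of_nat_mult[symmetric] mult.commute)
  have "(\<lambda>n. q ^ n) sums (1 / (1 - q))" using q by (intro geometric_sums) auto
  hence g: "((\<lambda>n. q ^ n) has_sum (1 / (1 - q))) UNIV" using q by (intro sums_nonneg_imp_has_sum) auto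
  have 1: "((\<lambda>j::int. exp (- x * \<bar>real_of_int j\<bar>)) has_sum (1 / (1 - q))) (range int)"
    using g by (subst has_sum_reindex) (auto simp: o_def exp_q)
  have g2: "((\<lambda>n. q * q ^ n) has_sum (q * (1 / (1 - q)))) UNIV" using g by (rule has_sum_cmult_right)
  have 2: "((\<lambda>j::int. exp (- x * \<bar>real_of_int j\<bar>)) has_sum (q / (1 - q))) (range (\<lambda>n. - int (Suc n)))"
  proof (subst has_sum_reindex)
    show "inj (\<lambda>n. - int (Suc n))" by (auto simp: inj_on_def)
    have "exp (- x * \<bar>real_of_int (- int (Suc n))\<bar>) = q * q ^ n" for n
      using exp_q[of "Suc n"] by (simp add: algebra_simps)
    thus "((\<lambda>j::int. exp (- x * \<bar>real_of_int j\<bar>)) \<circ> (\<lambda>n. - int (Suc n)) has_sum q / (1 - q)) UNIV"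
      using g2 by (simp add: o_def)
  qed
  have U: "range int \<union> range (\<lambda>n. - int (Suc n)) = UNIV"
  proof (intro equalityI subsetI)
    fix j :: int show "j \<in> range int \<union> range (\<lambda>n. - int (Suc n))"
      by (cases j) (auto simp del: of_nat_Suc)
  qed auto
  have "((\<lambda>j::int. exp (- x * \<bar>real_of_int j\<bar>)) has_sum (1 / (1 - q) + q / (1 - q)))
     (range int \<union> range (\<lambda>n. - int (Suc n)))"
    using 1 2 by (rule has_sum_Un_disjoint) auto
  thus ?thesis unfolding U by (simp add: q_def add_divide_distrib)
qed

text \<open>The sum is a product of one sum per coordinate. As this product is positive, it differs from the default
  value 0 of a divergent sum, and summability follows.\<close>

lemma has_sum_exp_weight_UNIV:
  fixes c :: "'d::finite \<Rightarrow> real"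
  assumes c: "\<And>i. c i > 0"
  shows "((\<lambda>m::int ^ 'd::finite. exp (- weight c m)) has_sum
           (\<Prod>i\<in>UNIV. (1 + exp (- c i)) / (1 - exp (- c i)))) UNIV"
proof -
  let ?f = "\<lambda>i j. exp (- c i * \<bar>real_of_int j\<bar>)"
  let ?S = "\<Prod>i\<in>UNIV. (1 + exp (- c i)) / (1 - exp (- c i))"
  have f: "(?f i has_sum ((1 + exp (- c i)) / (1 - exp (- c i)))) UNIV" for i
    by (rule has_sum_exp_abs_int) (rule c)
  have "infsum (\<lambda>g. \<Prod>i\<in>UNIV. ?f i (g i)) (PiE UNIV (\<lambda>_. UNIV)) = (\<Prod>i\<in>UNIV. infsum (?f i) UNIV)"
    using f by (intro infsum_prod_PiE_abs) (auto intro: has_sum_imp_summable simp: summable_on_iff_abs_summable_on_real[symmetric])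
  also have "\<dots> = ?S" using f by (intro prod.cong) (auto simp: infsumI)
  finally have eq: "infsum (\<lambda>g. \<Prod>i\<in>UNIV. ?f i (g i)) UNIV = ?S" by simp
  have "?S > 0" using c by (intro prod_pos divide_pos_pos) (auto intro: add_pos_pos)
  hence "(\<lambda>g. \<Prod>i\<in>UNIV. ?f i (g i)) summable_on UNIV"
    using eq infsum_not_exists by fastforce
  with eq have hs: "((\<lambda>g. \<Prod>i\<in>UNIV. ?f i (g i)) has_sum ?S) UNIV" by (simp add: has_sum_iff)
  have bij: "bij_betw (\<lambda>(m :: (int, 'd) vec) i. m $ i) UNIV UNIV"
    by (rule bij_betwI[of _ _ _ vec_lambda]) auto
  have "((\<lambda>m::(int, 'd) vec. \<Prod>i\<in>UNIV. ?f i (m $ i)) has_sum ?S) UNIV"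
    using has_sum_reindex_bij_betw[OF bij, of "\<lambda>g. \<Prod>i\<in>UNIV. ?f i (g i)"] hs by simp
  moreover have "(\<Prod>i\<in>UNIV. ?f i (m $ i)) = exp (- weight c m)" for m :: "(int, 'd) vec"
    by (simp add: weight_def exp_sum[symmetric] sum_negf)
  ultimately show ?thesis by simp
qed

lemma half_space_cases:
  "UNIV = insert 0 (half_space \<union> uminus ` (half_space :: (int ^ 'd::{finite,linorder}) set))"
proof (intro equalityI subsetI)
  fix m :: "(int, 'd) vec"
  show "m \<in> insert 0 (half_space \<union> uminus ` half_space)"
  proof (cases "m = 0")
    case False
    hence ne: "{i. m $ i \<noteq> 0} \<noteq> {}" by (auto simp: vec_eq_iff)
    define i where "i = Min {i. m $ i \<noteq> 0}"
    have i: "m $ i \<noteq> 0" using Min_in[OF _ ne] by (auto simp: i_def)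
    have j: "m $ j = 0" if "j < i" for j
      using that Min_le[of "{i. m $ i \<noteq> 0}" j] by (auto simp: i_def not_le[symmetric])
    show ?thesis
    proof (cases "m $ i > 0")
      case True thus ?thesis using j by (auto simp: half_space_def)
    next
      case False
      hence "- m \<in> half_space" using i j by (auto simp: half_space_def intro!: exI[of _ i])
      hence "m \<in> uminus ` half_space" by (metis image_eqI minus_minus)
      thus ?thesis by simp
    qed
  qed simp
qed auto

lemma half_space_disjoint: "half_space \<inter> uminus ` half_space = {}" "0 \<notin> half_space"
proof -
  show "half_space \<inter> uminus ` half_space = {}"
  proof (safe)
    fix m assume "- m \<in> half_space" "m \<in> half_space"
    then obtain i j where i: "m $ i > 0" "\<forall>k<i. m $ k = 0" and j: "- m $ j > 0" "\<forall>k<j. m $ k = 0"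
      by (auto simp: half_space_def)
    thus "- m \<in> {}" by (cases i j rule: linorder_cases) auto
  qed
qed (auto simp: half_space_def)

text \<open>The sum over the half space in closed form: the sum over the whole lattice, less the term of the origin, halved.\<close>

definition half_sum :: "('d::{finite,linorder} \<Rightarrow> real) \<Rightarrow> real" where
  "half_sum c = ((\<Prod>i\<in>UNIV. (1 + exp (- c i)) / (1 - exp (- c i))) - 1) / 2"

lemma has_sum_exp_weight_half_space:
  fixes c :: "'d::{finite,linorder} \<Rightarrow> real"
  assumes c: "\<And>i. c i > 0"
  shows "((\<lambda>m. exp (- weight c m)) has_sum half_sum c) half_space"
proof -
  let ?f = "\<lambda>m::(int, 'd) vec. exp (- weight c m)"
  note U = has_sum_exp_weight_UNIV[of c, OF c]
  have "?f summable_on (half_space :: ((int, 'd) vec) set)"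
    using has_sum_imp_summable[OF U] by (rule summable_on_subset) auto
  then obtain H where H: "(?f has_sum H) half_space" by (auto simp: summable_on_def)
  have w: "weight c (- m) = weight c m" for m by (simp add: weight_def)
  have H': "(?f has_sum H) (uminus ` half_space)"
    using H by (subst has_sum_reindex) (auto simp: o_def w)
  have "(?f has_sum (H + H)) (half_space \<union> uminus ` half_space)"
    by (rule has_sum_Un_disjoint[OF H H' half_space_disjoint(1)])
  moreover have "0 \<notin> half_space \<union> uminus ` (half_space :: (int, 'd) vec set)"
    using half_space_disjoint(2) by force
  ultimately have "(?f has_sum (?f 0 + (H + H))) (insert 0 (half_space \<union> uminus ` half_space))"
    by (rule has_sum_insert[rotated])
  hence "(?f has_sum (1 + (H + H))) UNIV"
    unfolding half_space_cases[symmetric] by (simp add: weight_def)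
  from has_sum_unique[OF this U] have "H = half_sum c" by (simp add: half_sum_def)
  with H show ?thesis by simp
qed

definition primitive_sum :: "('d::{finite,linorder} \<Rightarrow> real) \<Rightarrow> real" where
  "primitive_sum c = (\<Sum>\<^sub>\<infinity>v\<in>primitive_vectors. exp (- weight c v))"

lemma has_sum_primitive_sum:
  assumes c: "\<And>i. c i > 0"
  shows "((\<lambda>v. exp (- weight c v)) has_sum primitive_sum c) primitive_vectors"
proof -
  have "(\<lambda>m. exp (- weight c m)) summable_on primitive_vectors"
    using has_sum_imp_summable[OF has_sum_exp_weight_half_space[of c, OF c]]
    by (rule summable_on_subset) (auto simp: primitive_vectors_eq)
  thus ?thesis by (simp add: primitive_sum_def)
qed

lemma primitive_sum_nonneg: "primitive_sum c \<ge> 0"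
  unfolding primitive_sum_def by (rule infsum_nonneg) auto

lemma has_sum_multiples:
  assumes c: "\<And>i. c i > 0"
  shows "((\<lambda>(k, v). exp (- (real (Suc k) * weight c v))) has_sum half_sum c) (UNIV \<times> primitive_vectors)"
proof -
  have "((\<lambda>x. exp (- weight c (case x of (k, v) \<Rightarrow> int (Suc k) *s v))) has_sum half_sum c)
     (UNIV \<times> primitive_vectors)"
    by (rule iffD2[OF has_sum_reindex_bij_betw[OF bij_betw_half_space, of "\<lambda>m. exp (- weight c m)"]
      has_sum_exp_weight_half_space[of c, OF c]])
  thus ?thesis by (simp only: case_prod_unfold weight_smult)
qed

lemma has_sum_primitive_sum_scaled:
  assumes c: "\<And>i. c i > 0" and s: "s > 0"
  shows "((\<lambda>v. exp (- (s * weight c v))) has_sum primitive_sum (\<lambda>i. s * c i)) primitive_vectors"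
  using has_sum_primitive_sum[of "\<lambda>i. s * c i"] c s by (simp add: weight_scale)

text \<open>The half space is sorted by the greatest common divisor of the coordinates.\<close>

lemma primitive_sum_sums:
  assumes c: "\<And>i. c i > 0"
  shows "(\<lambda>k. primitive_sum (\<lambda>i. real (Suc k) * c i)) sums half_sum c"
proof -
  have "((\<lambda>k. primitive_sum (\<lambda>i. real (Suc k) * c i)) has_sum half_sum c) UNIV"
    using has_sum_SigmaD[OF has_sum_multiples[of c, OF c]] has_sum_primitive_sum_scaled[of c, OF c] by simp
  thus ?thesis by (rule has_sum_imp_sums)
qed

text \<open>Minus the logarithm of the Euler product of \<open>1 - exp (- weight c v)\<close>, which is the logarithm of the generating
  function of multiplicity functions.\<close>

definition log_gf :: "('d::{finite,linorder} \<Rightarrow> real) \<Rightarrow> real" where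
  "log_gf c = (\<Sum>\<^sub>\<infinity>v\<in>primitive_vectors. - ln (1 - exp (- weight c v)))"

lemma minus_ln_one_minus_sums:
  fixes x :: real assumes "0 < x" "x < 1"
  shows "(\<lambda>k. x ^ Suc k / real (Suc k)) sums (- ln (1 - x))"
proof -
  have s: "summable (\<lambda>k. x ^ Suc k / real (Suc k))"
  proof (rule summable_comparison_test[of _ "\<lambda>k. x ^ k"])
    show "\<exists>N. \<forall>n\<ge>N. norm (x ^ Suc n / real (Suc n)) \<le> x ^ n"
    proof (intro exI allI impI)
      fix n
      have "x ^ Suc n / real (Suc n) \<le> x ^ n / 1"
        using assms by (intro frac_le) (auto simp: mult_left_le_one_le)
      thus "norm (x ^ Suc n / real (Suc n)) \<le> x ^ n" using assms by simp
    qed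
  qed (use assms in auto)
  have "ln (1 - x) = (\<Sum>n. (-1)^n * (1 / real (n + 1)) * ((1 - x) - 1)^(Suc n))"
    using assms by (intro ln_series) auto
  also have "(\<lambda>n. (-1)^n * (1 / real (n + 1)) * ((1 - x) - 1)^(Suc n)) = (\<lambda>k. - (x ^ Suc k / real (Suc k)))"
  proof
    fix n
    have "(-1)^n * ((1 - x) - 1)^n = x ^ n" by (simp add: power_mult_distrib[symmetric])
    hence "(-1)^n * ((1 - x) - 1)^(Suc n) = - (x ^ Suc n)" by simp
    thus "(-1)^n * (1 / real (n + 1)) * ((1 - x) - 1)^(Suc n) = - (x ^ Suc n / real (Suc n))"
      by (simp add: field_simps)
  qed
  also have "(\<Sum>k. - (x ^ Suc k / real (Suc k))) = - (\<Sum>k. x ^ Suc k / real (Suc k))"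
    by (rule suminf_minus[OF s])
  finally show ?thesis using s by (simp add: sums_iff)
qed

text \<open>The logarithm is expanded into its power series, and the double series, dominated by that over the half space, is summed
  in the other order.\<close>

lemma log_gf_sums:
  fixes c :: "'d::{finite,linorder} \<Rightarrow> real"
  assumes c: "\<And>i. c i > 0"
  shows "(\<lambda>v. - ln (1 - exp (- weight c v))) summable_on primitive_vectors"
    and "(\<lambda>k. primitive_sum (\<lambda>i. real (Suc k) * c i) / real (Suc k)) sums log_gf c"
proof -
  let ?f = "\<lambda>(k, v). exp (- (real (Suc k) * weight c v)) / real (Suc k)"
  have "?f summable_on (UNIV \<times> primitive_vectors)"
    using has_sum_imp_summable[OF has_sum_multiples[of c, OF c]]
    by (rule summable_on_comparison_test) (auto simp: field_simps)
  then obtain S where S: "(?f has_sum S) (UNIV \<times> primitive_vectors)" by (auto simp: summable_on_def)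
  have S': "((\<lambda>(v, k). exp (- (real (Suc k) * weight c v)) / real (Suc k)) has_sum S) (primitive_vectors \<times> UNIV)"
    using S by (subst has_sum_swap) (simp add: case_prod_unfold)
  have "((\<lambda>v. - ln (1 - exp (- weight c v))) has_sum S) primitive_vectors"
  proof (rule has_sum_SigmaD[OF S'])
    fix v assume "v \<in> (primitive_vectors :: ((int, 'd) vec) set)"
    hence w: "weight c v > 0" by (intro weight_pos c)
    have "(\<lambda>k. exp (- weight c v) ^ Suc k / real (Suc k)) sums (- ln (1 - exp (- weight c v)))"
      using w by (intro minus_ln_one_minus_sums) auto
    moreover have "exp (- weight c v) ^ Suc k = exp (- (real (Suc k) * weight c v))" for k
      by (subst exp_of_nat_mult[symmetric]) simp
    ultimately show "((\<lambda>k. case (v, k) of (v, k) \<Rightarrow> exp (- (real (Suc k) * weight c v)) / real (Suc k)) has_sum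
        - ln (1 - exp (- weight c v))) UNIV"
      by (intro sums_nonneg_imp_has_sum) auto
  qed
  hence *: "(\<lambda>v. - ln (1 - exp (- weight c v))) summable_on primitive_vectors" "log_gf c = S"
    by (auto simp: has_sum_iff log_gf_def)
  show "(\<lambda>v. - ln (1 - exp (- weight c v))) summable_on primitive_vectors" by (rule *)
  have "((\<lambda>k. primitive_sum (\<lambda>i. real (Suc k) * c i) / real (Suc k)) has_sum S) UNIV"
  proof (rule has_sum_SigmaD[OF S])
    fix k :: nat
    show "((\<lambda>v. case (k, v) of (k, v) \<Rightarrow> exp (- (real (Suc k) * weight c v)) / real (Suc k)) has_sum
        primitive_sum (\<lambda>i. real (Suc k) * c i) / real (Suc k)) primitive_vectors"
      using has_sum_divide_const[OF has_sum_primitive_sum_scaled[of c "real (Suc k)", OF c], of "real (Suc k)"] by simp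
  qed
  thus "(\<lambda>k. primitive_sum (\<lambda>i. real (Suc k) * c i) / real (Suc k)) sums log_gf c"
    unfolding *(2) by (rule has_sum_imp_sums)
qed

lemma pow_exp_bound:
  fixes x :: real assumes "x \<ge> 0" "n > 0"
  shows "x ^ n \<le> real n ^ n * exp x"
proof -
  have "(x / real n) ^ n \<le> (1 + x / real n) ^ n" using assms by (intro power_mono) auto
  also have "\<dots> \<le> exp x" using assms by (intro exp_ge_one_plus_x_over_n_power_n) auto
  finally show ?thesis using assms by (simp add: power_divide field_simps)
qed

lemma zeta_sums:
  assumes "n \<ge> 2"
  shows "(\<lambda>k. 1 / real (Suc k) ^ n) sums zeta (real n)"
proof -
  have "summable (\<lambda>k. 1 / real k ^ n)" using inverse_power_summable[OF assms, where 'a=real]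
    by (simp add: field_simps)
  hence "summable (\<lambda>k. 1 / real (Suc k) ^ n)" by (subst summable_Suc_iff)
  moreover have "(\<lambda>m. 1 / real (Suc m) powr real n) = (\<lambda>k. 1 / real (Suc k) ^ n)"
    by (intro ext) (subst powr_realpow, auto)
  ultimately show ?thesis unfolding zeta_def by (simp add: sums_iff)
qed

text \<open>The strict inequality \<open>\<zeta> n < 2\<close> is the contraction needed to invert the sum over multiples.\<close>

lemma zeta_tail:
  assumes n: "n \<ge> 2"
  shows "summable (\<lambda>k. 1 / real (k + 2) ^ n)" "(\<Sum>k. 1 / real (k + 2) ^ n) < 1"
    "zeta (real n) = 1 + (\<Sum>k. 1 / real (k + 2) ^ n)"
proof -
  have "(\<lambda>k. 1 / real (Suc (Suc k)) ^ n) sums (zeta (real n) - 1)"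
    using zeta_sums[OF n] by (subst sums_Suc_iff) auto
  moreover have S: "Suc (Suc k) = k + 2" for k by simp
  ultimately have s: "(\<lambda>k. 1 / real (k + 2) ^ n) sums (zeta (real n) - 1)" by (simp only: S)
  show sm: "summable (\<lambda>k. 1 / real (k + 2) ^ n)" using s by (rule sums_summable)
  show "zeta (real n) = 1 + (\<Sum>k. 1 / real (k + 2) ^ n)" using s by (simp add: sums_iff)
  have "(\<Sum>k<K. 1 / real (k + 2) ^ n) \<le> 3/4" for K
  proof -
    have "(\<Sum>k<K. 1 / real (k + 2) ^ n) \<le> (\<Sum>k<K. 1 / real (k + 2) ^ 2)"
      using n by (intro sum_mono divide_left_mono power_increasing) auto
    also have "\<dots> \<le> (\<Sum>k<Suc K. 1 / real (k + 2) ^ 2)" by simp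
    also have "\<dots> = (\<Sum>g=2..K+2. 1 / real g ^ 2)"
      by (rule sum.reindex_bij_witness[of _ "\<lambda>g. g - 2" "\<lambda>k. k + 2"]) auto
    also have "\<dots> \<le> 3/4 - 1 / real (K+2)" by (rule sum_inverse_squares_le) simp
    also have "\<dots> \<le> 3/4" by simp
    finally show ?thesis .
  qed
  hence "(\<Sum>k. 1 / real (k + 2) ^ n) \<le> 3/4" by (intro suminf_le_const sm)
  thus "(\<Sum>k. 1 / real (k + 2) ^ n) < 1" by simp
qed

lemma weight_lower_bound:
  assumes c: "\<And>i. c i \<ge> m" "m > 0" and v: "v \<in> primitive_vectors"
  shows "weight c v \<ge> m"
proof -
  from v obtain i where i: "v $ i > 0" by (auto simp: primitive_vectors_def)
  have "m * 1 \<le> c i * \<bar>real_of_int (v $ i)\<bar>"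
    using i c(1)[of i] c(2) by (intro mult_mono) auto
  also have "\<dots> \<le> weight c v" 
  proof (rule weight_ge)
    show "0 \<le> c i" for i using c(1)[of i] c(2) by linarith
  qed
  finally show ?thesis by simp
qed

text \<open>Each factor has a pole with residue \<open>2 / c i\<close> at \<open>s = 0\<close>.\<close>

lemma half_sum_limit:
  fixes c :: "'d::{finite,linorder} \<Rightarrow> real"
  assumes c: "\<And>i. c i > 0"
  shows "((\<lambda>s. s ^ CARD('d) * half_sum (\<lambda>i. s * c i)) \<longlongrightarrow> 2 ^ (CARD('d) - 1) / (\<Prod>i\<in>UNIV. c i)) (at_right 0)"
proof -
  have 1: "((\<lambda>s. s * ((1 + exp (- (s * c i))) / (1 - exp (- (s * c i))))) \<longlongrightarrow> 2 / c i) (at_right 0)" for i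
    using c[of i] by (real_asymp simp: field_simps)
  have "((\<lambda>s::real. ((\<Prod>i\<in>UNIV. s * ((1 + exp (- (s * c i))) / (1 - exp (- (s * c i))))) - s ^ CARD('d)) / 2)
     \<longlongrightarrow> ((\<Prod>i\<in>UNIV. 2 / c i) - 0 ^ CARD('d)) / 2) (at_right 0)"
    by (intro tendsto_intros tendsto_prod 1) auto
  also have "(\<lambda>s::real. ((\<Prod>i\<in>UNIV. s * ((1 + exp (- (s * c i))) / (1 - exp (- (s * c i))))) - s ^ CARD('d)) / 2)
     = (\<lambda>s. s ^ CARD('d) * half_sum (\<lambda>i. s * c i))"
    unfolding half_sum_def prod.distrib by (simp add: algebra_simps)
  also have "((\<Prod>i\<in>UNIV. 2 / c i) - 0 ^ CARD('d)) / 2 = 2 ^ (CARD('d) - 1) / (\<Prod>i\<in>UNIV. c i)"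
  proof -
    obtain n where n: "CARD('d) = Suc n" using zero_less_card_finite[where 'a='d] gr0_implies_Suc by blast
    show ?thesis by (simp add: prod_dividef n)
  qed
  finally show ?thesis .
qed

text \<open>For small \<open>s\<close> the sum over the half space is an upper bound of the right order. For large \<open>s\<close> the sum decays
  exponentially, because all weights are at least the smallest entry of \<open>c\<close>.\<close>

lemma primitive_sum_bounded:
  fixes c :: "'d::{finite,linorder} \<Rightarrow> real"
  assumes c: "\<And>i. c i > 0"
  obtains C where "\<And>s. s > 0 \<Longrightarrow> s ^ CARD('d) * primitive_sum (\<lambda>i. s * c i) \<le> C" "C \<ge> 0"
proof -
  let ?d = "CARD('d)" and ?A = "2 ^ (CARD('d) - 1) / (\<Prod>i\<in>UNIV. c i)"
  define m where "m = Min (range c)"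
  have m: "m > 0" "\<And>i. c i \<ge> m" using c by (auto simp: m_def)
  have le: "primitive_sum c' \<le> half_sum c'" if c': "\<And>i. c' i > 0" for c' :: "'d \<Rightarrow> real"
    using has_sum_primitive_sum[of c', OF c'] has_sum_exp_weight_half_space[of c', OF c']
    by (rule has_sum_mono2) (auto simp: primitive_vectors_eq)
  have "\<forall>\<^sub>F s in at_right 0. s ^ ?d * half_sum (\<lambda>i. s * c i) < ?A + 1"
    by (rule order_tendstoD[OF half_sum_limit[of c, OF c]]) simp
  then obtain b where b: "b > 0" "\<And>s. 0 < s \<Longrightarrow> s < b \<Longrightarrow> s ^ ?d * half_sum (\<lambda>i. s * c i) < ?A + 1"
    by (auto simp: eventually_at_right_field)
  define P where "P = primitive_sum (\<lambda>i. b * c i)"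
  define D where "D = (real ?d / m) ^ ?d * exp (b * m) * P"
  have A: "?A > 0" using c by (auto intro!: divide_pos_pos prod_pos)
  have D: "D \<ge> 0" unfolding D_def P_def using m by (intro mult_nonneg_nonneg primitive_sum_nonneg) auto
  show ?thesis
  proof (rule that[of "?A + 1 + D"])
    fix s :: real assume s: "s > 0"
    show "s ^ ?d * primitive_sum (\<lambda>i. s * c i) \<le> ?A + 1 + D"
    proof (cases "s < b")
      case True
      have "s ^ ?d * primitive_sum (\<lambda>i. s * c i) \<le> s ^ ?d * half_sum (\<lambda>i. s * c i)"
        using s c by (intro mult_left_mono le) auto
      also have "\<dots> < ?A + 1" using b s True by blast
      finally show ?thesis using D by simp
    next
      case False
      have "primitive_sum (\<lambda>i. s * c i) \<le> exp (- ((s - b) * m)) * P"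
      proof (rule has_sum_mono[OF has_sum_primitive_sum_scaled[of c s, OF c s]
               has_sum_cmult_right[OF has_sum_primitive_sum_scaled[of c b, OF c b(1), folded P_def]]])
        fix v :: "(int, 'd) vec" assume v: "v \<in> primitive_vectors"
        have "(s - b) * m \<le> (s - b) * weight c v"
          using False m v by (intro mult_left_mono weight_lower_bound) auto
        thus "exp (- (s * weight c v)) \<le> exp (- ((s - b) * m)) * exp (- (b * weight c v))"
          unfolding exp_add[symmetric] by (simp add: algebra_simps)
      qed
      hence "s ^ ?d * primitive_sum (\<lambda>i. s * c i) \<le> s ^ ?d * (exp (- ((s - b) * m)) * P)"
        using s by (intro mult_left_mono) auto
      also have "\<dots> = (s * m) ^ ?d / m ^ ?d * exp (- ((s - b) * m)) * P"
        using m by (simp add: power_mult_distrib)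
      also have "\<dots> \<le> (real ?d ^ ?d * exp (s * m)) / m ^ ?d * exp (- ((s - b) * m)) * P"
        using m s pow_exp_bound[of "s * m" ?d]
        by (intro mult_right_mono divide_right_mono) (auto simp: P_def primitive_sum_nonneg)
      also have "\<dots> = (real ?d / m) ^ ?d * (exp (s * m) * exp (- ((s - b) * m))) * P"
        by (simp add: power_divide)
      also have "exp (s * m) * exp (- ((s - b) * m)) = exp (b * m)"
        unfolding exp_add[symmetric] by (simp add: algebra_simps)
      also have "(real ?d / m) ^ ?d * exp (b * m) * P = D" by (simp add: D_def)
      finally show ?thesis using A by simp
    qed
  qed (use A D in auto)
qed

text \<open>The relation \<open>primitive_sum_sums\<close>, multiplied by \<open>s ^ d\<close>, is a Dirichlet convolution with the
  coefficients \<open>1 / k ^ d\<close>, whose total mass is \<open>\<zeta> d\<close>.\<close>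

lemma primitive_sum_limit:
  fixes c :: "'d::{finite,linorder} \<Rightarrow> real"
  assumes c: "\<And>i. c i > 0" and d: "CARD('d) \<ge> 2"
  shows "((\<lambda>s. s ^ CARD('d) * primitive_sum (\<lambda>i. s * c i)) \<longlongrightarrow>
     2 ^ (CARD('d) - 1) / (\<Prod>i\<in>UNIV. c i) / zeta (real CARD('d))) (at_right 0)"
proof -
  let ?d = "CARD('d)"
  obtain C where C: "\<And>s. s > 0 \<Longrightarrow> s ^ ?d * primitive_sum (\<lambda>i. s * c i) \<le> C" "C \<ge> 0"
    using primitive_sum_bounded[of c, OF c] by blast
  note z = zeta_tail[OF d]
  show ?thesis unfolding z(3)
  proof (rule dirichlet_convolution_tauberian[where C = C and g = "\<lambda>s. s ^ ?d * half_sum (\<lambda>i. s * c i)"])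
    show "\<bar>s ^ ?d * primitive_sum (\<lambda>i. s * c i)\<bar> \<le> C" if "s > 0" for s
      using C(1)[OF that] that primitive_sum_nonneg[of "\<lambda>i. s * c i"] by (simp add: abs_mult)
    fix s :: real assume s: "s > 0"
    have "(\<lambda>k. primitive_sum (\<lambda>i. real (Suc k) * (s * c i))) sums half_sum (\<lambda>i. s * c i)"
      using s c by (intro primitive_sum_sums) auto
    hence "(\<lambda>k. primitive_sum (\<lambda>i. real (Suc (Suc k)) * (s * c i))) sums
        (half_sum (\<lambda>i. s * c i) - primitive_sum (\<lambda>i. s * c i))"
      by (subst sums_Suc_iff) auto
    hence "(\<lambda>k. s ^ ?d * primitive_sum (\<lambda>i. real (Suc (Suc k)) * (s * c i))) sums
        (s ^ ?d * (half_sum (\<lambda>i. s * c i) - primitive_sum (\<lambda>i. s * c i)))"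
      by (rule sums_mult)
    moreover have "s ^ ?d * primitive_sum (\<lambda>i. real (Suc (Suc k)) * (s * c i)) =
       1 / real (k + 2) ^ ?d * ((real (k + 2) * s) ^ ?d * primitive_sum (\<lambda>i. real (k + 2) * s * c i))" for k
      by (simp add: power_mult_distrib mult.assoc del: of_nat_Suc of_nat_add)
    ultimately show "(\<lambda>k. 1 / real (k + 2) ^ ?d * ((real (k + 2) * s) ^ ?d * primitive_sum (\<lambda>i. real (k + 2) * s * c i))) sums
      (s ^ ?d * half_sum (\<lambda>i. s * c i) - s ^ ?d * primitive_sum (\<lambda>i. s * c i))"
      by (simp add: right_diff_distrib)
  qed (use z half_sum_limit[of c, OF c] in auto)
qed

text \<open>In \<open>log_gf_sums\<close> the term with index \<open>k\<close>, multiplied by \<open>s ^ d\<close>, tends to \<open>L / k ^ (d + 1)\<close> with \<open>L\<close> the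
  limit for primitive vectors; the bound on \<open>primitive_sum\<close> allows the passage to the limit under the sum. The result contains
  \<open>\<zeta> (d + 1) / \<zeta> d\<close>, the arithmetic part of \<open>kappa\<close>.\<close>

lemma log_gf_limit:
  fixes c :: "'d::{finite,linorder} \<Rightarrow> real"
  assumes c: "\<And>i. c i > 0" and d: "CARD('d) \<ge> 2"
  shows "((\<lambda>s. s ^ CARD('d) * log_gf (\<lambda>i. s * c i)) \<longlongrightarrow> kappa CARD('d) / (\<Prod>i\<in>UNIV. c i)) (at_right 0)"
proof -
  let ?d = "CARD('d)"
  define p where "p = (\<lambda>s. s ^ ?d * primitive_sum (\<lambda>i. s * c i))"
  define L where "L = 2 ^ (?d - 1) / (\<Prod>i\<in>UNIV. c i) / zeta (real ?d)"
  obtain C where C: "\<And>s. s > 0 \<Longrightarrow> p s \<le> C" "C \<ge> 0"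
    using primitive_sum_bounded[of c, OF c] unfolding p_def by blast
  have p0: "p s \<ge> 0" if "s > 0" for s using that by (simp add: p_def primitive_sum_nonneg)
  have lim: "(p \<longlongrightarrow> L) (at_right 0)"
    unfolding p_def L_def by (rule primitive_sum_limit) (use c d in auto)
  have z: "(\<lambda>k. 1 / real (Suc k) ^ (?d + 1)) sums zeta (real (?d + 1))"
    by (rule zeta_sums) (use d in auto)
  let ?a = "\<lambda>k s. p (real (Suc k) * s) * (1 / real (Suc k) ^ (?d + 1))"
  have sums: "(\<lambda>k. ?a k s) sums (s ^ ?d * log_gf (\<lambda>i. s * c i))" if s: "s > 0" for s
  proof -
    have "(\<lambda>k. primitive_sum (\<lambda>i. real (Suc k) * (s * c i)) / real (Suc k)) sums log_gf (\<lambda>i. s * c i)"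
      using s c by (intro log_gf_sums(2)) auto
    hence "(\<lambda>k. s ^ ?d * (primitive_sum (\<lambda>i. real (Suc k) * (s * c i)) / real (Suc k))) sums
      (s ^ ?d * log_gf (\<lambda>i. s * c i))" by (rule sums_mult)
    moreover have "s ^ ?d * (primitive_sum (\<lambda>i. real (Suc k) * (s * c i)) / real (Suc k)) = ?a k s" for k
      by (simp add: p_def power_mult_distrib mult.assoc del: of_nat_Suc)
    ultimately show ?thesis by simp
  qed
  have "((\<lambda>s. \<Sum>k. ?a k s) \<longlongrightarrow> (\<Sum>k. L * (1 / real (Suc k) ^ (?d + 1)))) (at_right 0)"
  proof (rule conjunct2[OF conjunct2[OF tannerys_theorem[where M = "\<lambda>k. C * (1 / real (Suc k) ^ (?d + 1))"]]])
    fix k :: nat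
    have "filterlim (\<lambda>s::real. real (Suc k) * s) (at_right 0) (at_right 0)"
    proof (rule tendsto_imp_filterlim_at_right)
      have "((\<lambda>s::real. real (Suc k) * s) \<longlongrightarrow> real (Suc k) * 0) (at_right 0)" by (intro tendsto_intros)
      thus "((\<lambda>s::real. real (Suc k) * s) \<longlongrightarrow> 0) (at_right 0)" by simp
      show "\<forall>\<^sub>F s in at_right 0. 0 < real (Suc k) * s"
        using eventually_at_right_less[of "0::real"] by eventually_elim simp
    qed
    from filterlim_compose[OF lim this] show "((\<lambda>s. ?a k s) \<longlongrightarrow> L * (1 / real (Suc k) ^ (?d + 1))) (at_right 0)"
      by (intro tendsto_mult tendsto_const)
  next
    have "\<forall>\<^sub>F s in at_right 0. \<forall>k. norm (?a k s) \<le> C * (1 / real (Suc k) ^ (?d + 1))"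
      using eventually_at_right_less[of "0::real"]
    proof eventually_elim
      case (elim s)
      show ?case
      proof
        fix k
        have "real (Suc k) * s > 0" using elim by simp
        from C(1)[OF this] p0[OF this] have "\<bar>p (real (Suc k) * s)\<bar> \<le> C" by linarith
        thus "norm (?a k s) \<le> C * (1 / real (Suc k) ^ (?d + 1))"
          unfolding real_norm_def abs_mult by (intro mult_mono) auto
      qed
    qed
    thus "\<forall>\<^sub>F (k, s) in at_top \<times>\<^sub>F at_right 0. norm (?a k s) \<le> C * (1 / real (Suc k) ^ (?d + 1))"
      by (subst eventually_prod_filter) (intro exI[of _ "\<lambda>_. True"] exI conjI, auto)
    show "summable (\<lambda>k. C * (1 / real (Suc k) ^ (?d + 1)))" using z by (intro summable_mult) (rule sums_summable)
  qed simp
  also have "(\<Sum>k. L * (1 / real (Suc k) ^ (?d + 1))) = L * zeta (real (?d + 1))"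
    using sums_mult[OF z, of L] by (simp add: sums_iff)
  also have "\<dots> = kappa ?d / (\<Prod>i\<in>UNIV. c i)" by (simp add: L_def kappa_def add.commute)
  finally show ?thesis
  proof (rule Lim_transform_eventually)
    show "\<forall>\<^sub>F s in at_right 0. (\<Sum>k. ?a k s) = s ^ ?d * log_gf (\<lambda>i. s * c i)"
      using eventually_at_right_less[of "0::real"] by eventually_elim (use sums in \<open>simp add: sums_iff\<close>)
  qed
qed

lemma kappa_pos: "d \<ge> 2 \<Longrightarrow> kappa d > 0"
proof -
  assume d: "d \<ge> 2"
  have *: "zeta (real n) > 0" if "n \<ge> 2" for n
    using zeta_tail(3)[OF that] suminf_nonneg[OF zeta_tail(1)[OF that]] by simp
  show ?thesis using *[of d] *[of "d + 1"] d by (simp add: kappa_def add.commute)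
qed

section \<open>Exponential tilting\<close>

text \<open>Expanding the product gives one term for every function on \<open>V\<close>, and distinct elements of \<open>\<Omega>\<close> have distinct terms.\<close>

lemma sum_prod_le_prod_sums:
  fixes \<psi> :: "'v \<Rightarrow> nat \<Rightarrow> real"
  assumes V: "finite V" and \<Omega>: "finite \<Omega>" "\<And>\<omega>. \<omega> \<in> \<Omega> \<Longrightarrow> {v. \<omega> v \<noteq> 0} \<subseteq> V"
    and \<psi>: "\<And>v k. v \<in> V \<Longrightarrow> \<psi> v k \<ge> 0" "\<And>v. v \<in> V \<Longrightarrow> \<psi> v sums g v"
  shows "(\<Sum>\<omega>\<in>\<Omega>. \<Prod>v\<in>V. \<psi> v (\<omega> v)) \<le> (\<Prod>v\<in>V. g v)"
proof -
  define K where "K = (\<Sum>\<omega>\<in>\<Omega>. \<Sum>v\<in>V. \<omega> v)"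
  have K: "\<omega> v \<le> K" if "\<omega> \<in> \<Omega>" "v \<in> V" for \<omega> v
  proof -
    have "\<omega> v \<le> (\<Sum>v\<in>V. \<omega> v)" using V that by (intro member_le_sum) auto
    also have "\<dots> \<le> K" unfolding K_def using \<Omega> that by (intro member_le_sum) auto
    finally show ?thesis .
  qed
  have inj: "inj_on (\<lambda>\<omega>. restrict \<omega> V) \<Omega>"
  proof (rule inj_onI, rule ext)
    fix \<omega> \<omega>' v assume *: "\<omega> \<in> \<Omega>" "\<omega>' \<in> \<Omega>" "restrict \<omega> V = restrict \<omega>' V"
    show "\<omega> v = \<omega>' v"
    proof (cases "v \<in> V")
      case True thus ?thesis using fun_cong[OF *(3), of v] by simp
    next
      case False
      have "\<omega> v = 0" "\<omega>' v = 0" using False \<Omega>(2)[OF *(1)] \<Omega>(2)[OF *(2)] by fastforce+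
      thus ?thesis by simp
    qed
  qed
  have "(\<Sum>\<omega>\<in>\<Omega>. \<Prod>v\<in>V. \<psi> v (\<omega> v)) = (\<Sum>f\<in>(\<lambda>\<omega>. restrict \<omega> V) ` \<Omega>. \<Prod>v\<in>V. \<psi> v (f v))"
    by (subst sum.reindex[OF inj]) simp
  also have "\<dots> \<le> (\<Sum>f\<in>PiE V (\<lambda>_. {..K}). \<Prod>v\<in>V. \<psi> v (f v))"
    using V K \<psi> by (intro sum_mono2 finite_PiE prod_nonneg) (auto simp: PiE_def)
  also have "\<dots> = (\<Prod>v\<in>V. \<Sum>k\<le>K. \<psi> v k)"
    using V by (intro prod_sum_PiE[symmetric]) auto
  also have "\<dots> \<le> (\<Prod>v\<in>V. g v)"
  proof (intro prod_mono conjI sum_nonneg \<psi>)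
    fix v assume v: "v \<in> V"
    have "(\<Sum>k\<le>K. \<psi> v k) \<le> suminf (\<psi> v)"
      using \<psi>(2)[OF v] by (intro sum_le_suminf) (auto simp: sums_iff \<psi>(1)[OF v])
    thus "(\<Sum>k\<le>K. \<psi> v k) \<le> g v" using \<psi>(2)[OF v] by (simp add: sums_iff)
  qed
  finally show ?thesis .
qed

lemma exp_weight_bounds:
  assumes "\<And>i. c i > 0" "v \<in> primitive_vectors"
  shows "0 < exp (- weight c v)" "exp (- weight c v) < 1"
  using weight_pos[of c, OF assms] by auto

lemma prod_le_exp_log_gf:
  assumes c: "\<And>i. c i > 0" and V: "finite V" "V \<subseteq> primitive_vectors"
  shows "(\<Prod>v\<in>V. 1 / (1 - exp (- weight c v))) \<le> exp (log_gf c)"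
proof -
  have "(\<Prod>v\<in>V. 1 / (1 - exp (- weight c v))) = (\<Prod>v\<in>V. exp (- ln (1 - exp (- weight c v))))"
    using exp_weight_bounds[of c, OF c] V(2) by (intro prod.cong refl) (auto simp: exp_minus inverse_eq_divide)
  also have "\<dots> = exp (\<Sum>v\<in>V. - ln (1 - exp (- weight c v)))" by (simp add: exp_sum[OF V(1)])
  also have "\<dots> \<le> exp (log_gf c)" unfolding exp_le_cancel_iff log_gf_def
    using V log_gf_sums(1)[of c, OF c] exp_weight_bounds[of c, OF c]
    by (intro finite_sum_le_infsum) auto
  finally show ?thesis .
qed

lemma exp_weight_coord_sum:
  assumes "finite V" "{v. \<omega> v \<noteq> 0} \<subseteq> V"
  shows "exp (- weight c (coord_sum \<omega>)) = (\<Prod>v\<in>V. exp (- weight c v) ^ \<omega> v)"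
  by (simp add: weight_coord_sum[OF assms] exp_of_nat_mult[symmetric] exp_sum[OF assms(1), symmetric] sum_negf)

lemma finite_Union_support:
  assumes "finite \<Omega>" "\<And>\<omega>. \<omega> \<in> \<Omega> \<Longrightarrow> multiplicity_function \<omega>"
  obtains V where "finite V" "V \<subseteq> primitive_vectors" "\<And>\<omega>. \<omega> \<in> \<Omega> \<Longrightarrow> {v. \<omega> v \<noteq> 0} \<subseteq> V"
  using assms by (intro that[of "\<Union>\<omega>\<in>\<Omega>. {v. \<omega> v \<noteq> 0}"]) (auto simp: multiplicity_function_def)

text \<open>Euler product: the multiplicities of the generators are independent. Since the support of a multiplicity function is finite but
  arbitrary, both inequalities pass through finite sets of generators, the lower one also through bounded multiplicities.\<close>

lemma has_sum_generating_function:
  fixes c :: "'d::{finite,linorder} \<Rightarrow> real"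
  assumes c: "\<And>i. c i > 0"
  shows "((\<lambda>\<omega>. exp (- weight c (coord_sum \<omega>))) has_sum exp (log_gf c)) {\<omega>. multiplicity_function \<omega>}"
proof -
  let ?f = "\<lambda>\<omega>. exp (- weight c (coord_sum \<omega>))" and ?A = "{\<omega>. multiplicity_function \<omega>}"
  note x = exp_weight_bounds[of c, OF c]
  have geo: "(\<lambda>k. exp (- weight c v) ^ k) sums (1 / (1 - exp (- weight c v)))" if "v \<in> primitive_vectors" for v
    using x[OF that] by (intro geometric_sums) auto
  have upper: "sum ?f \<Omega> \<le> exp (log_gf c)" if \<Omega>: "finite \<Omega>" "\<Omega> \<subseteq> ?A" for \<Omega>
  proof -
    obtain V where V: "finite V" "V \<subseteq> primitive_vectors" "\<And>\<omega>. \<omega> \<in> \<Omega> \<Longrightarrow> {v. \<omega> v \<noteq> 0} \<subseteq> V"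
      using finite_Union_support[OF \<Omega>(1)] \<Omega>(2) by blast
    have "sum ?f \<Omega> = (\<Sum>\<omega>\<in>\<Omega>. \<Prod>v\<in>V. exp (- weight c v) ^ \<omega> v)"
      using V by (intro sum.cong exp_weight_coord_sum) auto
    also have "\<dots> \<le> (\<Prod>v\<in>V. 1 / (1 - exp (- weight c v)))"
      using V geo by (intro sum_prod_le_prod_sums \<Omega>) auto
    also have "\<dots> \<le> exp (log_gf c)" by (rule prod_le_exp_log_gf[of c, OF c V(1,2)])
    finally show ?thesis .
  qed
  have summable: "?f summable_on ?A"
    using upper by (intro nonneg_bdd_above_summable_on) (auto intro!: bdd_aboveI[of _ "exp (log_gf c)"])
  then obtain S where S: "(?f has_sum S) ?A" by (auto simp: summable_on_def)
  have "S \<le> exp (log_gf c)" using S upper by (rule has_sum_le_finite_sums)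
  have S0: "S > 0"
  proof -
    have "sum ?f {\<lambda>_. 0} \<le> S" using S
      by (rule finite_sum_le_has_sum) (auto simp: multiplicity_function_def)
    moreover have "sum ?f {\<lambda>_. 0} > 0" by simp
    ultimately show ?thesis by linarith
  qed
  \<comment> \<open>Each partial product is the limit of sums over the multiplicity functions bounded by \<open>K\<close> and supported in \<open>V\<close>.\<close>
  have lower: "(\<Prod>v\<in>V. 1 / (1 - exp (- weight c v))) \<le> S" if V: "finite V" "V \<subseteq> primitive_vectors" for V
  proof (rule tendsto_upperbound)
    show "(\<lambda>K. \<Prod>v\<in>V. \<Sum>k\<le>K. exp (- weight c v) ^ k) \<longlonglongrightarrow> (\<Prod>v\<in>V. 1 / (1 - exp (- weight c v)))"
      using V geo by (intro tendsto_prod) (auto simp: sums_def_le)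
    have "(\<Prod>v\<in>V. \<Sum>k\<le>K. exp (- weight c v) ^ k) \<le> S" for K
    proof -
      let ?e = "\<lambda>f v. if v \<in> V then f v else (0::nat)"
      have fin: "finite (PiE V (\<lambda>_. {..K}))" using V by (intro finite_PiE) auto
      have inj: "inj_on ?e (PiE V (\<lambda>_. {..K}))"
      proof (rule inj_onI)
        fix f g assume fg: "f \<in> PiE V (\<lambda>_. {..K})" "g \<in> PiE V (\<lambda>_. {..K})" and eq: "?e f = ?e g"
        show "f = g" using fg(1,2)
        proof (rule PiE_ext)
          fix v assume "v \<in> V" thus "f v = g v" using fun_cong[OF eq, of v] by simp
        qed
      qed
      have "(\<Prod>v\<in>V. \<Sum>k\<le>K. exp (- weight c v) ^ k) = (\<Sum>f\<in>PiE V (\<lambda>_. {..K}). \<Prod>v\<in>V. exp (- weight c v) ^ f v)"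
        using V by (intro prod_sum_PiE) auto
      also have "\<dots> = (\<Sum>f\<in>PiE V (\<lambda>_. {..K}). ?f (?e f))"
      proof (intro sum.cong refl)
        fix f
        show "(\<Prod>v\<in>V. exp (- weight c v) ^ f v) = ?f (?e f)"
          using V by (subst exp_weight_coord_sum[OF V(1)]) (auto intro!: prod.cong)
      qed
      also have "\<dots> = sum ?f (?e ` PiE V (\<lambda>_. {..K}))" by (simp add: sum.reindex[OF inj])
      also have "\<dots> \<le> S"
      proof (rule finite_sum_le_has_sum[OF S])
        show "?e ` PiE V (\<lambda>_. {..K}) \<subseteq> ?A"
          using V by (auto simp: multiplicity_function_def intro: finite_subset[OF _ V(1)])
      qed (use fin in auto)
      finally show ?thesis .
    qed
    thus "\<forall>\<^sub>F K in sequentially. (\<Prod>v\<in>V. \<Sum>k\<le>K. exp (- weight c v) ^ k) \<le> S" by simp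
  qed simp
  have "log_gf c \<le> ln S" unfolding log_gf_def
  proof (rule infsum_le_finite_sums[OF log_gf_sums(1)[of c, OF c]])
    fix V :: "(int, 'd) vec set" assume V: "finite V" "V \<subseteq> primitive_vectors"
    have "exp (\<Sum>v\<in>V. - ln (1 - exp (- weight c v))) = (\<Prod>v\<in>V. exp (- ln (1 - exp (- weight c v))))"
      by (rule exp_sum[OF V(1)])
    also have "\<dots> = (\<Prod>v\<in>V. 1 / (1 - exp (- weight c v)))"
      using x V(2) by (intro prod.cong refl) (auto simp: exp_minus inverse_eq_divide)
    also have "\<dots> \<le> S" by (rule lower[OF V])
    finally show "(\<Sum>v\<in>V. - ln (1 - exp (- weight c v))) \<le> ln S" using S0 by (simp add: ln_ge_iff)
  qed
  hence "exp (log_gf c) \<le> S" using S0 by (simp add: ln_ge_iff)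
  with \<open>S \<le> exp (log_gf c)\<close> S show ?thesis by simp
qed

text \<open>The sum on the left is the mean of the number \<open>S\<close> of elements of \<open>B\<close> that occur in a uniform multiplicity function with
  total \<open>N\<close>. For independent geometric multiplicities with ratios \<open>x v = exp (- weight c v)\<close>, the mean of \<open>exp (t * S)\<close> is the product over \<open>B\<close> of
  \<open>1 + (exp t - 1) * x v\<close>, because \<open>v\<close> occurs with probability \<open>x v\<close>. Restricting to the total \<open>N\<close> costs at most the exponential of
  \<open>weight c N + log_gf c - ln (zono_count N)\<close>, and Jensen's inequality bounds the mean of \<open>t * S\<close>. Both signs of \<open>t\<close> are useful.\<close>

lemma sum_count_diff_le:
  fixes N :: "int ^ 'd::{finite,linorder}"
  assumes c: "\<And>i. c i > 0" and N: "zono_count N > 0" and B: "finite B" "B \<subseteq> primitive_vectors"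
  shows "t * (\<Sum>v\<in>B. zono_count (N - vabs v) / zono_count N)
     \<le> weight c N + log_gf c - ln (zono_count N) + (exp t - 1) * (\<Sum>v\<in>B. exp (- weight c v))"
proof -
  define S where "S = (\<lambda>\<omega>. \<Sum>v\<in>B. if \<omega> v \<ge> (1::nat) then 1 else (0::real))"
  let ?A = "with_total N"
  note x = exp_weight_bounds[of c, OF c]
  obtain V0 where V0: "finite V0" "V0 \<subseteq> primitive_vectors" "\<And>\<omega>. \<omega> \<in> ?A \<Longrightarrow> {v. \<omega> v \<noteq> 0} \<subseteq> V0"
    using finite_Union_support[OF finite_with_total[of N]] unfolding with_total_def by blast
  define V where "V = V0 \<union> B"
  have V: "finite V" "V \<subseteq> primitive_vectors" "\<And>\<omega>. \<omega> \<in> ?A \<Longrightarrow> {v. \<omega> v \<noteq> 0} \<subseteq> V"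
    using V0 B by (auto simp: V_def)
  define e where "e = (\<lambda>v. if v \<in> B then exp t else 1)"
  \<comment> \<open>The product of the \<open>\<psi> v (\<omega> v)\<close> is \<open>exp (t * S \<omega>)\<close> times the weight of \<open>\<omega>\<close>, and \<open>\<psi> v\<close> has the sum
      \<open>z v / (1 - x v)\<close>.\<close>
  define \<psi> where "\<psi> = (\<lambda>v k. (if k \<ge> (1::nat) then e v else 1) * exp (- weight c v) ^ k)"
  define z where "z = (\<lambda>v. 1 + (e v - 1) * exp (- weight c v))"
  have e0: "e v > 0" for v by (simp add: e_def)
  have z0: "z v > 0" if "v \<in> primitive_vectors" for v
  proof -
    have "z v = (1 - exp (- weight c v)) + e v * exp (- weight c v)" by (simp add: z_def algebra_simps)
    thus ?thesis using x[OF that] e0[of v] by (simp add: add_pos_pos)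
  qed
  have \<psi>: "\<psi> v sums (z v * (1 / (1 - exp (- weight c v))))" if v: "v \<in> primitive_vectors" for v
  proof -
    let ?x = "exp (- weight c v)"
    have "(\<lambda>k. e v * ?x ^ k) sums (e v * (1 / (1 - ?x)))"
      using x[OF v] by (intro sums_mult geometric_sums) auto
    moreover have "(\<lambda>k. if k = 0 then e v - 1 else 0) sums (e v - 1)"
      by (rule sums_single)
    ultimately have "(\<lambda>k. e v * ?x ^ k - (if k = 0 then e v - 1 else 0)) sums (e v * (1 / (1 - ?x)) - (e v - 1))"
      by (rule sums_diff)
    also have "(\<lambda>k. e v * ?x ^ k - (if k = 0 then e v - 1 else 0)) = \<psi> v"
    proof
      fix k show "e v * ?x ^ k - (if k = 0 then e v - 1 else 0) = \<psi> v k" by (cases k) (auto simp: \<psi>_def)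
    qed
    also have "e v * (1 / (1 - ?x)) - (e v - 1) = z v * (1 / (1 - ?x))"
      using x[OF v] by (simp add: z_def field_simps)
    finally show ?thesis .
  qed
  have S_eq: "exp (t * S \<omega>) * exp (- weight c N) = (\<Prod>v\<in>V. \<psi> v (\<omega> v))" if w: "\<omega> \<in> ?A" for \<omega>
  proof -
    have "exp (t * S \<omega>) = (\<Prod>v\<in>B. if \<omega> v \<ge> 1 then e v else 1)"
      unfolding S_def sum_distrib_left by (subst exp_sum[OF B(1)]) (auto intro!: prod.cong simp: e_def)
    also have "\<dots> = (\<Prod>v\<in>V. if \<omega> v \<ge> 1 then e v else 1)"
      using V(1) by (intro prod.mono_neutral_left) (auto simp: V_def e_def)
    finally have 1: "exp (t * S \<omega>) = (\<Prod>v\<in>V. if \<omega> v \<ge> 1 then e v else 1)" .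
    have "coord_sum \<omega> = N" using w by (simp add: with_total_def)
    hence "exp (- weight c N) = (\<Prod>v\<in>V. exp (- weight c v) ^ \<omega> v)"
      using exp_weight_coord_sum[OF V(1) V(3)[OF w], of c] by simp
    with 1 show ?thesis by (simp add: \<psi>_def prod.distrib)
  qed
  have "(\<Sum>\<omega>\<in>?A. exp (t * S \<omega>)) * exp (- weight c N) = (\<Sum>\<omega>\<in>?A. \<Prod>v\<in>V. \<psi> v (\<omega> v))"
    by (simp add: sum_distrib_right S_eq)
  also have "\<dots> \<le> (\<Prod>v\<in>V. z v * (1 / (1 - exp (- weight c v))))"
    using V \<psi> x e0 by (intro sum_prod_le_prod_sums) (auto simp: \<psi>_def less_imp_le)
  also have "\<dots> = (\<Prod>v\<in>V. z v) * (\<Prod>v\<in>V. 1 / (1 - exp (- weight c v)))" by (rule prod.distrib)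
  also have "\<dots> \<le> (\<Prod>v\<in>V. z v) * exp (log_gf c)"
    using V z0 by (intro mult_left_mono prod_le_exp_log_gf c prod_nonneg) (auto simp: less_imp_le subset_iff)
  also have "(\<Prod>v\<in>V. z v) = (\<Prod>v\<in>B. z v)"
    using V(1) by (intro prod.mono_neutral_right) (auto simp: V_def z_def e_def)
  also have "(\<Prod>v\<in>B. z v) * exp (log_gf c) \<le> (\<Prod>v\<in>B. exp ((exp t - 1) * exp (- weight c v))) * exp (log_gf c)"
  proof (intro mult_right_mono prod_mono conjI)
    fix v assume v: "v \<in> B"
    show "0 \<le> z v" using z0[of v] v B by (auto simp: less_imp_le)
    show "z v \<le> exp ((exp t - 1) * exp (- weight c v))"
      using v exp_ge_add_one_self[of "(exp t - 1) * exp (- weight c v)"] by (simp add: z_def e_def)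
  qed simp
  also have "(\<Prod>v\<in>B. exp ((exp t - 1) * exp (- weight c v))) = exp ((exp t - 1) * (\<Sum>v\<in>B. exp (- weight c v)))"
    by (simp add: exp_sum[OF B(1)] sum_distrib_left)
  finally have "(\<Sum>\<omega>\<in>?A. exp (t * S \<omega>)) * exp (- weight c N) \<le>
     exp ((exp t - 1) * (\<Sum>v\<in>B. exp (- weight c v))) * exp (log_gf c)" .
  hence le: "(\<Sum>\<omega>\<in>?A. exp (t * S \<omega>)) * exp (- weight c N) * exp (weight c N) \<le>
     exp ((exp t - 1) * (\<Sum>v\<in>B. exp (- weight c v))) * exp (log_gf c) * exp (weight c N)"
    by (rule mult_right_mono) simp
  have "(\<Sum>\<omega>\<in>?A. exp (t * S \<omega>)) =
      (\<Sum>\<omega>\<in>?A. exp (t * S \<omega>)) * exp (- weight c N) * exp (weight c N)"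
    by (simp add: mult.assoc exp_add[symmetric])
  also note le
  also have "exp ((exp t - 1) * (\<Sum>v\<in>B. exp (- weight c v))) * exp (log_gf c) * exp (weight c N) =
      exp (weight c N + log_gf c + (exp t - 1) * (\<Sum>v\<in>B. exp (- weight c v)))"
    by (simp only: exp_add[symmetric] add_ac)
  finally have M: "(\<Sum>\<omega>\<in>?A. exp (t * S \<omega>)) \<le>
     exp (weight c N + log_gf c + (exp t - 1) * (\<Sum>v\<in>B. exp (- weight c v)))" .
  define y where "y = t * (\<Sum>v\<in>B. zono_count (N - vabs v) / zono_count N)"
  have "(\<Sum>\<omega>\<in>?A. S \<omega>) = (\<Sum>v\<in>B. zono_count (N - vabs v))"
  proof -
    have "(\<Sum>\<omega>\<in>?A. S \<omega>) = (\<Sum>v\<in>B. \<Sum>\<omega>\<in>?A. if \<omega> v \<ge> 1 then 1 else 0)"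
      unfolding S_def by (rule sum.swap)
    also have "\<dots> = (\<Sum>v\<in>B. zono_count (N - vabs v))"
    proof (intro sum.cong refl)
      fix v assume "v \<in> B"
      hence v: "v \<in> primitive_vectors" using B by auto
      have "(\<Sum>\<omega>\<in>?A. if \<omega> v \<ge> 1 then 1 else 0) = real (card {\<omega>\<in>?A. \<omega> v \<ge> 1})"
        by (simp add: sum.If_cases Int_def)
      thus "(\<Sum>\<omega>\<in>?A. if \<omega> v \<ge> 1 then 1 else 0) = zono_count (N - vabs v)"
        using card_multiplicity_ge[OF v, of N 1] by simp
    qed
    finally show ?thesis .
  qed
  hence y: "t * (\<Sum>\<omega>\<in>?A. S \<omega>) = zono_count N * y"
    using N by (simp add: y_def sum_divide_distrib[symmetric])
  \<comment> \<open>Jensen's inequality, in the form \<open>1 + (t * S - y) \<le> exp (t * S - y)\<close> with \<open>y\<close> the mean of \<open>t * S\<close>.\<close>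
  have "zono_count N = (\<Sum>\<omega>\<in>?A. 1 + (t * S \<omega> - y))"
    using y by (simp add: sum.distrib sum_subtractf sum_distrib_left[symmetric] zono_count_def)
  also have "\<dots> \<le> (\<Sum>\<omega>\<in>?A. exp (t * S \<omega> - y))"
    by (intro sum_mono exp_ge_add_one_self)
  also have "\<dots> = exp (- y) * (\<Sum>\<omega>\<in>?A. exp (t * S \<omega>))"
    by (simp add: exp_diff sum_divide_distrib[symmetric] exp_minus field_simps)
  also have "\<dots> \<le> exp (- y) * exp (weight c N + log_gf c + (exp t - 1) * (\<Sum>v\<in>B. exp (- weight c v)))"
    by (intro mult_left_mono M) auto
  also have "\<dots> = exp (weight c N + log_gf c + (exp t - 1) * (\<Sum>v\<in>B. exp (- weight c v)) - y)"
    unfolding exp_add[symmetric] by simp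
  finally have "ln (zono_count N) \<le> weight c N + log_gf c + (exp t - 1) * (\<Sum>v\<in>B. exp (- weight c v)) - y"
    using N by (metis ln_exp ln_le_cancel_iff exp_gt_zero)
  thus ?thesis by (simp add: y_def)
qed

section \<open>Concentration of the total and a lower bound for the count\<close>

lemma card_int_vec_box:
  assumes "\<And>i. finite (S i)"
  shows "card {v :: int ^ 'd::finite. \<forall>i. v $ i \<in> S i} = (\<Prod>i\<in>UNIV. card (S i))"
proof -
  have "bij_betw (\<lambda>(v :: int ^ 'd) i. v $ i) {v. \<forall>i. v $ i \<in> S i} (PiE UNIV S)"
    by (rule bij_betwI[of _ _ _ vec_lambda]) (auto simp: PiE_def)
  from bij_betw_same_card[OF this] show ?thesis by (simp add: card_PiE)
qed

lemma weight_update: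
  "weight (\<lambda>j. if j = i then a else c j) m = weight c m + (a - c i) * \<bar>real_of_int (m $ i)\<bar>"
proof -
  have "weight (\<lambda>j. if j = i then a else c j) m =
      (\<Sum>j\<in>UNIV. c j * \<bar>real_of_int (m $ j)\<bar> + (if j = i then (a - c i) * \<bar>real_of_int (m $ i)\<bar> else 0))"
    unfolding weight_def by (intro sum.cong) (auto simp: algebra_simps)
  thus ?thesis by (simp add: sum.distrib weight_def)
qed

text \<open>Totals all of whose coordinates lie in the same real interval.\<close>

definition count_window :: "real \<Rightarrow> real \<Rightarrow> (int ^ 'd::finite) set" where
  "count_window L U = {M. \<forall>i. 0 \<le> M $ i \<and> L \<le> real_of_int (M $ i) \<and> real_of_int (M $ i) \<le> U}"

lemma finite_count_window: "finite (count_window L U :: (int ^ 'd::finite) set)"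
  and card_count_window_le: "U \<ge> 0 \<Longrightarrow> real (card (count_window L U :: (int ^ 'd::finite) set)) \<le> (U + 1) ^ CARD('d)"
proof -
  let ?B = "{M :: int ^ 'd. \<forall>i. M $ i \<in> {0..\<lfloor>U\<rfloor>}}"
  have sub: "count_window L U \<subseteq> ?B" by (auto simp: count_window_def le_floor_iff)
  have fin: "finite ?B" by (rule finite_int_vec_box) auto
  show "finite (count_window L U :: (int ^ 'd::finite) set)" using sub fin by (rule finite_subset)
  assume "U \<ge> 0"
  have "real (card (count_window L U :: (int ^ 'd) set)) \<le> real (card ?B)"
    using sub fin by (simp add: card_mono)
  also have "\<dots> = real (nat (\<lfloor>U\<rfloor> + 1)) ^ CARD('d)" by (subst card_int_vec_box) auto
  also have "\<dots> \<le> (U + 1) ^ CARD('d)" using \<open>U \<ge> 0\<close> by (intro power_mono) auto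
  finally show "real (card (count_window L U :: (int ^ 'd) set)) \<le> (U + 1) ^ CARD('d)" .
qed

text \<open>Chernoff's bound. A total outside the window has a coordinate \<open>i\<close> above \<open>U\<close> or below \<open>L\<close>; its term is then at most
  \<open>exp (- \<theta> \<beta> U)\<close> or \<open>exp (\<theta> \<beta> L)\<close> times the term in which coordinate \<open>i\<close> of the tilt is scaled by \<open>1 - \<theta>\<close> or
  \<open>1 + \<theta>\<close>.\<close>

lemma exp_log_gf_le_window:
  fixes \<beta> \<theta> L U :: real
  assumes \<beta>: "\<beta> > 0" and \<theta>: "0 < \<theta>" "\<theta> < 1"
  defines "up \<equiv> \<lambda>i j :: 'd::{finite,linorder}. if j = i then 1 + \<theta> else 1"
    and "dn \<equiv> \<lambda>i j. if j = i then 1 - \<theta> else 1"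
  shows "exp (log_gf (\<lambda>_ :: 'd. \<beta>)) \<le> (\<Sum>M\<in>count_window L U. zono_count M * exp (- weight (\<lambda>_ :: 'd. \<beta>) M))
     + (\<Sum>i\<in>UNIV. exp (- (\<theta> * \<beta> * U)) * exp (log_gf (\<lambda>j. \<beta> * dn i j))
                + exp (\<theta> * \<beta> * L) * exp (log_gf (\<lambda>j. \<beta> * up i j)))"
    (is "_ \<le> ?W + ?T")
proof (rule has_sum_le_finite_sums[OF has_sum_generating_function])
  show "\<beta> > 0" by fact
  fix \<Omega> :: "((int, 'd) vec \<Rightarrow> nat) set"
  assume \<Omega>: "finite \<Omega>" "\<Omega> \<subseteq> {\<omega>. multiplicity_function \<omega>}"
  let ?f = "\<lambda>c \<omega>. exp (- weight c (coord_sum \<omega>))" and ?c = "\<lambda>_ :: 'd. \<beta>"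
  define In where "In = {\<omega>\<in>\<Omega>. coord_sum \<omega> \<in> count_window L U}"
  have nn: "coord_sum \<omega> $ i \<ge> 0" if "\<omega> \<in> \<Omega>" for \<omega> i
    using that \<Omega> coord_sum_nonneg[OF multiplicity_functionD(1)] by blast
  have pos: "\<beta> * dn i j > 0" "\<beta> * up i j > 0" for i j
    using \<beta> \<theta> by (auto simp: dn_def up_def)
  have "(\<Sum>\<omega>\<in>In. ?f ?c \<omega>) = (\<Sum>M\<in>coord_sum ` In. \<Sum>\<omega>\<in>{\<omega>\<in>In. coord_sum \<omega> = M}. ?f ?c \<omega>)"
    using \<Omega> by (intro sum.image_gen) (auto simp: In_def)
  also have "\<dots> \<le> (\<Sum>M\<in>coord_sum ` In. zono_count M * exp (- weight ?c M))"
  proof (intro sum_mono)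
    fix M
    have "(\<Sum>\<omega>\<in>{\<omega>\<in>In. coord_sum \<omega> = M}. ?f ?c \<omega>) = real (card {\<omega>\<in>In. coord_sum \<omega> = M}) * exp (- weight ?c M)"
      by simp
    also have "\<dots> \<le> zono_count M * exp (- weight ?c M)" unfolding zono_count_def
      using \<Omega> by (intro mult_right_mono of_nat_mono card_mono) (auto simp: In_def with_total_def[of M] intro: finite_with_total[unfolded with_total_def])
    finally show "(\<Sum>\<omega>\<in>{\<omega>\<in>In. coord_sum \<omega> = M}. ?f ?c \<omega>) \<le> zono_count M * exp (- weight ?c M)" .
  qed
  also have "\<dots> \<le> ?W" by (intro sum_mono2 finite_count_window) (auto simp: In_def zono_count_nonneg)
  finally have 1: "(\<Sum>\<omega>\<in>In. ?f ?c \<omega>) \<le> ?W" .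
  have fin: "finite (\<Omega> - In)" using \<Omega> by auto
  have "(\<Sum>\<omega>\<in>\<Omega> - In. ?f ?c \<omega>) \<le> (\<Sum>\<omega>\<in>\<Omega> - In. \<Sum>i\<in>UNIV.
       exp (- (\<theta> * \<beta> * U)) * ?f (\<lambda>j. \<beta> * dn i j) \<omega> + exp (\<theta> * \<beta> * L) * ?f (\<lambda>j. \<beta> * up i j) \<omega>)"
  proof (intro sum_mono)
    fix \<omega> assume w: "\<omega> \<in> \<Omega> - In"
    then obtain i where i: "real_of_int (coord_sum \<omega> $ i) < L \<or> real_of_int (coord_sum \<omega> $ i) > U"
      using nn by (fastforce simp: In_def count_window_def not_le)
    let ?x = "real_of_int (coord_sum \<omega> $ i)"
    have wdn: "weight (\<lambda>j. \<beta> * dn i j) (coord_sum \<omega>) = weight ?c (coord_sum \<omega>) - \<theta> * \<beta> * ?x"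
      unfolding weight_scale dn_def using nn[of \<omega> i] w
      by (subst weight_update) (simp add: weight_def sum_distrib_left algebra_simps)
    have wup: "weight (\<lambda>j. \<beta> * up i j) (coord_sum \<omega>) = weight ?c (coord_sum \<omega>) + \<theta> * \<beta> * ?x"
      unfolding weight_scale up_def using nn[of \<omega> i] w
      by (subst weight_update) (simp add: weight_def sum_distrib_left algebra_simps)
    have "?f ?c \<omega> \<le> exp (- (\<theta> * \<beta> * U)) * ?f (\<lambda>j. \<beta> * dn i j) \<omega> + exp (\<theta> * \<beta> * L) * ?f (\<lambda>j. \<beta> * up i j) \<omega>"
      using i
    proof
      assume "?x < L"
      hence "\<theta> * \<beta> * ?x \<le> \<theta> * \<beta> * L" using \<theta> \<beta> by (intro mult_left_mono) auto
      hence "?f ?c \<omega> \<le> exp (\<theta> * \<beta> * L) * ?f (\<lambda>j. \<beta> * up i j) \<omega>"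
        unfolding wup exp_add[symmetric] by simp
      thus ?thesis by (simp add: add_increasing)
    next
      assume "?x > U"
      hence "\<theta> * \<beta> * U \<le> \<theta> * \<beta> * ?x" using \<theta> \<beta> by (intro mult_left_mono) auto
      hence "?f ?c \<omega> \<le> exp (- (\<theta> * \<beta> * U)) * ?f (\<lambda>j. \<beta> * dn i j) \<omega>"
        unfolding wdn exp_add[symmetric] by simp
      thus ?thesis by (simp add: add_increasing2)
    qed
    also have "\<dots> \<le> (\<Sum>i\<in>UNIV. exp (- (\<theta> * \<beta> * U)) * ?f (\<lambda>j. \<beta> * dn i j) \<omega> + exp (\<theta> * \<beta> * L) * ?f (\<lambda>j. \<beta> * up i j) \<omega>)"
      by (rule member_le_sum) auto
    finally show "?f ?c \<omega> \<le> \<dots>" .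
  qed
  also have "\<dots> = (\<Sum>i\<in>UNIV. exp (- (\<theta> * \<beta> * U)) * (\<Sum>\<omega>\<in>\<Omega> - In. ?f (\<lambda>j. \<beta> * dn i j) \<omega>)
       + exp (\<theta> * \<beta> * L) * (\<Sum>\<omega>\<in>\<Omega> - In. ?f (\<lambda>j. \<beta> * up i j) \<omega>))"
    by (subst sum.swap) (simp add: sum.distrib sum_distrib_left)
  also have "\<dots> \<le> ?T"
    using \<Omega> by (intro sum_mono add_mono mult_left_mono finite_sum_le_has_sum[OF has_sum_generating_function] fin pos) auto
  finally have 2: "(\<Sum>\<omega>\<in>\<Omega> - In. ?f ?c \<omega>) \<le> ?T" .
  have "(\<Sum>\<omega>\<in>\<Omega>. ?f ?c \<omega>) = (\<Sum>\<omega>\<in>\<Omega> - In. ?f ?c \<omega>) + (\<Sum>\<omega>\<in>In. ?f ?c \<omega>)"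
    using \<Omega> by (intro sum.subset_diff) (auto simp: In_def)
  thus "(\<Sum>\<omega>\<in>\<Omega>. ?f ?c \<omega>) \<le> ?W + ?T" using 1 2 by linarith
qed

text \<open>Multiplied by \<open>\<beta> ^ d\<close>, the exponent on the left exceeds that on the right by
  \<open>\<kappa> / (1 - \<theta>) - \<kappa> - \<theta> * m * \<kappa>\<close> in the limit, and \<open>gain\<close> says that this is negative. A negative \<open>\<theta>\<close> is allowed and
  gives lower tails. The factor \<open>8 * d\<close> is chosen so that \<open>2 * d\<close> such tails add up to a quarter.\<close>

lemma tilted_tail_bound:
  fixes \<theta> m :: real and i :: "'d::{finite,linorder}"
  assumes \<theta>: "\<theta> < 1" and gain: "1 < (1 + \<theta> * m) * (1 - \<theta>)" and d: "CARD('d) \<ge> 2"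
  shows "\<forall>\<^sub>F \<beta> in at_right 0.
     exp (- (\<theta> * \<beta> * (m * (kappa CARD('d) / \<beta> ^ (CARD('d) + 1))))) *
       exp (log_gf (\<lambda>j. \<beta> * (if j = i then 1 - \<theta> else 1)))
     \<le> exp (log_gf (\<lambda>_ :: 'd. \<beta>)) / (8 * real CARD('d))"
proof -
  let ?d = "CARD('d)"
  define \<kappa> where "\<kappa> = kappa ?d"
  define c where "c = (\<lambda>j :: 'd. if j = i then 1 - \<theta> else 1)"
  have \<kappa>: "\<kappa> > 0" unfolding \<kappa>_def using d by (rule kappa_pos)
  have c: "c j > 0" for j using \<theta> by (simp add: c_def)
  have prod_c: "(\<Prod>j\<in>UNIV. c j) = 1 - \<theta>" by (simp add: c_def prod.delta)
  have d0: "(0::real) ^ ?d = 0" using d by simp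
  have "((\<lambda>\<beta>. \<beta> ^ ?d * log_gf (\<lambda>j. \<beta> * c j) - \<beta> ^ ?d * log_gf (\<lambda>j :: 'd. \<beta> * 1) - \<theta> * m * \<kappa> + \<beta> ^ ?d * ln (8 * real ?d))
     \<longlongrightarrow> \<kappa> / (\<Prod>j\<in>UNIV. c j) - \<kappa> / (\<Prod>j\<in>(UNIV :: 'd set). 1) - \<theta> * m * \<kappa> + 0 ^ ?d * ln (8 * real ?d)) (at_right 0)"
    unfolding \<kappa>_def by (intro tendsto_intros log_gf_limit c d) simp
  moreover have "\<kappa> / (\<Prod>j\<in>UNIV. c j) - \<kappa> / (\<Prod>j\<in>(UNIV :: 'd set). 1) - \<theta> * m * \<kappa> + 0 ^ ?d * ln (8 * real ?d) < 0"
  proof -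
    have "\<kappa> * 1 < \<kappa> * ((1 + \<theta> * m) * (1 - \<theta>))" using \<kappa> gain by (intro mult_strict_left_mono)
    hence "\<kappa> / (1 - \<theta>) < \<kappa> * (1 + \<theta> * m)" using \<theta> by (simp add: field_simps)
    thus ?thesis by (simp add: prod_c d0 algebra_simps)
  qed
  ultimately have "\<forall>\<^sub>F \<beta> in at_right 0. \<beta> ^ ?d * log_gf (\<lambda>j. \<beta> * c j) - \<beta> ^ ?d * log_gf (\<lambda>_ :: 'd. \<beta> * 1)
      - \<theta> * m * \<kappa> + \<beta> ^ ?d * ln (8 * real ?d) < 0"
    by (rule order_tendstoD)
  thus ?thesis using eventually_at_right_less[of "0::real"]
  proof eventually_elim
    case (elim \<beta>)
    let ?T = "\<theta> * \<beta> * (m * (\<kappa> / \<beta> ^ (?d + 1)))"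
    have "\<beta> ^ ?d * ?T = \<theta> * m * \<kappa>" using elim by simp
    hence "\<beta> ^ ?d * (log_gf (\<lambda>j. \<beta> * c j) - log_gf (\<lambda>_ :: 'd. \<beta>) - ?T + ln (8 * real ?d)) < 0"
      using elim by (simp only: distrib_left right_diff_distrib mult_1_right)
    hence "log_gf (\<lambda>j. \<beta> * c j) - log_gf (\<lambda>_ :: 'd. \<beta>) - ?T + ln (8 * real ?d) < 0"
      using elim by (simp add: mult_less_0_iff)
    hence "exp (- ?T + log_gf (\<lambda>j. \<beta> * c j)) \<le> exp (log_gf (\<lambda>_ :: 'd. \<beta>) - ln (8 * real ?d))"
      by simp
    thus ?case unfolding exp_add exp_diff \<kappa>_def c_def by simp
  qed
qed

text \<open>The totals outside the window carry at most a quarter of the generating function. The window contains polynomially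
  many totals, so the largest term in it has the same logarithm as the generating function up to an error much smaller than
  \<open>1 / \<beta> ^ d\<close>.\<close>

lemma count_concentration:
  fixes \<rho> :: real
  assumes \<rho>: "0 < \<rho>" "\<rho> < 1" and d: "CARD('d::{finite,linorder}) \<ge> 2"
  defines "\<kappa> \<equiv> kappa CARD('d)"
  defines "\<nu> \<equiv> \<lambda>\<beta>. \<kappa> / \<beta> ^ (CARD('d) + 1)"
  shows "\<forall>\<^sub>F \<beta> in at_right 0. \<exists>M :: int ^ 'd::{finite,linorder}.
     M \<in> count_window ((1 - \<rho>) * \<nu> \<beta>) ((1 + \<rho>) * \<nu> \<beta>) \<and> zono_count M > 0 \<and>
     weight (\<lambda>_. \<beta>) M + log_gf (\<lambda>_ :: 'd. \<beta>) - ln (zono_count M) \<le> \<rho> / \<beta> ^ CARD('d)"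
proof -
  let ?d = "CARD('d)"
  have \<kappa>: "\<kappa> > 0" unfolding \<kappa>_def using d by (rule kappa_pos)
  \<comment> \<open>Small enough for both tails: \<open>1 < (1 + \<theta> * (1 + \<rho>)) * (1 - \<theta>)\<close> and \<open>1 < (1 - \<theta> * (1 - \<rho>)) * (1 + \<theta>)\<close>.\<close>
  define \<theta> where "\<theta> = \<rho> / 3"
  have \<theta>: "0 < \<theta>" "\<theta> < 1" using \<rho> by (auto simp: \<theta>_def)
  define up where "up = (\<lambda>i j :: 'd. if j = i then 1 + \<theta> else 1)"
  define dn where "dn = (\<lambda>i j :: 'd. if j = i then 1 - \<theta> else 1)"
  have pos: "\<forall>\<^sub>F \<beta> in at_right 0. \<beta> > (0::real)" by (rule eventually_at_right_less)
  have tail_dn: "\<forall>\<^sub>F \<beta> in at_right 0. exp (- (\<theta> * \<beta> * ((1 + \<rho>) * \<nu> \<beta>))) * exp (log_gf (\<lambda>j. \<beta> * dn i j))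
       \<le> exp (log_gf (\<lambda>_ :: 'd. \<beta>)) / (8 * real ?d)" for i
    unfolding dn_def \<nu>_def \<kappa>_def using \<theta> \<rho>
    by (intro tilted_tail_bound d) (simp_all add: \<theta>_def field_simps power2_eq_square)
  have tail_up: "\<forall>\<^sub>F \<beta> in at_right 0. exp (\<theta> * \<beta> * ((1 - \<rho>) * \<nu> \<beta>)) * exp (log_gf (\<lambda>j. \<beta> * up i j))
       \<le> exp (log_gf (\<lambda>_ :: 'd. \<beta>)) / (8 * real ?d)" for i
  proof -
    have "- \<theta> < 1" using \<theta> by simp
    moreover have "1 < (1 + - \<theta> * (1 - \<rho>)) * (1 - - \<theta>)"
      using \<rho> by (simp add: \<theta>_def field_simps power2_eq_square) (smt (verit) mult_strict_right_mono mult_pos_pos mult_less_cancel_left_pos)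
    ultimately show ?thesis
      using tilted_tail_bound[OF _ _ d, of "- \<theta>" "1 - \<rho>" i] unfolding up_def \<nu>_def \<kappa>_def
      by (simp only: mult_minus_left minus_minus diff_minus_eq_add)
  qed
  \<comment> \<open>A bound for \<open>\<beta> ^ d\<close> times the logarithm of the number of totals in the window.\<close>
  define h where "h = (\<lambda>\<beta>::real. \<beta> * ln 2 + real ?d * ln (2 * \<kappa> + 1) * \<beta> + real ?d * real (?d + 1) * (\<beta> * ln (1 / \<beta>)))"
  have h: "(h \<longlongrightarrow> 0 * ln 2 + real ?d * ln (2 * \<kappa> + 1) * 0 + real ?d * real (?d + 1) * 0) (at_right 0)"
    unfolding h_def
  proof (intro tendsto_add tendsto_mult tendsto_const tendsto_ident_at)
    show "((\<lambda>\<beta>::real. \<beta> * ln (1 / \<beta>)) \<longlongrightarrow> 0) (at_right 0)" by real_asymp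
  qed
  have h_small: "\<forall>\<^sub>F \<beta> in at_right 0. h \<beta> < \<rho>"
    by (rule order_tendstoD[OF h]) (use \<rho> in simp)
  have entropy: "\<forall>\<^sub>F \<beta> in at_right 0. ln (2 * ((1 + \<rho>) * \<nu> \<beta> + 1) ^ ?d) \<le> \<rho> / \<beta> ^ ?d"
    using pos h_small eventually_at_right_real[of 0 "1::real", simplified]
  proof eventually_elim
    case (elim \<beta>)
    hence b: "0 < \<beta>" "\<beta> < 1" by auto
    have b1: "\<beta> ^ (?d + 1) \<le> 1" "\<beta> ^ (?d + 1) > 0" using b by (auto simp: power_le_one simp del: power_Suc)
    have \<nu>: "\<nu> \<beta> > 0" using \<kappa> b by (simp add: \<nu>_def)
    have "(1 + \<rho>) * \<nu> \<beta> + 1 \<le> 2 * \<nu> \<beta> + 1 / \<beta> ^ (?d + 1)"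
      using b1 \<rho> \<nu> by (intro add_mono mult_right_mono) (auto simp del: power_Suc)
    also have "\<dots> = (2 * \<kappa> + 1) / \<beta> ^ (?d + 1)" by (simp add: \<nu>_def add_divide_distrib)
    finally have le: "(1 + \<rho>) * \<nu> \<beta> + 1 \<le> (2 * \<kappa> + 1) / \<beta> ^ (?d + 1)" .
    have gt: "(1 + \<rho>) * \<nu> \<beta> + 1 > 1" using \<rho> \<nu> by simp
    have l0: "ln ((1 + \<rho>) * \<nu> \<beta> + 1) \<le> ln ((2 * \<kappa> + 1) / \<beta> ^ (?d + 1))"
      using le gt by (subst ln_le_cancel_iff) linarith+
    also have "\<dots> = ln (2 * \<kappa> + 1) + real (?d + 1) * ln (1 / \<beta>)"
      using \<kappa> b by (simp add: ln_div ln_realpow del: power_Suc)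
    finally have l1: "ln ((1 + \<rho>) * \<nu> \<beta> + 1) \<le> ln (2 * \<kappa> + 1) + real (?d + 1) * ln (1 / \<beta>)" .
    have l2: "ln (2 * ((1 + \<rho>) * \<nu> \<beta> + 1) ^ ?d) = ln 2 + real ?d * ln ((1 + \<rho>) * \<nu> \<beta> + 1)"
      using gt by (simp add: ln_mult ln_realpow)
    have "\<beta> ^ ?d * ln (2 * ((1 + \<rho>) * \<nu> \<beta> + 1) ^ ?d) \<le> \<beta> ^ 1 * ln (2 * ((1 + \<rho>) * \<nu> \<beta> + 1) ^ ?d)"
    proof (intro mult_right_mono power_decreasing)
      show "ln (2 * ((1 + \<rho>) * \<nu> \<beta> + 1) ^ ?d) \<ge> 0" unfolding l2 using gt by (intro add_nonneg_nonneg mult_nonneg_nonneg) auto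
    qed (use b d in auto)
    also have "\<dots> \<le> \<beta> * (ln 2 + real ?d * (ln (2 * \<kappa> + 1) + real (?d + 1) * ln (1 / \<beta>)))"
      unfolding l2 power_one_right using b l1 by (intro mult_left_mono add_left_mono) auto
    also have "\<dots> = h \<beta>" by (simp add: h_def algebra_simps)
    finally have "\<beta> ^ ?d * ln (2 * ((1 + \<rho>) * \<nu> \<beta> + 1) ^ ?d) \<le> \<rho>" using elim by linarith
    thus ?case using b by (simp add: field_simps)
  qed
  have tails: "\<forall>\<^sub>F \<beta> in at_right 0. \<forall>i. exp (- (\<theta> * \<beta> * ((1 + \<rho>) * \<nu> \<beta>))) * exp (log_gf (\<lambda>j. \<beta> * dn i j))
       \<le> exp (log_gf (\<lambda>_ :: 'd. \<beta>)) / (8 * real ?d) \<and> exp (\<theta> * \<beta> * ((1 - \<rho>) * \<nu> \<beta>)) * exp (log_gf (\<lambda>j. \<beta> * up i j))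
       \<le> exp (log_gf (\<lambda>_ :: 'd. \<beta>)) / (8 * real ?d)"
    by (intro eventually_all_finite eventually_conj tail_dn tail_up)
  from pos tails entropy show ?thesis
  proof eventually_elim
    case (elim \<beta>)
    let ?U = "(1 + \<rho>) * \<nu> \<beta>" and ?L = "(1 - \<rho>) * \<nu> \<beta>" and ?F = "log_gf (\<lambda>_ :: 'd. \<beta>)"
    let ?W = "count_window ?L ?U :: (int, 'd) vec set" and ?w = "weight (\<lambda>_ :: 'd. \<beta>)"
    have \<nu>: "\<nu> \<beta> > 0" using \<kappa> elim by (simp add: \<nu>_def)
    have U: "?U > 0" using \<nu> \<rho> by simp
    define D where "D = (?U + 1) ^ ?d"
    have D: "D > 0" using U by (simp add: D_def)
    have "exp ?F \<le> (\<Sum>M\<in>?W. zono_count M * exp (- ?w M)) +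
       (\<Sum>i\<in>UNIV. exp (- (\<theta> * \<beta> * ?U)) * exp (log_gf (\<lambda>j. \<beta> * dn i j)) + exp (\<theta> * \<beta> * ?L) * exp (log_gf (\<lambda>j. \<beta> * up i j)))"
      unfolding dn_def up_def by (rule exp_log_gf_le_window) (use elim \<theta> in auto)
    also have "(\<Sum>i\<in>UNIV. exp (- (\<theta> * \<beta> * ?U)) * exp (log_gf (\<lambda>j. \<beta> * dn i j)) + exp (\<theta> * \<beta> * ?L) * exp (log_gf (\<lambda>j. \<beta> * up i j)))
       \<le> (\<Sum>i\<in>(UNIV :: 'd set). exp ?F / (8 * real ?d) + exp ?F / (8 * real ?d))"
      using elim by (intro sum_mono add_mono) auto
    also have "\<dots> = exp ?F / 4" by simp
    finally have W: "exp ?F * (3/4) \<le> (\<Sum>M\<in>?W. zono_count M * exp (- ?w M))" by simp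
    have "\<exists>M\<in>?W. zono_count M * exp (- ?w M) \<ge> exp ?F / (2 * D)"
    proof (rule ccontr)
      assume "\<not> ?thesis"
      hence "(\<Sum>M\<in>?W. zono_count M * exp (- ?w M)) \<le> real (card ?W) * (exp ?F / (2 * D))"
        by (intro sum_bounded_above) (auto simp: not_le less_imp_le)
      also have "\<dots> \<le> D * (exp ?F / (2 * D))"
        using card_count_window_le[of ?U ?L, where 'd='d] U D by (intro mult_right_mono) (auto simp: D_def)
      also have "\<dots> = exp ?F / 2" using D by simp
      finally show False using W exp_gt_zero[of ?F] by linarith
    qed
    then obtain M where M: "M \<in> ?W" "zono_count M * exp (- ?w M) \<ge> exp ?F / (2 * D)" by blast
    have "exp ?F / (2 * D) > 0" using D by simp
    with M(2) have "zono_count M * exp (- ?w M) > 0" by linarith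
    hence a: "zono_count M > 0" by (simp add: zero_less_mult_iff)
    have "exp (?F - ln (2 * D) + ?w M) = exp ?F / (2 * D) * exp (?w M)" using D by (simp add: exp_add exp_diff)
    also have "\<dots> \<le> zono_count M * exp (- ?w M) * exp (?w M)" using M(2) by (intro mult_right_mono) auto
    also have "\<dots> = zono_count M" by (simp add: mult.assoc exp_add[symmetric])
    finally have "?F - ln (2 * D) + ?w M \<le> ln (zono_count M)" using a by (simp add: ln_ge_iff)
    moreover have "ln (2 * D) \<le> \<rho> / \<beta> ^ ?d" using elim by (simp add: D_def)
    ultimately show ?case using M(1) a by (intro exI[of _ M]) auto
  qed
qed

text \<open>The solution \<open>\<beta>\<close> of \<open>\<beta> ^ (d + 1) * n = kappa d\<close>, at which the coordinates of the tilted total concentrate near \<open>n\<close>.\<close>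

definition tilt :: "nat \<Rightarrow> nat \<Rightarrow> real" where
  "tilt d n = (kappa d / real n) powr (1 / (real d + 1))"

lemma powr_inverse_Suc_power: "x > 0 \<Longrightarrow> (x powr (1 / (real d + 1))) ^ (d + 1) = x"
  by (subst powr_realpow[symmetric]) (auto simp: powr_powr add.commute)

lemma tilt_pos: "d \<ge> 2 \<Longrightarrow> n > 0 \<Longrightarrow> tilt d n > 0"
  using kappa_pos[of d] by (simp add: tilt_def)

lemma tilt_power: "d \<ge> 2 \<Longrightarrow> n > 0 \<Longrightarrow> tilt d n ^ (d + 1) * real n = kappa d"
  using kappa_pos[of d] unfolding tilt_def by (subst powr_inverse_Suc_power) auto

lemma tilt_tendsto_0:
  assumes d: "d \<ge> 2" shows "tilt d \<longlonglongrightarrow> 0"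
proof -
  have "(\<lambda>n. (kappa d / real n) powr (1 / (real d + 1))) \<longlonglongrightarrow> 0"
  proof (rule tendsto_eq_rhs)
    show "(\<lambda>n. (kappa d / real n) powr (1 / (real d + 1))) \<longlonglongrightarrow> 0 powr (1 / (real d + 1))"
    proof (rule tendsto_powr')
      show "(\<lambda>n. kappa d / real n) \<longlonglongrightarrow> 0" by (rule lim_const_over_n)
      have "kappa d / real n \<ge> 0" for n using kappa_pos[OF d] by simp
      thus "0 \<noteq> (0::real) \<or> 0 < 1 / (real d + 1) \<and> (\<forall>\<^sub>F n in sequentially. 0 \<le> kappa d / real n)" by simp
    qed auto
  qed simp
  thus ?thesis by (simp add: tilt_def[abs_def])
qed

lemma filterlim_tilt:
  assumes "d \<ge> 2" "q > 0" shows "filterlim (\<lambda>n. tilt d n * q) (at_right 0) sequentially"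
proof (rule tendsto_imp_filterlim_at_right)
  show "(\<lambda>n. tilt d n * q) \<longlonglongrightarrow> 0" using tendsto_mult[OF tilt_tendsto_0[OF assms(1)] tendsto_const, of q] by simp
  show "\<forall>\<^sub>F n in sequentially. tilt d n * q > 0"
    using eventually_gt_at_top[of 0] by eventually_elim (use tilt_pos assms in auto)
qed

lemma weight_const: "weight (\<lambda>_ :: 'd::finite. \<beta>) m = \<beta> * (\<Sum>i\<in>UNIV. \<bar>real_of_int (m $ i)\<bar>)"
  by (simp add: weight_def sum_distrib_left)

text \<open>Concentration is used at the slightly larger tilt \<open>\<beta> * q\<close>. There the coordinates of the total \<open>M\<close> with a large count are at
  most \<open>(1 - \<rho>) * n\<close>, so \<open>M \<le> N\<close> and \<open>zono_count M \<le> zono_count N\<close>. Passing from \<open>\<beta> * q\<close> and \<open>M\<close> back to \<open>\<beta>\<close> and \<open>N\<close>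
  changes the terms only by a small multiple of \<open>1 / \<beta> ^ d\<close>.\<close>

lemma log_count_lower_bound:
  fixes \<delta> :: real
  assumes \<delta>: "\<delta> > 0" and d: "CARD('d::{finite,linorder}) \<ge> 2"
  defines "\<beta> \<equiv> tilt CARD('d)"
  shows "\<exists>\<epsilon>>0. \<epsilon> < 1 \<and> (\<forall>\<^sub>F n in sequentially. \<forall>N :: int ^ 'd::{finite,linorder}.
     (\<forall>i. \<bar>real_of_int (N $ i) - real n\<bar> \<le> \<epsilon> * real n) \<longrightarrow>
       weight (\<lambda>_. \<beta> n) N + log_gf (\<lambda>_ :: 'd. \<beta> n) - ln (zono_count N) \<le> \<delta> / \<beta> n ^ CARD('d))"
proof -
  let ?d = "CARD('d)"
  define \<kappa> where "\<kappa> = kappa ?d"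
  have \<kappa>: "\<kappa> > 0" unfolding \<kappa>_def using d by (rule kappa_pos)
  \<comment> \<open>The total error at the end is at most \<open>\<rho> * c / \<beta> ^ d\<close>.\<close>
  define c where "c = 4 * (real ?d * \<kappa>) + 2 * \<kappa> + 3"
  have c: "c > 0" using \<kappa> by (simp add: c_def add_pos_pos)
  define \<rho> where "\<rho> = min (1/2) (min (\<kappa> / 2) (\<delta> / c))"
  have \<rho>: "0 < \<rho>" "\<rho> < 1" "\<rho> < \<kappa>" using \<delta> c \<kappa> by (auto simp: \<rho>_def)
  have \<rho>c: "\<rho> * c \<le> \<delta>"
  proof -
    have "\<rho> \<le> \<delta> / c" by (simp add: \<rho>_def)
    thus ?thesis using c by (simp add: field_simps)
  qed
  \<comment> \<open>The enlarged tilt \<open>\<beta> * q\<close> satisfies \<open>(1 + \<rho>) * \<kappa> / (\<beta> * q) ^ (d + 1) = (1 - \<rho>) * n\<close>, which places the whole window below \<open>N\<close>.\<close>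
  define Q where "Q = (1 + \<rho>) / (1 - \<rho>)"
  define q where "q = Q powr (1 / (real ?d + 1))"
  have Q: "Q \<ge> 1" using \<rho> by (simp add: Q_def)
  have q: "q \<ge> 1" "q ^ (?d + 1) = Q" unfolding q_def
    using Q powr_inverse_Suc_power[of Q ?d] by (auto intro!: ge_one_powr_ge_zero)
  have lim1: "((\<lambda>\<beta>. \<beta> ^ ?d * log_gf (\<lambda>j::'d. \<beta>)) \<longlongrightarrow> \<kappa>) (at_right 0)"
    using log_gf_limit[of "\<lambda>_::'d. 1"] d by (simp add: \<kappa>_def)
  have up: "\<forall>\<^sub>F \<beta> in at_right 0. \<beta> ^ ?d * log_gf (\<lambda>j::'d. \<beta>) < \<kappa> + \<rho>"
    and dn: "\<forall>\<^sub>F \<beta> in at_right 0. \<beta> ^ ?d * log_gf (\<lambda>j::'d. \<beta>) > \<kappa> - \<rho>"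
    by (rule order_tendstoD[OF lim1]; use \<rho> in simp)+
  have f1: "filterlim \<beta> (at_right 0) sequentially"
    using filterlim_tilt[OF d, of 1] by (simp add: \<beta>_def)
  have fq: "filterlim (\<lambda>n. \<beta> n * q) (at_right 0) sequentially"
    using filterlim_tilt[OF d, of q] q by (simp add: \<beta>_def)
  have conc: "\<forall>\<^sub>F \<beta> in at_right 0. \<exists>M :: (int, 'd) vec.
     M \<in> count_window ((1 - \<rho>) * (\<kappa> / \<beta> ^ (?d + 1))) ((1 + \<rho>) * (\<kappa> / \<beta> ^ (?d + 1))) \<and> zono_count M > 0 \<and>
     weight (\<lambda>_. \<beta>) M + log_gf (\<lambda>_ :: 'd. \<beta>) - ln (zono_count M) \<le> \<rho> / \<beta> ^ ?d"
    using count_concentration[OF \<rho>(1,2) d] by (simp add: \<kappa>_def)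
  have "\<forall>\<^sub>F n in sequentially. \<forall>N :: (int, 'd) vec.
     (\<forall>i. \<bar>real_of_int (N $ i) - real n\<bar> \<le> \<rho> * real n) \<longrightarrow>
       weight (\<lambda>_. \<beta> n) N + log_gf (\<lambda>_ :: 'd. \<beta> n) - ln (zono_count N) \<le> \<delta> / \<beta> n ^ ?d"
    using eventually_compose_filterlim[OF up f1] eventually_compose_filterlim[OF dn fq]
      eventually_compose_filterlim[OF conc fq] eventually_gt_at_top[of 0]
  proof eventually_elim
    case (elim n)
    define b where "b = \<beta> n"
    have b: "b > 0" "b ^ (?d + 1) * real n = \<kappa>"
      using tilt_pos[OF d elim(4)] tilt_power[OF d elim(4)] by (simp_all add: b_def \<beta>_def \<kappa>_def)
    define \<nu> where "\<nu> = \<kappa> / (b * q) ^ (?d + 1)"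
    define X where "X = (b * q) ^ (?d + 1)"
    have X: "X > 0" using b q by (simp add: X_def)
    have "X * real n = (b ^ (?d + 1) * real n) * q ^ (?d + 1)"
      unfolding X_def power_mult_distrib by (simp only: mult_ac)
    hence "X * real n = \<kappa> * Q" unfolding b q .
    hence "\<nu> = real n / Q" using X Q unfolding \<nu>_def X_def[symmetric] by (simp add: field_simps)
    moreover have "(1 + \<rho>) * (real n / Q) = (1 - \<rho>) * real n" using \<rho> by (simp add: Q_def)
    ultimately have \<nu>: "(1 + \<rho>) * \<nu> = (1 - \<rho>) * real n" "\<nu> > 0"
      using Q elim(4) by simp_all
    from elim(3) obtain M :: "(int, 'd) vec" where M: "M \<in> count_window ((1 - \<rho>) * \<nu>) ((1 + \<rho>) * \<nu>)"
      "zono_count M > 0" "weight (\<lambda>_. b * q) M + log_gf (\<lambda>_ :: 'd. b * q) - ln (zono_count M) \<le> \<rho> / (b * q) ^ ?d"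
      unfolding b_def[symmetric] \<nu>_def[symmetric] by blast
    show ?case
    proof (intro allI impI)
      fix N :: "(int, 'd) vec" assume N: "\<forall>i. \<bar>real_of_int (N $ i) - real n\<bar> \<le> \<rho> * real n"
      have NM: "M $ i \<le> N $ i" for i
      proof -
        have "real_of_int (M $ i) \<le> (1 - \<rho>) * real n" using M(1) \<nu> by (auto simp: count_window_def)
        also have "\<dots> \<le> real_of_int (N $ i)" using N[rule_format, of i] by (simp add: algebra_simps abs_le_iff)
        finally show ?thesis by simp
      qed
      have "ln (zono_count M) \<le> ln (zono_count N)"
        using M(2) zono_count_mono[of M N, OF NM] by (simp add: ln_mono)
      hence 1: "ln (zono_count N) \<ge> weight (\<lambda>_. b * q) M + log_gf (\<lambda>_ :: 'd. b * q) - \<rho> / (b * q) ^ ?d"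
        using M(3) by linarith
      define r where "r = 1 / q ^ ?d"
      have r: "0 < r" "r \<le> 1" "r \<ge> 1 - 2 * \<rho>"
      proof -
        show "0 < r" "r \<le> 1" using q by (auto simp: r_def)
        have "q ^ ?d \<le> Q" using q(1) q(2) power_increasing[of ?d "?d + 1" q] by simp
        hence "1 / Q \<le> r" using q Q by (simp add: r_def frac_le)
        moreover have "1 - 2 * \<rho> \<le> 1 / Q" using \<rho> by (simp add: Q_def field_simps)
        ultimately show "r \<ge> 1 - 2 * \<rho>" by linarith
      qed
      have bq: "b ^ ?d = (b * q) ^ ?d * r" using q by (simp add: r_def power_mult_distrib)
      have wN: "b ^ ?d * weight (\<lambda>_. b) N \<le> real ?d * \<kappa> * (1 + \<rho>)"
      proof -
        have "(\<Sum>i\<in>UNIV. \<bar>real_of_int (N $ i)\<bar>) \<le> (\<Sum>i\<in>(UNIV::'d set). (1 + \<rho>) * real n)"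
          
        proof (intro sum_mono)
          fix i :: 'd
          have "\<bar>real_of_int (N $ i)\<bar> \<le> \<bar>real_of_int (N $ i) - real n\<bar> + real n" by linarith
          also have "\<dots> \<le> \<rho> * real n + real n" using N by simp
          finally show "\<bar>real_of_int (N $ i)\<bar> \<le> (1 + \<rho>) * real n" by (simp add: algebra_simps)
        qed
        hence "b ^ ?d * weight (\<lambda>_. b) N \<le> b ^ ?d * (b * (real ?d * ((1 + \<rho>) * real n)))"
          unfolding weight_const using b by (intro mult_left_mono) auto
        also have "\<dots> = (b ^ (?d + 1) * real n) * real ?d * (1 + \<rho>)" by simp
        finally show ?thesis unfolding b by (simp add: mult_ac)
      qed
      have wM: "b ^ ?d * weight (\<lambda>_. b * q) M \<ge> r * (real ?d * \<kappa> * (1 - \<rho>))"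
      proof -
        have "(\<Sum>i\<in>(UNIV::'d set). (1 - \<rho>) * \<nu>) \<le> (\<Sum>i\<in>UNIV. \<bar>real_of_int (M $ i)\<bar>)"
          using M(1) by (intro sum_mono order.trans[OF _ abs_ge_self]) (auto simp: count_window_def)
        hence "b ^ ?d * weight (\<lambda>_. b * q) M \<ge> b ^ ?d * ((b * q) * (real ?d * ((1 - \<rho>) * \<nu>)))"
          unfolding weight_const using b q by (intro mult_left_mono) auto
        moreover have "b ^ ?d * ((b * q) * (real ?d * ((1 - \<rho>) * \<nu>))) = r * (((b * q) ^ (?d + 1) * \<nu>) * real ?d * (1 - \<rho>))"
          unfolding bq by simp
        moreover have e: "(b * q) ^ (?d + 1) * \<nu> = \<kappa>" using b q by (simp add: \<nu>_def)
        ultimately have "b ^ ?d * weight (\<lambda>_. b * q) M \<ge> r * (\<kappa> * real ?d * (1 - \<rho>))" unfolding e by linarith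
        thus ?thesis by (simp only: mult.commute[of \<kappa>])
      qed
      have lg: "b ^ ?d * log_gf (\<lambda>_ :: 'd. b * q) \<ge> r * (\<kappa> - \<rho>)"
        unfolding bq using mult_left_mono[of "\<kappa> - \<rho>" "(b * q) ^ ?d * log_gf (\<lambda>_ :: 'd. b * q)" r] elim(2) r
        by (simp add: b_def mult_ac)
      have "b ^ ?d * (weight (\<lambda>_. b) N + log_gf (\<lambda>_ :: 'd. b) - ln (zono_count N)) \<le>
         b ^ ?d * (weight (\<lambda>_. b) N + log_gf (\<lambda>_ :: 'd. b) - (weight (\<lambda>_. b * q) M + log_gf (\<lambda>_ :: 'd. b * q) - \<rho> / (b * q) ^ ?d))"
        using b 1 by (intro mult_left_mono) auto
      also have "\<dots> = b ^ ?d * weight (\<lambda>_. b) N + b ^ ?d * log_gf (\<lambda>_ :: 'd. b) - b ^ ?d * weight (\<lambda>_. b * q) M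
           - b ^ ?d * log_gf (\<lambda>_ :: 'd. b * q) + b ^ ?d * (\<rho> / (b * q) ^ ?d)"
        by (simp add: algebra_simps)
      also have "b ^ ?d * (\<rho> / (b * q) ^ ?d) = r * \<rho>" unfolding bq using b q by simp
      also have "b ^ ?d * weight (\<lambda>_. b) N + b ^ ?d * log_gf (\<lambda>_ :: 'd. b) - b ^ ?d * weight (\<lambda>_. b * q) M
           - b ^ ?d * log_gf (\<lambda>_ :: 'd. b * q) + r * \<rho>
         \<le> real ?d * \<kappa> * (1 + \<rho>) + (\<kappa> + \<rho>) - r * (real ?d * \<kappa> * (1 - \<rho>)) - r * (\<kappa> - \<rho>) + \<rho>"
        using wN wM lg elim(1)[folded b_def] mult_right_mono[OF r(2) less_imp_le[OF \<rho>(1)]] by linarith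
      also have "\<dots> = real ?d * \<kappa> * (1 + \<rho>) + \<kappa> + 2 * \<rho> - r * (real ?d * \<kappa> * (1 - \<rho>) + (\<kappa> - \<rho>))"
        by (simp add: algebra_simps)
      also have "\<dots> \<le> real ?d * \<kappa> * (1 + \<rho>) + \<kappa> + 2 * \<rho> - (1 - 2 * \<rho>) * (real ?d * \<kappa> * (1 - \<rho>) + (\<kappa> - \<rho>))"
        using r(3) \<rho> \<kappa> by (intro diff_left_mono mult_right_mono add_nonneg_nonneg mult_nonneg_nonneg) auto
      also have "\<dots> = \<rho> * c - 2 * \<rho>\<^sup>2 * (real ?d * \<kappa> + 1)"
        by (simp add: c_def algebra_simps power2_eq_square)
      also have "\<dots> \<le> \<rho> * c" using \<kappa> by simp
      also have "\<dots> \<le> \<delta>" by (rule \<rho>c)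
      finally show "weight (\<lambda>_. \<beta> n) N + log_gf (\<lambda>_ :: 'd. \<beta> n) - ln (zono_count N) \<le> \<delta> / \<beta> n ^ ?d"
        using b(1) unfolding b_def by (simp add: field_simps)
    qed
  qed
  with \<rho> show ?thesis by blast
qed

section \<open>Ratios of counts\<close>

lemma card_multiples_le:
  fixes u :: int
  assumes "g > 0"
  shows "real (card {x \<in> {u<..u + int L}. g dvd x}) \<le> real L / real_of_int g + 1"
proof -
  let ?S = "{x \<in> {u<..u + int L}. g dvd x}"
  have inj: "inj_on (\<lambda>x. x div g) ?S" by (rule inj_onI) (metis (mono_tags, lifting) dvd_div_mult_self mem_Collect_eq)
  have "(\<lambda>x. x div g) ` ?S \<subseteq> {u div g<..(u + int L) div g}"
  proof (intro image_subsetI)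
    fix x assume x: "x \<in> ?S"
    then obtain k where k: "x = g * k" by (auto elim: dvdE)
    have "u div g < k"
    proof (rule ccontr)
      assume "\<not> u div g < k"
      hence "g * k \<le> g * (u div g)" using assms by (intro mult_left_mono) auto
      also have "\<dots> \<le> u" using assms pos_mod_sign[of g u] mult_div_mod_eq[of g u] by linarith
      finally show False using x k by auto
    qed
    moreover have "k \<le> (u + int L) div g"
      using x k assms zdiv_mono1[of "g * k" "u + int L" g] by simp
    ultimately show "x div g \<in> {u div g<..(u + int L) div g}" using k assms by auto
  qed
  from card_mono[OF _ this] have "card ?S \<le> nat ((u + int L) div g - u div g)"
    using card_image[OF inj] by simp
  hence "real (card ?S) \<le> real (nat ((u + int L) div g - u div g))" by simp
  also have "\<dots> = real_of_int ((u + int L) div g) - real_of_int (u div g)"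
    using assms by (simp add: zdiv_mono1)
  also have "\<dots> \<le> real L / real_of_int g + 1"
  proof -
    have "real_of_int ((u + int L) div g) \<le> real_of_int (u + int L) / real_of_int g"
      by (rule real_of_int_div4)
    moreover have "real_of_int u / real_of_int g - 1 \<le> real_of_int (u div g)"
      using real_of_int_div3[of u g] by linarith
    ultimately show ?thesis by (simp add: add_divide_distrib)
  qed
  finally show ?thesis .
qed

text \<open>A crude bound that is small against \<open>R\<close>, in place of the logarithm.\<close>

lemma sum_inverse_le_sqrt: "(\<Sum>g=1..R. 1 / real g) \<le> 2 * sqrt (real R)"
proof (induction R)
  case (Suc R)
  have "1 / real (Suc R) \<le> 2 * (sqrt (real (Suc R)) - sqrt (real R))"
  proof -
    let ?a = "sqrt (real (Suc R))" and ?b = "sqrt (real R)"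
    have ab: "?a > 0" "?b \<ge> 0" "?b \<le> ?a" "?a \<ge> 1" by auto
    have "(?a - ?b) * (?a + ?b) = 1" by (simp add: algebra_simps)
    hence "?a - ?b = 1 / (?a + ?b)" using ab by (intro eq_divide_imp) (auto simp del: of_nat_Suc)
    also have "\<dots> \<ge> 1 / (2 * ?a)" using ab by (intro divide_left_mono mult_pos_pos add_pos_nonneg) (auto simp del: of_nat_Suc)
    finally have "2 * (?a - ?b) \<ge> 1 / ?a" by simp
    moreover have "1 / ?a \<ge> 1 / (?a * ?a)"
      using ab mult_left_mono[OF ab(4), of ?a] by (intro divide_left_mono mult_pos_pos) (auto simp del: of_nat_Suc real_sqrt_mult_self)
    moreover have "?a * ?a = real (Suc R)" by simp
    ultimately show ?thesis by (simp del: of_nat_Suc)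
  qed
  with Suc show ?case by simp
qed simp

definition primitive_box :: "int ^ 'd::{finite,linorder} \<Rightarrow> nat \<Rightarrow> (int ^ 'd::{finite,linorder}) set" where
  "primitive_box u L = {v \<in> primitive_vectors. \<forall>i. v $ i \<in> {u $ i<..u $ i + int L}}"

text \<open>If a vector in the box is not primitive, then some \<open>g \<ge> 2\<close> divides its coordinates \<open>i1\<close> and \<open>i2\<close>. For given \<open>g\<close> this leaves at most
  \<open>(L / g + 1)\<^sup>2\<close> of the \<open>L\<^sup>2\<close> pairs. As the inverse squares of \<open>g \<ge> 2\<close> add up to at most 3/4, a positive fraction of the box is
  primitive. The condition on \<open>L\<close>, with \<open>4096 = 64\<^sup>2\<close>, makes the terms of order \<open>L powr (3/2)\<close> at most an eighth of \<open>L\<^sup>2\<close>.\<close>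

lemma card_primitive_box_ge:
  fixes u :: "int ^ 'd::{finite,linorder}"
  assumes d: "CARD('d) \<ge> 2" and C: "C \<ge> 0" and L: "real L \<ge> 4096 * (C + 1)"
    and u: "\<And>i. u $ i \<ge> 0" "\<And>i. real_of_int (u $ i) \<le> C * real L"
  shows "real (card (primitive_box u L)) \<ge> real L ^ CARD('d) / 8"
proof -
  let ?d = "CARD('d)"
  obtain i1 i2 :: 'd where i12: "i1 \<noteq> i2"
  proof -
    have "\<not> card (UNIV :: 'd set) \<le> Suc 0" using d by simp
    hence "\<not> (\<forall>x\<in>(UNIV :: 'd set). \<forall>y\<in>UNIV. x = y)" using card_le_Suc0_iff_eq[of "UNIV :: 'd set"] by simp
    thus ?thesis using that by blast
  qed
  have L1: "real L \<ge> 4096" using L C by (simp add: algebra_simps)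
  define X where "X = {v :: (int, 'd) vec. \<forall>i. v $ i \<in> {u $ i<..u $ i + int L}}"
  define S where "S = (\<lambda>g i. if i = i1 \<or> i = i2 then {x \<in> {u $ i<..u $ i + int L}. int g dvd x} else {u $ i<..u $ i + int L})"
  define Bad where "Bad = (\<lambda>g. {v :: (int, 'd) vec. \<forall>i. v $ i \<in> S g i})"
  \<comment> \<open>Divisors of a positive coordinate of a vector in the box are at most \<open>R\<close>.\<close>
  define R where "R = nat \<lfloor>(C + 1) * real L\<rfloor>"
  have finS: "finite (S g i)" for g i by (auto simp: S_def intro: finite_subset[of _ "{u $ i<..u $ i + int L}"])
  have finX: "finite X" unfolding X_def by (rule finite_int_vec_box) auto
  have finB: "finite (Bad g)" for g unfolding Bad_def by (rule finite_int_vec_box) (rule finS)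
  have cardX: "card X = L ^ ?d" unfolding X_def by (subst card_int_vec_box) auto
  have R: "real R \<le> (C + 1) * real L" "R \<ge> 2"
  proof -
    show "real R \<le> (C + 1) * real L" using C by (simp add: R_def)
    have "(2::real) \<le> 1 * real L" using L1 by simp
    also have "\<dots> \<le> (C + 1) * real L" using C by (intro mult_right_mono) auto
    finally show "R \<ge> 2" unfolding R_def by (simp add: le_nat_iff le_floor_iff)
  qed
  have cover: "X - primitive_box u L \<subseteq> (\<Union>g\<in>{2..R}. Bad g)"
  proof
    fix v assume v: "v \<in> X - primitive_box u L"
    have vpos: "v $ i > 0" for i
    proof -
      have "u $ i < v $ i" using v by (auto simp: X_def)
      thus ?thesis using u(1)[of i] by linarith
    qed
    define g where "g = Gcd (range (\<lambda>i. v $ i))"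
    have gd: "g dvd v $ i" for i unfolding g_def by (rule Gcd_dvd) auto
    have "v \<notin> primitive_vectors" using v by (auto simp: X_def primitive_box_def)
    moreover have "\<exists>i. v $ i > 0 \<and> (\<forall>j<i. v $ j = 0)"
      by (rule exI[of _ "Min UNIV"]) (auto simp: vpos)
    moreover have "v \<noteq> 0" using vpos[of i1] by auto
    ultimately have "g \<noteq> 1" by (auto simp: primitive_vectors_def g_def)
    moreover have "g \<noteq> 0" using gd[of i1] vpos[of i1] by auto
    moreover have "g \<ge> 0" by (simp add: g_def)
    ultimately have g2: "g \<ge> 2" by linarith
    have "g \<le> v $ i1" using gd[of i1] vpos[of i1] by (rule zdvd_imp_le)
    also have "\<dots> \<le> u $ i1 + int L" using v by (auto simp: X_def)
    finally have "real_of_int g \<le> real_of_int (u $ i1) + real L" by linarith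
    also have "\<dots> \<le> (C + 1) * real L" using u(2)[of i1] by (simp add: algebra_simps)
    finally have "g \<le> \<lfloor>(C + 1) * real L\<rfloor>" by (simp add: le_floor_iff)
    hence "nat g \<in> {2..R}" using g2 by (auto simp: R_def)
    moreover have "v \<in> Bad (nat g)" using v gd g2 by (auto simp: Bad_def S_def X_def)
    ultimately show "v \<in> (\<Union>g\<in>{2..R}. Bad g)" by blast
  qed
  have cardBad: "real (card (Bad g)) \<le> real L ^ (?d - 2) * (real L / real g + 1) ^ 2" if g: "g \<ge> 2" for g
  proof -
    have "real (card (Bad g)) = (\<Prod>i\<in>UNIV. real (card (S g i)))"
      unfolding Bad_def by (subst card_int_vec_box[OF finS]) simp
    also have "\<dots> = (\<Prod>i\<in>UNIV - {i1, i2}. real (card (S g i))) * (real (card (S g i1)) * real (card (S g i2)))"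
      using i12 by (subst prod.subset_diff[of "{i1, i2}"]) auto
    also have "(\<Prod>i\<in>UNIV - {i1, i2}. real (card (S g i))) = (\<Prod>i\<in>UNIV - {i1, i2}. real L)"
      by (intro prod.cong) (auto simp: S_def)
    also have "\<dots> = real L ^ (?d - 2)" using i12 by (simp add: card_Diff_subset numeral_2_eq_2)
    also have "real L ^ (?d - 2) * (real (card (S g i1)) * real (card (S g i2))) \<le>
       real L ^ (?d - 2) * ((real L / real g + 1) * (real L / real g + 1))"
      using card_multiples_le[of "int g" "u $ i1" L] card_multiples_le[of "int g" "u $ i2" L] g
      by (intro mult_left_mono mult_mono) (auto simp: S_def)
    finally show ?thesis by (simp add: power2_eq_square)
  qed
  have "(\<Sum>g=2..R. (real L / real g + 1) ^ 2) \<le> real L ^ 2 * (7 / 8)"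
  proof -
    have "(\<Sum>g=2..R. (real L / real g + 1) ^ 2) = (\<Sum>g=2..R. real L ^ 2 * (1 / real g ^ 2) + 2 * real L * (1 / real g) + 1)"
      by (intro sum.cong) (auto simp: power2_eq_square field_simps)
    also have "\<dots> = real L ^ 2 * (\<Sum>g=2..R. 1 / real g ^ 2) + 2 * real L * (\<Sum>g=2..R. 1 / real g) + real (R - 1)"
      by (simp add: sum.distrib sum_distrib_left)
    also have "\<dots> \<le> real L ^ 2 * (3/4) + 2 * real L * (real L / 32) + real L / 4096 * real L"
    proof (intro add_mono mult_left_mono)
      have "(\<Sum>g=2..R. 1 / real g ^ 2) \<le> 3/4 - 1 / real R" by (rule sum_inverse_squares_le) (use R in auto)
      also have "\<dots> \<le> 3/4" by simp
      finally show "(\<Sum>g=2..R. 1 / real g ^ 2) \<le> 3/4" .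
      have "(\<Sum>g=2..R. 1 / real g) \<le> (\<Sum>g=1..R. 1 / real g)" by (rule sum_mono2) auto
      also have "\<dots> \<le> 2 * sqrt (real R)" by (rule sum_inverse_le_sqrt)
      also have "\<dots> \<le> 2 * (real L / 64)"
      proof -
        have "real R \<le> (real L / 4096) * real L"
          using R(1) mult_right_mono[of "C + 1" "real L / 4096" "real L"] L by simp
        also have "\<dots> = (real L / 64) ^ 2" by (simp add: power2_eq_square)
        finally have "sqrt (real R) \<le> real L / 64" by (intro real_le_lsqrt) auto
        thus ?thesis by simp
      qed
      finally show "(\<Sum>g=2..R. 1 / real g) \<le> real L / 32" by simp
      have "real (R - 1) \<le> real R" by simp
      also have "\<dots> \<le> (real L / 4096) * real L"
        using R(1) mult_right_mono[of "C + 1" "real L / 4096" "real L"] L by simp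
      finally show "real (R - 1) \<le> real L / 4096 * real L" .
    qed auto
    also have "\<dots> \<le> real L ^ 2 * (7 / 8)" by (simp add: power2_eq_square)
    finally show ?thesis .
  qed
  hence sum_le: "real L ^ (?d - 2) * (\<Sum>g=2..R. (real L / real g + 1) ^ 2) \<le> real L ^ (?d - 2) * (real L ^ 2 * (7 / 8))"
    by (intro mult_left_mono) auto
  have Ld: "real L ^ (?d - 2) * real L ^ 2 = real L ^ ?d" using power_add[of "real L" "?d - 2" 2] d by (metis le_add_diff_inverse2)
  have "real (card (X - primitive_box u L)) \<le> real (card (\<Union>g\<in>{2..R}. Bad g))"
    using finB by (intro of_nat_mono card_mono cover) auto
  also have "\<dots> \<le> real (\<Sum>g=2..R. card (Bad g))" by (intro of_nat_mono card_UN_le) auto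
  also have "\<dots> \<le> (\<Sum>g=2..R. real L ^ (?d - 2) * (real L / real g + 1) ^ 2)"
    unfolding of_nat_sum by (intro sum_mono cardBad) auto
  also have "\<dots> \<le> real L ^ (?d - 2) * (real L ^ 2 * (7 / 8))"
    using sum_le by (simp add: sum_distrib_left)
  also have "\<dots> = real L ^ ?d * (7 / 8)" using Ld by simp
  finally have rest: "real (card (X - primitive_box u L)) \<le> real L ^ ?d * (7 / 8)" .
  have sub: "primitive_box u L \<subseteq> X" by (auto simp: primitive_box_def X_def)
  hence "card X = card (primitive_box u L) + card (X - primitive_box u L)"
    using finX finite_subset[OF sub finX] card_mono[OF finX sub] by (simp add: card_Diff_subset)
  hence "real (card X) = real (card (primitive_box u L)) + real (card (X - primitive_box u L))"
    by simp
  moreover have "real (card X) = real L ^ ?d" by (simp add: cardX)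
  ultimately show ?thesis using rest by linarith
qed

lemma exp_minus_le_quadratic: "0 \<le> t \<Longrightarrow> exp (- t) \<le> 1 - t + t\<^sup>2" for t :: real
proof -
  assume t: "0 \<le> t"
  have "exp (- t) * (1 + t) \<le> exp (- t) * exp t" using t by (intro mult_left_mono) auto
  hence "exp (- t) * (1 + t) \<le> 1" by (simp add: exp_add[symmetric])
  also have "1 \<le> (1 - t + t\<^sup>2) * (1 + t)" using t by (simp add: algebra_simps power2_eq_square)
  finally show ?thesis using t by (simp add: mult_le_cancel_right)
qed

text \<open>For \<open>v\<close> in the box with corner \<open>u\<close> one has \<open>u \<le> v \<le> u + e\<close>, so the ratio at \<open>v\<close> lies between those at \<open>u + e\<close> and at \<open>u\<close>.
  Its average over the box is known from \<open>sum_count_diff_le\<close>, applied with \<open>t\<close> and with \<open>- t\<close>; the hypothesis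
  \<open>defect\<close> makes the cost of conditioning at most \<open>t\<^sup>2\<close> per element of the box.\<close>

lemma count_ratio_box_bounds:
  fixes N u :: "int ^ 'd::{finite,linorder}"
  assumes d: "CARD('d) \<ge> 2" and b: "b > 0" and t: "0 < t" "t \<le> 1"
    and N: "zono_count N > 0" "zono_count (N - u) \<ge> 0"
    and card: "real (card (primitive_box u L)) \<ge> K" "K > 0"
    and defect: "weight (\<lambda>_. b) N + log_gf (\<lambda>_ :: 'd. b) - ln (zono_count N) \<le> t\<^sup>2 * K"
    and u: "\<And>i. u $ i \<ge> 0"
  defines "y \<equiv> exp (- weight (\<lambda>_. b) u)" and "e \<equiv> (\<chi> i. int L) :: int ^ 'd::{finite,linorder}"
  shows "zono_count (N - u) / zono_count N \<ge> (1 - t) * (y * exp (- b * real (CARD('d) * L))) - t"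
    and "zono_count (N - (u + e)) / zono_count N \<le> (1 + t) * y + t"
proof -
  let ?B = "primitive_box u L" and ?R = "\<lambda>w. zono_count (N - w) / zono_count N"
  let ?x = "\<lambda>v. exp (- weight (\<lambda>_. b) v)" and ?z = "exp (- b * real (CARD('d) * L))"
  have "finite {v :: (int, 'd) vec. \<forall>i. v $ i \<in> {u $ i<..u $ i + int L}}"
    by (rule finite_int_vec_box) auto
  hence B: "finite ?B" "?B \<subseteq> primitive_vectors"
    by (auto simp: primitive_box_def intro: rev_finite_subset)
  let ?n = "real (card ?B)"
  have n: "?n > 0" using card by linarith
  have tn: "t\<^sup>2 * K \<le> t * (t * ?n)" using card t by (simp add: power2_eq_square mult.assoc)
  have coord: "u $ i \<le> v $ i" "v $ i \<le> u $ i + int L" "v $ i \<ge> 0" if "v \<in> ?B" for v i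
    using that u[of i] by (auto simp: primitive_box_def intro: less_imp_le order.trans)
  have R_le: "?R (vabs v) \<le> ?R u" and R_ge: "?R (vabs v) \<ge> ?R (u + e)" if v: "v \<in> ?B" for v
  proof -
    have 1: "(N - vabs v) $ i \<le> (N - u) $ i" "(N - (u + e)) $ i \<le> (N - vabs v) $ i" for i
      using coord[OF v, of i] by (simp_all add: e_def)
    show "?R (vabs v) \<le> ?R u" "?R (vabs v) \<ge> ?R (u + e)"
      using N by (intro divide_right_mono zono_count_mono 1; simp)+
  qed
  have x_le: "?x v \<le> y" and x_ge: "?x v \<ge> y * ?z" if v: "v \<in> ?B" for v
  proof -
    have "(\<Sum>i\<in>UNIV. \<bar>real_of_int (u $ i)\<bar>) \<le> (\<Sum>i\<in>UNIV. \<bar>real_of_int (v $ i)\<bar>)"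
      using coord[OF v] u by (intro sum_mono) auto
    hence "weight (\<lambda>_. b) u \<le> weight (\<lambda>_. b) v"
      unfolding weight_const using b by (intro mult_left_mono) auto
    thus "?x v \<le> y" by (simp add: y_def)
    have "(\<Sum>i\<in>UNIV. \<bar>real_of_int (v $ i)\<bar>) \<le> (\<Sum>i\<in>UNIV. \<bar>real_of_int (u $ i)\<bar> + real L)"
    proof (intro sum_mono)
      fix i
      have "real_of_int (v $ i) \<le> real_of_int (u $ i + int L)" using coord(2)[OF v] by (simp only: of_int_le_iff)
      thus "\<bar>real_of_int (v $ i)\<bar> \<le> \<bar>real_of_int (u $ i)\<bar> + real L" using coord(3)[OF v, of i] u[of i] by simp
    qed
    hence "b * (\<Sum>i\<in>UNIV. \<bar>real_of_int (v $ i)\<bar>) \<le> b * (\<Sum>i\<in>UNIV. \<bar>real_of_int (u $ i)\<bar> + real L)"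
      using b by (intro mult_left_mono) auto
    also have "\<dots> = weight (\<lambda>_. b) u + b * real (CARD('d) * L)"
      by (simp add: weight_const sum.distrib algebra_simps)
    finally have "weight (\<lambda>_. b) v \<le> weight (\<lambda>_. b) u + b * real (CARD('d) * L)" by (simp add: weight_const)
    thus "?x v \<ge> y * ?z" unfolding y_def exp_add[symmetric] by simp
  qed
  have key: "s * (\<Sum>v\<in>?B. ?R (vabs v)) \<le> t * (t * ?n) + (exp s - 1) * (\<Sum>v\<in>?B. ?x v)" for s
    using sum_count_diff_le[of "\<lambda>_. b" N ?B s] b N B defect tn by force
  have t2: "exp t - 1 \<le> t * (1 + t)" "1 - exp (- t) \<ge> t * (1 - t)"
    using exp_bound[of t] exp_minus_le_quadratic[of t] t by (simp_all add: algebra_simps power2_eq_square)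
  show "?R u \<ge> (1 - t) * (y * ?z) - t"
  proof -
    have "(1 - exp (- t)) * (\<Sum>v\<in>?B. ?x v) - t * (t * ?n) \<le> t * (\<Sum>v\<in>?B. ?R (vabs v))"
      using key[of "- t"] by (simp add: algebra_simps)
    moreover have "(1 - exp (- t)) * (\<Sum>v\<in>?B. ?x v) \<ge> (t * (1 - t)) * (?n * (y * ?z))"
    proof (rule mult_mono)
      show "?n * (y * ?z) \<le> (\<Sum>v\<in>?B. ?x v)" using x_ge by (intro sum_bounded_below) auto
    qed (use t2 t in \<open>auto simp: y_def\<close>)
    moreover have "(\<Sum>v\<in>?B. ?R (vabs v)) \<le> ?n * ?R u" using R_le by (intro sum_bounded_above) auto
    hence "t * (\<Sum>v\<in>?B. ?R (vabs v)) \<le> t * (?n * ?R u)" using t by (intro mult_left_mono) auto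
    ultimately have "(t * (1 - t)) * (?n * (y * ?z)) - t * (t * ?n) \<le> t * (?n * ?R u)" by linarith
    hence "(t * ?n) * ((1 - t) * (y * ?z) - t) \<le> (t * ?n) * ?R u" by (simp add: algebra_simps)
    thus ?thesis by (rule mult_left_le_imp_le) (use t n in simp)
  qed
  show "?R (u + e) \<le> (1 + t) * y + t"
  proof -
    have "?n * ?R (u + e) \<le> (\<Sum>v\<in>?B. ?R (vabs v))" using R_ge by (intro sum_bounded_below) auto
    hence "t * (?n * ?R (u + e)) \<le> t * (\<Sum>v\<in>?B. ?R (vabs v))" using t by (intro mult_left_mono) auto
    moreover have "(exp t - 1) * (\<Sum>v\<in>?B. ?x v) \<le> (t * (1 + t)) * (?n * y)"
    proof (rule mult_mono)
      show "(\<Sum>v\<in>?B. ?x v) \<le> ?n * y" using x_le by (intro sum_bounded_above) auto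
    qed (use t2 t in \<open>auto simp: y_def intro!: sum_nonneg\<close>)
    ultimately have "t * (?n * ?R (u + e)) \<le> (t * (1 + t)) * (?n * y) + t * (t * ?n)" using key[of t] by linarith
    hence "(t * ?n) * ?R (u + e) \<le> (t * ?n) * ((1 + t) * y + t)" by (simp add: algebra_simps)
    thus ?thesis by (rule mult_left_le_imp_le) (use t n in simp)
  qed
qed

text \<open>Boxes of side \<open>L \<approx> s / \<beta>\<close> with small \<open>s\<close> are used. The lower bound of \<open>count_ratio_box_bounds\<close> is immediate. The upper bound concerns
  \<open>u + e\<close>; applied to \<open>N + e\<close> it bounds \<open>zono_count (N - u) / zono_count (N + e)\<close>, and the lower bound for the shift \<open>e\<close>
  replaces the denominator by \<open>zono_count N\<close>. The statement is uniform in \<open>N\<close> near the diagonal, because the tail estimate applies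
  it repeatedly along the line in the direction of \<open>|v\<^sub>0|\<close>.\<close>

lemma count_ratio_asymptotic:
  fixes \<eta> C :: real
  assumes \<eta>: "\<eta> > 0" and C: "C \<ge> 0" and d: "CARD('d::{finite,linorder}) \<ge> 2"
  defines "\<beta> \<equiv> tilt CARD('d)"
  shows "\<exists>\<epsilon>>0. \<epsilon> < 1 \<and> (\<forall>\<^sub>F n in sequentially. \<forall>N u :: int ^ 'd::{finite,linorder}.
     (\<forall>i. \<bar>real_of_int (N $ i) - real n\<bar> \<le> \<epsilon> * real n) \<longrightarrow> (\<forall>i. 0 \<le> u $ i \<and> \<beta> n * real_of_int (u $ i) \<le> C) \<longrightarrow>
       \<bar>zono_count (N - u) / zono_count N - exp (- weight (\<lambda>_. \<beta> n) u)\<bar> \<le> \<eta>)"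
proof -
  let ?d = "CARD('d)"
  \<comment> \<open>The final errors are \<open>3 * t\<close> below and \<open>18 * t\<close> above.\<close>
  define t where "t = min (1/6) (\<eta> / 18)"
  have t: "0 < t" "t \<le> 1/6" "18 * t \<le> \<eta>" using \<eta> by (auto simp: t_def)
  define s where "s = t / (4 * real ?d)"
  have s: "s > 0" "4 * real ?d * s = t" using t d by (auto simp: s_def)
  define C' where "C' = C / s + 1"
  have C': "C' \<ge> 1" using C s by (simp add: C'_def)
  \<comment> \<open>With this \<open>\<delta>\<close> the cost of conditioning is at most \<open>t\<^sup>2\<close> times the number of primitive vectors in a box of side \<open>s / \<beta>\<close>.\<close>
  define \<delta> where "\<delta> = t\<^sup>2 * (s ^ ?d / 8)"
  have \<delta>: "\<delta> > 0" using t s by (simp add: \<delta>_def)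
  obtain \<epsilon> where \<epsilon>: "\<epsilon> > 0" "\<epsilon> < 1" and defect: "\<forall>\<^sub>F n in sequentially. \<forall>N :: (int, 'd) vec.
     (\<forall>i. \<bar>real_of_int (N $ i) - real n\<bar> \<le> \<epsilon> * real n) \<longrightarrow>
       weight (\<lambda>_. \<beta> n) N + log_gf (\<lambda>_ :: 'd. \<beta> n) - ln (zono_count N) \<le> \<delta> / \<beta> n ^ ?d"
    using log_count_lower_bound[OF \<delta> d] unfolding \<beta>_def by blast
  have \<beta>0: "\<beta> \<longlonglongrightarrow> 0" unfolding \<beta>_def by (rule tilt_tendsto_0[OF d])
  have small: "\<forall>\<^sub>F n in sequentially. \<beta> n < x" if "x > 0" for x
    using order_tendstoD(2)[OF \<beta>0 that] .
  have "\<forall>\<^sub>F n in sequentially. \<beta> n ^ ?d < kappa ?d * (\<epsilon> / 2) / (2 * s)"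
  proof (rule order_tendstoD)
    show "(\<lambda>n. \<beta> n ^ ?d) \<longlonglongrightarrow> 0 ^ ?d" by (intro tendsto_power \<beta>0)
    show "0 ^ ?d < kappa ?d * (\<epsilon> / 2) / (2 * s)" 
    proof -
      have "(0::real) ^ ?d = 0" using d by simp
      thus ?thesis using \<epsilon> s(1) kappa_pos[OF d] by (simp only:) simp
    qed
  qed
  moreover have "\<forall>\<^sub>F n in sequentially. \<beta> n < s / (4096 * (C' + 1))"
    using s C' by (intro small divide_pos_pos) auto
  ultimately have "\<forall>\<^sub>F n in sequentially. \<forall>N u :: (int, 'd) vec.
     (\<forall>i. \<bar>real_of_int (N $ i) - real n\<bar> \<le> \<epsilon> / 2 * real n) \<longrightarrow> (\<forall>i. 0 \<le> u $ i \<and> \<beta> n * real_of_int (u $ i) \<le> C) \<longrightarrow>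
       \<bar>zono_count (N - u) / zono_count N - exp (- weight (\<lambda>_. \<beta> n) u)\<bar> \<le> \<eta>"
    using eventually_gt_at_top[of 0] defect small[OF s(1)]
  proof eventually_elim
    case (elim n)
    define b where "b = \<beta> n"
    have b: "b > 0" "b ^ (?d + 1) * real n = kappa ?d"
      using tilt_pos[OF d elim(3)] tilt_power[OF d elim(3)] by (simp_all add: b_def \<beta>_def)
    define L where "L = nat \<lceil>s / b\<rceil>"
    have L: "s / b \<le> real L" "real L \<le> s / b + 1"
      using b s by (simp_all add: L_def)
    have bL: "s \<le> b * real L" "b * real L \<le> 2 * s"
    proof -
      show "s \<le> b * real L" using L b by (simp add: field_simps)
      have "b * real L \<le> b * (s / b + 1)" using L b by (intro mult_left_mono) auto
      also have "\<dots> = s + b" using b by (simp add: field_simps)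
      finally show "b * real L \<le> 2 * s" using elim(5) by (simp add: b_def)
    qed
    have L_big: "real L \<ge> 4096 * (C' + 1)"
    proof -
      have "b * (4096 * (C' + 1)) \<le> s" using elim(2) C' by (simp add: b_def field_simps)
      hence "b * (4096 * (C' + 1)) \<le> b * real L" using bL by linarith
      thus ?thesis using b by simp
    qed
    have L_small: "real L \<le> \<epsilon> / 2 * real n"
    proof -
      have "b ^ ?d * (2 * s) \<le> kappa ?d * (\<epsilon> / 2)" using elim(1) s by (simp add: b_def field_simps)
      also have "\<dots> = b ^ ?d * (b * real n * (\<epsilon> / 2))" using b(2) by (simp add: mult_ac)
      finally have "2 * s \<le> b * real n * (\<epsilon> / 2)" using b by simp
      hence "b * real L \<le> b * (\<epsilon> / 2 * real n)" using bL by (simp add: mult_ac)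
      thus ?thesis using b by simp
    qed
    define K where "K = real L ^ ?d / 8"
    have K: "K > 0" using L_big C' by (simp add: K_def)
    have \<delta>K: "\<delta> / b ^ ?d \<le> t\<^sup>2 * K"
    proof -
      have "s ^ ?d / b ^ ?d \<le> real L ^ ?d"
        unfolding power_divide[symmetric] using L s b by (intro power_mono) auto
      from mult_left_mono[OF this, of "t\<^sup>2 / 8"] show ?thesis by (simp add: \<delta>_def K_def)
    qed
    define e where "e = ((\<chi> i. int L) :: (int, 'd) vec)"
    let ?z = "exp (- b * real (?d * L))"
    have z: "?z \<ge> 1 - t" "?z \<le> 1"
    proof -
      have "b * real (?d * L) = real ?d * (b * real L)" by simp
      also have "\<dots> \<le> real ?d * (2 * s)" using bL by (intro mult_left_mono) auto
      also have "\<dots> \<le> t" using s t by simp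
      finally show "?z \<ge> 1 - t" using exp_ge_add_one_self[of "- b * real (?d * L)"] by simp
      show "?z \<le> 1" using b by simp
    qed
    have lower: "zono_count (N - u) / zono_count N \<ge> (1 - t) * (exp (- weight (\<lambda>_. b) u) * ?z) - t"
      and upper: "zono_count (N - (u + e)) / zono_count N \<le> (1 + t) * exp (- weight (\<lambda>_. b) u) + t"
      if N: "\<And>i. \<bar>real_of_int (N $ i) - real n\<bar> \<le> \<epsilon> * real n"
        and u: "\<And>i. u $ i \<ge> 0" "\<And>i. real_of_int (u $ i) \<le> C' * real L" for N u :: "(int, 'd) vec"
    proof -
      have "N $ i \<ge> 0" for i
      proof -
        have "real n - real_of_int (N $ i) \<le> \<epsilon> * real n" using N[of i] by linarith
        also have "\<dots> \<le> 1 * real n" using \<epsilon> by (intro mult_right_mono) auto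
        finally show ?thesis by simp
      qed
      hence N1: "zono_count N > 0" using zono_count_ge_1[of N] by force
      have "weight (\<lambda>_. b) N + log_gf (\<lambda>_ :: 'd. b) - ln (zono_count N) \<le> \<delta> / b ^ ?d"
        using elim(4) N unfolding b_def by blast
      also note \<delta>K
      finally have df: "weight (\<lambda>_. b) N + log_gf (\<lambda>_ :: 'd. b) - ln (zono_count N) \<le> t\<^sup>2 * K" .
      have cd: "real (card (primitive_box u L)) \<ge> K"
        unfolding K_def using C' by (intro card_primitive_box_ge[OF d _ L_big u]) auto
      have "t \<le> 1" using t by simp
      from count_ratio_box_bounds[OF d b(1) t(1) this N1 zono_count_nonneg cd K df u(1), folded e_def]
      show "zono_count (N - u) / zono_count N \<ge> (1 - t) * (exp (- weight (\<lambda>_. b) u) * ?z) - t"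
        and "zono_count (N - (u + e)) / zono_count N \<le> (1 + t) * exp (- weight (\<lambda>_. b) u) + t"
        by auto
    qed
    show ?case unfolding b_def[symmetric]
    proof (intro allI impI)
      fix N u :: "(int, 'd) vec"
      assume N: "\<forall>i. \<bar>real_of_int (N $ i) - real n\<bar> \<le> \<epsilon> / 2 * real n" and u: "\<forall>i. 0 \<le> u $ i \<and> b * real_of_int (u $ i) \<le> C"
      define y where "y = exp (- weight (\<lambda>_. b) u)"
      have y: "0 \<le> y" "y \<le> 1" using weight_nonneg[of "\<lambda>_. b" u] b by (auto simp: y_def)
      have u': "real_of_int (u $ i) \<le> C' * real L" for i
      proof -
        have "b * real_of_int (u $ i) \<le> C / s * s" using u s by simp
        also have "\<dots> \<le> C / s * (b * real L)" using bL C s by (intro mult_left_mono) auto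
        finally have "b * real_of_int (u $ i) \<le> b * (C / s * real L)" by (simp add: mult_ac)
        hence "real_of_int (u $ i) \<le> C / s * real L" using b(1) by (rule mult_left_le_imp_le)
        also have "\<dots> \<le> C' * real L" unfolding C'_def by (intro mult_right_mono) auto
        finally show ?thesis .
      qed
      have hN: "\<epsilon> / 2 * real n \<le> \<epsilon> * real n" using \<epsilon> by simp
      have N1: "\<bar>real_of_int (N $ i) - real n\<bar> \<le> \<epsilon> * real n" for i using N hN by (meson order.trans)
      have N2: "\<bar>real_of_int ((N + e) $ i) - real n\<bar> \<le> \<epsilon> * real n" for i
        using N[rule_format, of i] L_small abs_triangle_ineq[of "real_of_int (N $ i) - real n" "real L"]
        by (simp add: e_def algebra_simps)
      have low: "zono_count (N - u) / zono_count N \<ge> y - 3 * t"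
      proof -
        have "y - 3 * t \<le> (1 - t) * (y * (1 - t)) - t"
        proof -
          have "(1 - t) * (y * (1 - t)) = y - 2 * (t * y) + t\<^sup>2 * y" by (simp add: algebra_simps power2_eq_square)
          moreover have "t * y \<le> t" using y t by (simp add: mult_left_le)
          moreover have "t\<^sup>2 * y \<ge> 0" using y by simp
          ultimately show ?thesis by linarith
        qed
        also have "\<dots> \<le> (1 - t) * (y * ?z) - t" using z y t by (intro diff_right_mono mult_left_mono) auto
        also have "\<dots> \<le> zono_count (N - u) / zono_count N"
          unfolding y_def by (rule lower[OF N1]) (use u u' in auto)
        finally show ?thesis .
      qed
      have up: "zono_count (N - u) / zono_count N \<le> y + 18 * t"
      proof -
        have e1: "real_of_int (e $ i) \<le> C' * real L" "e $ i \<ge> 0" for i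
          using C' mult_right_mono[of 1 C' "real L"] by (simp_all add: e_def)
        have we: "weight (\<lambda>_. b) e = b * real (?d * L)" by (simp add: weight_const e_def)
        have "1 - 4 * t \<le> (1 - t) * ((1 - t) * (1 - t)) - t"
          using t by (simp add: algebra_simps power2_eq_square)
        also have "\<dots> \<le> (1 - t) * (?z * ?z) - t" using z t by (intro diff_right_mono mult_left_mono mult_mono) auto
        also have "\<dots> \<le> zono_count (N + e - e) / zono_count (N + e)"
          using lower[OF N2 e1(2,1)] unfolding we by simp
        finally have A: "zono_count N / zono_count (N + e) \<ge> 1 - 4 * t" by simp
        have B: "zono_count (N - u) / zono_count (N + e) \<le> (1 + t) * y + t"
          using upper[of "N + e" u, OF N2 _ u'] u unfolding y_def by (simp add: algebra_simps)
        have pos: "zono_count (N + e) > 0" "zono_count N > 0"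
        proof -
          show a: "zono_count N > 0"
            using A t zono_count_nonneg[of N] by (cases "zono_count N = 0") auto
          show "zono_count (N + e) > 0"
            using A t zono_count_nonneg[of "N + e"] by (cases "zono_count (N + e) = 0") auto
        qed
        have "zono_count (N - u) \<le> ((1 + t) * y + t) * zono_count (N + e)"
          using B pos by (simp add: field_simps)
        also have "\<dots> \<le> ((1 + t) * y + t) * (zono_count N / (1 - 4 * t))"
          using A pos t y by (intro mult_left_mono) (auto simp: field_simps)
        finally have "zono_count (N - u) / zono_count N \<le> ((1 + t) * y + t) / (1 - 4 * t)"
          using pos t by (simp add: field_simps)
        also have "\<dots> \<le> y + 18 * t"
        proof -
          have "(1 + t) * y + t \<le> (y + 18 * t) * (1 - 4 * t)"
          proof -
            have "5 * (t * y) \<le> 5 * t" using y t by (simp add: mult_left_le)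
            moreover have "72 * (t * t) \<le> 12 * t" using t mult_right_mono[of t "1/6" t] by simp
            ultimately show ?thesis by (simp add: algebra_simps)
          qed
          thus ?thesis using t by (simp add: divide_le_eq)
        qed
        finally show ?thesis .
      qed
      show "\<bar>zono_count (N - u) / zono_count N - exp (- weight (\<lambda>_. b) u)\<bar> \<le> \<eta>"
        using low up t unfolding y_def[symmetric] by (simp add: abs_le_iff)
    qed
  qed
  thus ?thesis using \<epsilon> by (intro exI[of _ "\<epsilon> / 2"]) auto
qed

section \<open>The number of copies of one generator\<close>

lemma weight_const_multiple:
  "weight (\<lambda>_ :: 'd::finite. b) (int k *s vabs v) = b * l1_norm v * real k"
  by (simp add: weight_const l1_norm_def abs_mult sum_distrib_left sum_distrib_right mult_ac)

lemma abs_le_l1_norm: "\<bar>real_of_int (v $ i)\<bar> \<le> l1_norm v"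
  unfolding l1_norm_def by (rule member_le_sum) auto

lemma l1_norm_ge_1:
  assumes "v \<in> primitive_vectors" shows "l1_norm v \<ge> 1"
proof -
  from assms obtain i where "v $ i > 0" by (auto simp: primitive_vectors_def)
  thus ?thesis using abs_le_l1_norm[of v i] by linarith
qed

definition cube_side :: "nat \<Rightarrow> int ^ 'd" where
  "cube_side n = (\<chi> i. int n)"

text \<open>The probability that \<open>v\<close> occurs at least \<open>k\<close> times.\<close>

definition survival :: "int ^ 'd::{finite,linorder} \<Rightarrow> nat \<Rightarrow> nat \<Rightarrow> real" where
  "survival v n k = zono_count (cube_side n - int k *s vabs v) /
    zono_count (cube_side n :: int ^ 'd::{finite,linorder})"

lemma zono_count_cube_pos: "zono_count (cube_side n :: int ^ 'd::{finite,linorder}) > 0"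
proof -
  have "zono_count (cube_side n :: (int, 'd) vec) \<ge> 1" by (rule zono_count_ge_1) (simp add: cube_side_def)
  thus ?thesis by linarith
qed

lemma survival_nonneg: "survival v n k \<ge> 0"
  by (simp add: survival_def zono_count_nonneg)

lemma survival_antimono: "k \<le> l \<Longrightarrow> survival v n l \<le> survival v n k"
  unfolding survival_def
  by (intro divide_right_mono zono_count_mono zono_count_nonneg) (auto intro!: mult_right_mono)

lemma survival_eq_0:
  assumes "v \<in> primitive_vectors" "k > n" shows "survival v n k = 0"
proof -
  from assms obtain i where i: "v $ i > 0" by (auto simp: primitive_vectors_def)
  have "int n < int k * 1" using assms by simp
  also have "\<dots> \<le> int k * \<bar>v $ i\<bar>" using i by (intro mult_left_mono) auto
  finally have "zono_count (cube_side n - int k *s vabs v) = 0"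
    by (intro zono_count_eq_0[of _ i]) (simp add: cube_side_def)
  thus ?thesis by (simp add: survival_def)
qed

lemma survival_limit:
  fixes v :: "int ^ 'd::{finite,linorder}"
  assumes d: "CARD('d) \<ge> 2" and \<eta>: "\<eta> > 0"
  defines "b \<equiv> \<lambda>n. tilt CARD('d) n * l1_norm v"
  shows "\<forall>\<^sub>F n in sequentially. \<forall>k. b n * real k \<le> C \<longrightarrow> \<bar>survival v n k - exp (- b n * real k)\<bar> \<le> \<eta>"
proof -
  obtain \<epsilon> where \<epsilon>: "\<epsilon> > 0" and key: "\<forall>\<^sub>F n in sequentially. \<forall>N u :: (int, 'd) vec.
     (\<forall>i. \<bar>real_of_int (N $ i) - real n\<bar> \<le> \<epsilon> * real n) \<longrightarrow> (\<forall>i. 0 \<le> u $ i \<and> tilt CARD('d) n * real_of_int (u $ i) \<le> max C 0) \<longrightarrow>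
       \<bar>zono_count (N - u) / zono_count N - exp (- weight (\<lambda>_. tilt CARD('d) n) u)\<bar> \<le> \<eta>"
    using count_ratio_asymptotic[OF \<eta> _ d, of "max C 0"] by auto
  from key eventually_gt_at_top[of 0] show ?thesis
  proof eventually_elim
    case (elim n)
    show ?case
    proof (intro allI impI)
      fix k assume k: "b n * real k \<le> C"
      have "tilt CARD('d) n * real_of_int ((int k *s vabs v) $ i) \<le> max C 0" for i
      proof -
        have "tilt CARD('d) n * real_of_int ((int k *s vabs v) $ i) = tilt CARD('d) n * real k * \<bar>real_of_int (v $ i)\<bar>" by simp
        also have "\<dots> \<le> tilt CARD('d) n * real k * l1_norm v"
          using tilt_pos[OF d elim(2)] by (intro mult_left_mono abs_le_l1_norm) auto
        also have "\<dots> \<le> C" using k by (simp add: b_def mult_ac)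
        finally show ?thesis by simp
      qed
      moreover have "\<bar>real_of_int ((cube_side n :: (int, 'd) vec) $ i) - real n\<bar> \<le> \<epsilon> * real n" for i
        using \<epsilon> by (simp add: cube_side_def)
      ultimately have "\<bar>survival v n k - exp (- weight (\<lambda>_. tilt CARD('d) n) (int k *s vabs v))\<bar> \<le> \<eta>"
        unfolding survival_def using elim(1) by simp
      thus "\<bar>survival v n k - exp (- b n * real k)\<bar> \<le> \<eta>"
        by (simp add: weight_const_multiple b_def)
    qed
  qed
qed

text \<open>Let \<open>K \<approx> 1 / b n\<close>. Removing \<open>K\<close> copies of \<open>v\<close> at least halves the count while the total stays within \<open>\<epsilon> * n\<close> of the diagonal, which
  gives exponential decay for \<open>k\<close> up to a fixed fraction of \<open>n\<close>. At most \<open>n\<close> copies can occur, so monotonicity in \<open>k\<close> extends the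
  decay to all \<open>k\<close> with a smaller rate.\<close>

lemma survival_exp_decay:
  fixes v :: "int ^ 'd::{finite,linorder}"
  assumes d: "CARD('d) \<ge> 2" and v: "v \<in> primitive_vectors"
  defines "b \<equiv> \<lambda>n. tilt CARD('d) n * l1_norm v"
  shows "\<exists>c>0. \<forall>\<^sub>F n in sequentially. \<forall>k. \<bar>survival v n k\<bar> \<le> 4 * exp (- c * b n * real k)"
proof -
  define l where "l = l1_norm v"
  have l: "l \<ge> 1" unfolding l_def by (rule l1_norm_ge_1[OF v])
  obtain \<epsilon> where \<epsilon>: "\<epsilon> > 0" "\<epsilon> < 1" and key: "\<forall>\<^sub>F n in sequentially. \<forall>N u :: (int, 'd) vec.
     (\<forall>i. \<bar>real_of_int (N $ i) - real n\<bar> \<le> \<epsilon> * real n) \<longrightarrow> (\<forall>i. 0 \<le> u $ i \<and> tilt CARD('d) n * real_of_int (u $ i) \<le> 2) \<longrightarrow>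
       \<bar>zono_count (N - u) / zono_count N - exp (- weight (\<lambda>_. tilt CARD('d) n) u)\<bar> \<le> 1/10"
    using count_ratio_asymptotic[of "1/10" 2, OF _ _ d] by auto
  define c where "c = ln 2 / 2 * (\<epsilon> / l)"
  have c: "c > 0" using \<epsilon> l by (simp add: c_def)
  have "b \<longlonglongrightarrow> 0" unfolding b_def using tendsto_mult_left_zero[OF tilt_tendsto_0[OF d]] .
  hence b1: "\<forall>\<^sub>F n in sequentially. b n < 1" by (rule order_tendstoD) simp
  from key b1 eventually_gt_at_top[of 0]
  have "\<forall>\<^sub>F n in sequentially. \<forall>k. \<bar>survival v n k\<bar> \<le> 4 * exp (- c * b n * real k)"
  proof eventually_elim
    case (elim n)
    define \<beta> where "\<beta> = tilt CARD('d) n"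
    have \<beta>: "\<beta> > 0" unfolding \<beta>_def by (rule tilt_pos[OF d elim(3)])
    have b: "0 < b n" "b n < 1" "b n = \<beta> * l" using \<beta> l elim(2) by (auto simp: b_def \<beta>_def l_def)
    define K where "K = nat \<lceil>1 / b n\<rceil>"
    have K: "1 / b n \<le> real K" "real K \<le> 1 / b n + 1" using b by (simp_all add: K_def)
    have bK: "b n * real K \<ge> 1" using K b by (simp add: field_simps)
    have K2: "b n * real K \<le> 2"
    proof -
      have "b n * real K \<le> b n * (1 / b n + 1)" using K b by (intro mult_left_mono) auto
      also have "\<dots> \<le> 2" using b by (simp add: field_simps)
      finally show ?thesis .
    qed
    have K0: "K > 0" using bK by (cases K) auto
    have step: "zono_count (N - int K *s vabs v) / zono_count N \<le> 1/2"
      if N: "\<And>i. \<bar>real_of_int (N $ i) - real n\<bar> \<le> \<epsilon> * real n" for N :: "(int, 'd) vec"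
    proof -
      have "\<beta> * real_of_int ((int K *s vabs v) $ i) \<le> 2" for i
      proof -
        have "\<beta> * real_of_int ((int K *s vabs v) $ i) = \<beta> * real K * \<bar>real_of_int (v $ i)\<bar>" by simp
        also have "\<dots> \<le> \<beta> * real K * l"
          using \<beta> unfolding l_def by (intro mult_left_mono abs_le_l1_norm) auto
        also have "\<dots> \<le> 2" using K2 b by (simp add: mult_ac)
        finally show ?thesis .
      qed
      hence "\<bar>zono_count (N - int K *s vabs v) / zono_count N - exp (- weight (\<lambda>_. \<beta>) (int K *s vabs v))\<bar> \<le> 1/10"
        using elim(1) N unfolding \<beta>_def by simp
      moreover have "exp (- weight (\<lambda>_. \<beta>) (int K *s vabs v)) \<le> 2/5"
      proof -
        have "exp (- weight (\<lambda>_. \<beta>) (int K *s vabs v)) \<le> exp (- 1)"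
          using bK b by (simp add: weight_const_multiple l_def)
        also have "\<dots> \<le> 2/5"
          using exp_lower_Taylor_quadratic[of 1] by (simp add: exp_minus field_simps)
        finally show ?thesis .
      qed
      ultimately show ?thesis by linarith
    qed
    have pow: "survival v n (j * K) \<le> (1/2) ^ j" if "real (j * K) * l \<le> \<epsilon> * real n" for j
      using that
    proof (induction j)
      case 0
      show ?case using zono_count_cube_pos[of n, where 'd='d] by (simp add: survival_def)
    next
      case (Suc j)
      define N where "N = cube_side n - int (j * K) *s vabs v"
      have jK: "real (j * K) * l \<le> \<epsilon> * real n"
      proof -
        have "real (j * K) * l \<le> real (Suc j * K) * l" using l by (intro mult_right_mono) auto
        with Suc.prems show ?thesis by linarith
      qed
      have N: "\<bar>real_of_int (N $ i) - real n\<bar> \<le> \<epsilon> * real n" for i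
      proof -
        have "\<bar>real_of_int (N $ i) - real n\<bar> = real (j * K) * \<bar>real_of_int (v $ i)\<bar>"
          by (simp add: N_def cube_side_def abs_mult)
        also have "\<dots> \<le> real (j * K) * l" unfolding l_def by (intro mult_left_mono abs_le_l1_norm) auto
        finally show ?thesis using jK by linarith
      qed
      have "N $ i \<ge> 0" for i
      proof -
        have "real n - real_of_int (N $ i) \<le> \<epsilon> * real n" using N[of i] by linarith
        also have "\<dots> \<le> 1 * real n" using \<epsilon> by (intro mult_right_mono) auto
        finally show ?thesis by simp
      qed
      hence N1: "zono_count N > 0" using zono_count_ge_1[of N] by force
      have eq: "cube_side n - int (Suc j * K) *s vabs v = N - int K *s vabs v"
        by (simp add: N_def vec_eq_iff algebra_simps)
      have "survival v n (Suc j * K) = (zono_count (N - int K *s vabs v) / zono_count N) * survival v n (j * K)"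
        unfolding survival_def eq N_def[symmetric] using N1 by simp
      also have "\<dots> \<le> 1/2 * (1/2) ^ j"
        using step[OF N] Suc.IH[OF jK] by (intro mult_mono survival_nonneg) auto
      finally show ?case by simp
    qed
    have mid: "survival v n k \<le> 2 * exp (- (ln 2 / 2 * b n * real k))" if k: "real k * l \<le> \<epsilon> * real n" for k
    proof -
      define j where "j = k div K"
      have jk: "j * K \<le> k" by (simp add: j_def)
      have "real (j * K) * l \<le> real k * l" using l jk by (intro mult_right_mono of_nat_mono) auto
      hence "survival v n (j * K) \<le> (1/2) ^ j" using k by (intro pow) linarith
      hence "survival v n k \<le> (1/2) ^ j" using survival_antimono[OF jk, of v n] by linarith
      also have "(1/2 :: real) ^ j = exp (- (ln 2 * real j))"
        by (simp add: exp_minus power_divide field_simps exp_of_nat_mult)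
      also have "\<dots> \<le> exp (ln 2 - ln 2 / 2 * b n * real k)"
      proof -
        have "k < (j + 1) * K" using K0 unfolding j_def by (metis add.commute dividend_less_times_div mult.commute plus_1_eq_Suc mult_Suc_right)
        hence "real k \<le> real ((j + 1) * K)" by (intro of_nat_mono less_imp_le)
        hence "b n * real k \<le> b n * real ((j + 1) * K)" using b by (intro mult_left_mono) auto
        also have "\<dots> = (b n * real K) * (real j + 1)" by (simp add: algebra_simps)
        also have "\<dots> \<le> 2 * (real j + 1)" using K2 by (intro mult_right_mono) auto
        finally have "ln 2 / 2 * (b n * real k) \<le> ln 2 / 2 * (2 * (real j + 1))" by (intro mult_left_mono) auto
        thus ?thesis by (simp add: algebra_simps)
      qed
      also have "\<dots> = 2 * exp (- (ln 2 / 2 * b n * real k))" unfolding diff_conv_add_uminus exp_add by simp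
      finally show ?thesis .
    qed
    show ?case
    proof
      fix k
      show "\<bar>survival v n k\<bar> \<le> 4 * exp (- c * b n * real k)"
      proof (cases "k > n")
        case True
        thus ?thesis using survival_eq_0[OF v] by simp
      next
        case False
        \<comment> \<open>A proportional index in the range where the halving argument applies.\<close>
        define k' where "k' = nat \<lfloor>\<epsilon> / l * real k\<rfloor>"
        have el: "\<epsilon> / l \<ge> 0" "\<epsilon> / l \<le> 1" using \<epsilon> l by auto
        have k': "real k' \<le> \<epsilon> / l * real k" "\<epsilon> / l * real k - 1 \<le> real k'"
          using mult_nonneg_nonneg[OF el(1), of "real k"] unfolding k'_def
          by (simp_all only: of_nat_nat zero_le_floor) linarith+
        have "\<epsilon> / l * real k \<le> 1 * real k" using el by (intro mult_right_mono) auto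
        hence "k' \<le> k" using k'(1) by simp
        have "real k' * l \<le> \<epsilon> / l * real k * l" using k' l by (intro mult_right_mono) auto
        also have "\<dots> \<le> \<epsilon> * real n" using l \<epsilon> False by simp
        finally have "survival v n k' \<le> 2 * exp (- (ln 2 / 2 * b n * real k'))" by (rule mid)
        hence "survival v n k \<le> 2 * exp (- (ln 2 / 2 * b n * real k'))"
          using survival_antimono[OF \<open>k' \<le> k\<close>, of v n] by linarith
        also have "\<dots> \<le> 2 * exp (ln 2 - c * b n * real k)"
        proof -
          have "ln 2 / 2 * b n * (\<epsilon> / l * real k - 1) \<le> ln 2 / 2 * b n * real k'"
            using k' b by (intro mult_left_mono) auto
          moreover have "ln 2 / 2 * b n * (\<epsilon> / l * real k - 1) = c * b n * real k - ln 2 / 2 * b n"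
            unfolding c_def right_diff_distrib by (simp add: mult_ac)
          moreover have "ln 2 / 2 * b n \<le> ln 2 * 1" using b by (intro mult_mono) auto
          ultimately have "- (ln 2 / 2 * b n * real k') \<le> ln 2 - c * b n * real k" by linarith
          hence "exp (- (ln 2 / 2 * b n * real k')) \<le> exp (ln 2 - c * b n * real k)"
            by (simp only: exp_le_cancel_iff)
          thus ?thesis by simp
        qed
        also have "\<dots> = 4 * exp (- c * b n * real k)" unfolding diff_conv_add_uminus exp_add by simp
        finally show ?thesis using survival_nonneg[of v n k] by simp
      qed
    qed
  qed
  with c show ?thesis by blast
qed

lemma survival_moments:
  fixes v :: "int ^ 'd::{finite,linorder}"
  assumes d: "CARD('d) \<ge> 2" and v: "v \<in> primitive_vectors"
  defines "b \<equiv> \<lambda>n. tilt CARD('d) n * l1_norm v"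
  shows "(\<lambda>n. b n * (\<Sum>k. survival v n (Suc k))) \<longlonglongrightarrow> 1"
    and "(\<lambda>n. b n ^ 2 * (\<Sum>k. (2 * real k + 1) * survival v n (Suc k))) \<longlonglongrightarrow> 2"
proof -
  obtain c where c: "c > 0" "\<forall>\<^sub>F n in sequentially. \<forall>k. \<bar>survival v n k\<bar> \<le> 4 * exp (- c * b n * real k)"
    using survival_exp_decay[OF d v] unfolding b_def by blast
  have b: "b n > 0" if "n > 0" for n
    using tilt_pos[OF d that] l1_norm_ge_1[OF v] by (simp add: b_def)
  have b0: "b \<longlonglongrightarrow> 0" unfolding b_def using tendsto_mult_left_zero[OF tilt_tendsto_0[OF d]] .
  have lim: "\<forall>\<^sub>F n in sequentially. \<forall>k. b n * real k \<le> C \<longrightarrow> \<bar>survival v n k - exp (- b n * real k)\<bar> \<le> \<eta>"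
    if "\<eta> > 0" for C \<eta> unfolding b_def by (rule survival_limit[OF d that])
  show "(\<lambda>n. b n * (\<Sum>k. survival v n (Suc k))) \<longlonglongrightarrow> 1"
    and "(\<lambda>n. b n ^ 2 * (\<Sum>k. (2 * real k + 1) * survival v n (Suc k))) \<longlonglongrightarrow> 2"
    using scaled_sums_of_near_geometric[OF b b0 lim c(2,1)] by simp_all
qed

section \<open>Translation classes and multiplicity functions\<close>

lemma zonotope_mono_neutral:
  assumes "finite V" "I \<subseteq> V" "\<And>i. i \<in> V - I \<Longrightarrow> g i = 0"
  shows "zonotope V g = zonotope I g"
proof -
  have rv0: "real_vec 0 = (0 :: real ^ 'b)" by (simp add: real_vec_def vec_eq_iff)
  have eq: "(\<Sum>i\<in>V. \<alpha> i *\<^sub>R real_vec (g i)) = (\<Sum>i\<in>I. \<alpha> i *\<^sub>R real_vec (g i))" for \<alpha>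
    using assms by (intro sum.mono_neutral_right) (auto simp: rv0)
  show ?thesis
  proof (intro equalityI subsetI)
    fix x assume "x \<in> zonotope V g"
    thus "x \<in> zonotope I g" using assms(2) by (auto simp: zonotope_def eq)
  next
    fix x assume "x \<in> zonotope I g"
    then obtain \<alpha> where a: "\<forall>i\<in>I. \<alpha> i \<in> {0..1}" "x = (\<Sum>i\<in>I. \<alpha> i *\<^sub>R real_vec (g i))"
      by (auto simp: zonotope_def)
    define \<alpha>' where "\<alpha>' = (\<lambda>i. if i \<in> I then \<alpha> i else 0)"
    have "x = (\<Sum>i\<in>V. \<alpha>' i *\<^sub>R real_vec (g i))" unfolding eq a(2) by (intro sum.cong) (auto simp: \<alpha>'_def)
    moreover have "\<forall>i\<in>V. \<alpha>' i \<in> {0..1}" using a(1) by (auto simp: \<alpha>'_def)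
    ultimately show "x \<in> zonotope V g" unfolding zonotope_def by blast
  qed
qed

lemma zonotope_insert:
  assumes "finite I" "i \<notin> I"
  shows "zonotope (insert i I) g = {x + a *\<^sub>R real_vec (g i) | x a. x \<in> zonotope I g \<and> a \<in> {0..1}}"
proof (intro equalityI subsetI)
  fix x assume "x \<in> zonotope (insert i I) g"
  then obtain \<alpha> where a: "\<forall>j\<in>insert i I. \<alpha> j \<in> {0..1}" "x = (\<Sum>j\<in>insert i I. \<alpha> j *\<^sub>R real_vec (g j))"
    by (auto simp: zonotope_def)
  have "x = (\<Sum>j\<in>I. \<alpha> j *\<^sub>R real_vec (g j)) + \<alpha> i *\<^sub>R real_vec (g i)"
    using assms by (simp add: a(2) add.commute)
  moreover have "(\<Sum>j\<in>I. \<alpha> j *\<^sub>R real_vec (g j)) \<in> zonotope I g" using a(1) by (auto simp: zonotope_def)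
  ultimately show "x \<in> {x + a *\<^sub>R real_vec (g i) | x a. x \<in> zonotope I g \<and> a \<in> {0..1}}"
    using a(1) by blast
next
  fix x assume "x \<in> {x + a *\<^sub>R real_vec (g i) | x a. x \<in> zonotope I g \<and> a \<in> {0..1}}"
  then obtain \<alpha> a where a: "\<forall>j\<in>I. \<alpha> j \<in> {0..1}" "a \<in> {0..1}"
      "x = (\<Sum>j\<in>I. \<alpha> j *\<^sub>R real_vec (g j)) + a *\<^sub>R real_vec (g i)"
    by (auto simp: zonotope_def)
  have "(\<Sum>j\<in>insert i I. (\<alpha>(i := a)) j *\<^sub>R real_vec (g j)) = a *\<^sub>R real_vec (g i) + (\<Sum>j\<in>I. (\<alpha>(i := a)) j *\<^sub>R real_vec (g j))"
    using assms by simp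
  also have "(\<Sum>j\<in>I. (\<alpha>(i := a)) j *\<^sub>R real_vec (g j)) = (\<Sum>j\<in>I. \<alpha> j *\<^sub>R real_vec (g j))"
    using assms by (intro sum.cong) auto
  finally have "x = (\<Sum>j\<in>insert i I. (\<alpha>(i := a)) j *\<^sub>R real_vec (g j))" using a(3) by simp
  moreover have "\<forall>j\<in>insert i I. (\<alpha>(i := a)) j \<in> {0..1}" using a by auto
  ultimately show "x \<in> zonotope (insert i I) g" unfolding zonotope_def by blast
qed

lemma zonotope_reindex:
  assumes "bij_betw h J I"
  shows "zonotope J (\<lambda>j. g (h j)) = zonotope I g"
proof (intro equalityI subsetI)
  fix x assume "x \<in> zonotope J (\<lambda>j. g (h j))"
  then obtain \<alpha> where a: "\<forall>j\<in>J. \<alpha> j \<in> {0..1}" "x = (\<Sum>j\<in>J. \<alpha> j *\<^sub>R real_vec (g (h j)))"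
    by (auto simp: zonotope_def)
  have "x = (\<Sum>i\<in>I. \<alpha> (the_inv_into J h i) *\<^sub>R real_vec (g i))"
    unfolding a(2) by (subst sum.reindex_bij_betw[OF assms, symmetric])
      (use assms in \<open>auto intro!: sum.cong simp: bij_betw_def the_inv_into_f_f\<close>)
  moreover have "\<forall>i\<in>I. \<alpha> (the_inv_into J h i) \<in> {0..1}"
    using a(1) bij_betw_the_inv_into[OF assms] by (auto simp: bij_betw_def)
  ultimately show "x \<in> zonotope I g"
    unfolding zonotope_def mem_Collect_eq by (intro exI[of _ "\<lambda>i. \<alpha> (the_inv_into J h i)"]) auto
next
  fix x assume "x \<in> zonotope I g"
  then obtain \<alpha> where a: "\<forall>i\<in>I. \<alpha> i \<in> {0..1}" "x = (\<Sum>i\<in>I. \<alpha> i *\<^sub>R real_vec (g i))"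
    by (auto simp: zonotope_def)
  have "x = (\<Sum>j\<in>J. \<alpha> (h j) *\<^sub>R real_vec (g (h j)))"
    unfolding a(2) by (rule sum.reindex_bij_betw[OF assms, symmetric])
  moreover have "\<forall>j\<in>J. \<alpha> (h j) \<in> {0..1}" using a(1) assms by (auto simp: bij_betw_def)
  ultimately show "x \<in> zonotope J (\<lambda>j. g (h j))"
    unfolding zonotope_def mem_Collect_eq by (intro exI[of _ "\<lambda>j. \<alpha> (h j)"]) auto
qed

text \<open>The lower end takes only the generators with negative scalar product; taking a fraction \<open>s\<close> of the others and \<open>1 - s\<close> of these sweeps out
  the interval.\<close>

lemma inner_image_zonotope:
  assumes "finite I"
  shows "(\<lambda>x. x \<bullet> u) ` zonotope I g =
    {(\<Sum>i\<in>I. min 0 (real_vec (g i) \<bullet> u)) .. (\<Sum>i\<in>I. min 0 (real_vec (g i) \<bullet> u)) + (\<Sum>i\<in>I. \<bar>real_vec (g i) \<bullet> u\<bar>)}"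
    (is "_ = {?A..?A + ?W}")
proof (intro equalityI subsetI)
  let ?c = "\<lambda>i. real_vec (g i) \<bullet> u"
  fix y assume "y \<in> (\<lambda>x. x \<bullet> u) ` zonotope I g"
  then obtain \<alpha> where a: "\<forall>i\<in>I. \<alpha> i \<in> {0..1}" "y = (\<Sum>i\<in>I. \<alpha> i * ?c i)"
    by (auto simp: zonotope_def inner_sum_left)
  have "?A \<le> y" unfolding a(2)
  proof (intro sum_mono)
    fix i assume "i \<in> I"
    thus "min 0 (?c i) \<le> \<alpha> i * ?c i" using a(1) mult_right_le_one_le[of "- ?c i" "\<alpha> i"]
      by (cases "?c i \<ge> 0") (auto simp: min_def mult.commute)
  qed
  moreover have "y \<le> ?A + ?W" unfolding a(2) sum.distrib[symmetric]
  proof (intro sum_mono)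
    fix i assume i: "i \<in> I"
    show "\<alpha> i * ?c i \<le> min 0 (?c i) + \<bar>?c i\<bar>"
    proof (cases "?c i \<ge> 0")
      case True
      thus ?thesis using a(1) i mult_left_le_one_le[of "?c i" "\<alpha> i"] by (auto simp: min_def)
    next
      case False
      thus ?thesis using a(1) i by (auto simp: min_def mult_nonneg_nonpos)
    qed
  qed
  ultimately show "y \<in> {?A..?A + ?W}" by simp
next
  let ?c = "\<lambda>i. real_vec (g i) \<bullet> u"
  fix y assume y: "y \<in> {?A..?A + ?W}"
  have W0: "?W \<ge> 0" by (intro sum_nonneg) auto
  define s where "s = (y - ?A) / ?W"
  have s: "0 \<le> s" "s \<le> 1" "y = ?A + s * ?W"
    using y W0 by (auto simp: s_def divide_le_eq)
  define \<alpha> where "\<alpha> = (\<lambda>i. if ?c i \<ge> 0 then s else 1 - s)"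
  have "(\<Sum>i\<in>I. \<alpha> i *\<^sub>R real_vec (g i)) \<bullet> u = (\<Sum>i\<in>I. \<alpha> i * ?c i)" by (simp add: inner_sum_left)
  also have "\<dots> = (\<Sum>i\<in>I. min 0 (?c i) + s * \<bar>?c i\<bar>)"
    by (intro sum.cong) (auto simp: \<alpha>_def min_def algebra_simps)
  also have "\<dots> = y" using s(3) by (simp add: sum.distrib sum_distrib_left)
  finally have "y = (\<Sum>i\<in>I. \<alpha> i *\<^sub>R real_vec (g i)) \<bullet> u" by simp
  moreover have "(\<Sum>i\<in>I. \<alpha> i *\<^sub>R real_vec (g i)) \<in> zonotope I g"
    using s by (auto simp: zonotope_def \<alpha>_def)
  ultimately show "y \<in> (\<lambda>x. x \<bullet> u) ` zonotope I g" by blast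
qed

lemma real_vec_smult: "real_vec (int k *s v) = real k *\<^sub>R real_vec v"
  by (simp add: real_vec_def vec_eq_iff)

text \<open>The length of the projection of the zonotope of \<open>\<omega>\<close> to the line in direction \<open>u\<close>.\<close>

definition width :: "(int ^ 'd::{finite,linorder} \<Rightarrow> nat) \<Rightarrow> real ^ 'd::{finite,linorder} \<Rightarrow> real" where
  "width \<omega> u = (\<Sum>v | \<omega> v \<noteq> 0. real (\<omega> v) * \<bar>real_vec v \<bullet> u\<bar>)"

lemma inner_image_translate_zonotope_of:
  assumes "multiplicity_function \<omega>"
  shows "\<exists>a. (\<lambda>x. x \<bullet> u) ` ((\<lambda>x. t + x) ` zonotope_of \<omega>) = {a..a + width \<omega> u}"
proof -
  obtain a where a: "(\<lambda>x. x \<bullet> u) ` zonotope_of \<omega> = {a..a + width \<omega> u}"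
    using inner_image_zonotope[OF multiplicity_functionD(1)[OF assms], of u "\<lambda>v. int (\<omega> v) *s v"]
    unfolding zonotope_of_def real_vec_smult by (auto simp: width_def abs_mult)
  have "(\<lambda>x. x \<bullet> u) ` ((\<lambda>x. t + x) ` zonotope_of \<omega>) = (\<lambda>y. t \<bullet> u + y) ` ((\<lambda>x. x \<bullet> u) ` zonotope_of \<omega>)"
    by (simp add: image_image inner_add_left)
  also have "\<dots> = {(t \<bullet> u + a)..(t \<bullet> u + a) + width \<omega> u}" unfolding a by (simp add: add.assoc)
  finally show ?thesis by blast
qed

lemma width_nonneg: "width \<omega> u \<ge> 0"
  by (auto simp: width_def intro!: sum_nonneg)

lemma interval_length_unique:
  "{a..a + w} = {a'..a' + w'} \<Longrightarrow> w \<ge> 0 \<Longrightarrow> w' \<ge> 0 \<Longrightarrow> w = (w' :: real)"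
  by (auto simp: Icc_eq_Icc)

text \<open>The projections to the axes are the widths in the directions of the axis vectors.\<close>

lemma inscribed_iff:
  assumes "multiplicity_function \<omega>"
  shows "inscribed n ((\<lambda>x. t + x) ` zonotope_of \<omega>) \<longleftrightarrow> coord_sum \<omega> = cube_side n"
proof -
  have proj: "(\<lambda>x. x $ i) ` S = (\<lambda>x. x \<bullet> axis i 1) ` S" for i and S :: "(real, 'a) vec set"
    by (simp add: inner_axis)
  have w: "width \<omega> (axis i 1) = real_of_int (coord_sum \<omega> $ i)" for i
    by (simp add: width_def inner_axis real_vec_def coord_sum_nth[OF multiplicity_functionD(1)[OF assms] order.refl])
  have "(\<exists>a. (\<lambda>x. x $ i) ` ((\<lambda>x. t + x) ` zonotope_of \<omega>) = {a..a + real n}) \<longleftrightarrow> coord_sum \<omega> $ i = int n" for i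
  proof -
    obtain a where a: "(\<lambda>x. x $ i) ` ((\<lambda>x. t + x) ` zonotope_of \<omega>) = {a..a + real_of_int (coord_sum \<omega> $ i)}"
      using inner_image_translate_zonotope_of[OF assms, where t = t and u = "axis i 1"] unfolding proj w by blast
    have nn: "real_of_int (coord_sum \<omega> $ i) \<ge> 0"
      using coord_sum_nonneg[OF multiplicity_functionD(1)[OF assms]] by simp
    show ?thesis unfolding a using interval_length_unique[OF _ nn, of a _ "real n"] by force
  qed
  thus ?thesis unfolding inscribed_def by (simp add: vec_eq_iff cube_side_def)
qed

text \<open>Finitely many hyperplanes form a null set.\<close>

lemma exists_generic_vector:
  fixes W :: "(real ^ 'n::finite) set"
  assumes "finite W" "0 \<notin> W"
  obtains u where "\<And>w. w \<in> W \<Longrightarrow> w \<bullet> u \<noteq> 0"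
proof -
  have "negligible (\<Union>w\<in>W. {u. w \<bullet> u = 0})"
    using assms by (intro negligible_Union) (auto intro!: negligible_hyperplane)
  hence "(\<Union>w\<in>W. {u. w \<bullet> u = 0}) \<noteq> UNIV" using non_negligible_UNIV by metis
  thus ?thesis using that by blast
qed

text \<open>Choose \<open>x\<close> orthogonal to \<open>v\<close> but to no other element of \<open>V\<close>. In the symmetric second difference at \<open>x\<close> with a small step along \<open>v\<close>, all terms
  cancel except the one of \<open>v\<close>, whose absolute value has a kink at \<open>x\<close>.\<close>

lemma sum_abs_inner_eq_0_imp:
  fixes V :: "(real ^ 'n::finite) set"
  assumes V: "finite V" "v \<in> V" "v \<noteq> 0" and indep: "\<And>w c. w \<in> V \<Longrightarrow> w \<noteq> v \<Longrightarrow> w \<noteq> c *\<^sub>R v"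
    and f: "\<And>u. (\<Sum>w\<in>V. f w * \<bar>w \<bullet> u\<bar>) = (0::real)"
  shows "f v = 0"
proof -
  \<comment> \<open>The orthogonal projection along \<open>v\<close>; projecting a generic vector gives the point \<open>x\<close>.\<close>
  define p where "p = (\<lambda>w. w - ((w \<bullet> v) / (v \<bullet> v)) *\<^sub>R v)"
  have vv: "v \<bullet> v > 0" using V by simp
  have p0: "p w \<noteq> 0" if "w \<in> V - {v}" for w
  proof
    assume "p w = 0"
    hence "w = ((w \<bullet> v) / (v \<bullet> v)) *\<^sub>R v" unfolding p_def by (rule eq_iff_diff_eq_0[THEN iffD2])
    moreover have "w \<noteq> ((w \<bullet> v) / (v \<bullet> v)) *\<^sub>R v" using that by (intro indep) simp_all
    ultimately show False by (rule notE[rotated])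
  qed
  have "0 \<notin> p ` (V - {v})"
  proof
    assume "0 \<in> p ` (V - {v})"
    then obtain w where "w \<in> V - {v}" "0 = p w" by (rule imageE)
    with p0[of w] show False by metis
  qed
  then obtain u where u': "\<And>y. y \<in> p ` (V - {v}) \<Longrightarrow> y \<bullet> u \<noteq> 0"
    using exists_generic_vector[OF finite_imageI[OF finite_Diff[OF V(1)]]] by metis
  have u: "p w \<bullet> u \<noteq> 0" if "w \<in> V - {v}" for w using u'[OF imageI[OF that]] .
  define x where "x = p u"
  have vx: "v \<bullet> x = 0" using vv by (simp add: x_def p_def inner_diff_right inner_commute[of u v])
  have wx: "w \<bullet> x \<noteq> 0" if "w \<in> V - {v}" for w
  proof -
    have "w \<bullet> x = p w \<bullet> u" by (simp add: x_def p_def inner_diff_right inner_diff_left inner_commute[of u v])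
    thus ?thesis using u[OF that] by simp
  qed
  have "\<exists>s>0. \<forall>w\<in>V - {v}. s * \<bar>w \<bullet> v\<bar> \<le> \<bar>w \<bullet> x\<bar>"
  proof -
    define S where "S = insert 1 ((\<lambda>w. \<bar>w \<bullet> x\<bar> / (\<bar>w \<bullet> v\<bar> + 1)) ` (V - {v}))"
    have S: "finite S" "S \<noteq> {}" using V by (auto simp: S_def)
    have "\<forall>y\<in>S. y > 0" using wx by (auto simp: S_def intro!: divide_pos_pos)
    hence m: "Min S > 0" using S by (simp add: Min_gr_iff)
    have "Min S * \<bar>w \<bullet> v\<bar> \<le> \<bar>w \<bullet> x\<bar>" if "w \<in> V - {v}" for w
    proof -
      have "Min S \<le> \<bar>w \<bullet> x\<bar> / (\<bar>w \<bullet> v\<bar> + 1)" using S that by (intro Min_le) (auto simp: S_def)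
      hence "Min S * (\<bar>w \<bullet> v\<bar> + 1) \<le> \<bar>w \<bullet> x\<bar>" by (simp add: le_divide_eq add_nonneg_pos)
      thus ?thesis using m by (simp add: algebra_simps)
    qed
    with m show ?thesis by blast
  qed
  then obtain s where s: "s > 0" "\<And>w. w \<in> V - {v} \<Longrightarrow> s * \<bar>w \<bullet> v\<bar> \<le> \<bar>w \<bullet> x\<bar>" by blast
  define D where "D = (\<lambda>w. \<bar>w \<bullet> (x + s *\<^sub>R v)\<bar> + \<bar>w \<bullet> (x - s *\<^sub>R v)\<bar> - 2 * \<bar>w \<bullet> x\<bar>)"
  have D0: "D w = 0" if "w \<in> V - {v}" for w
  proof -
    have "\<bar>s * (w \<bullet> v)\<bar> \<le> \<bar>w \<bullet> x\<bar>" using s(2)[OF that] s(1) by (simp add: abs_mult)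
    thus ?thesis by (simp add: D_def inner_add_right inner_diff_right)
  qed
  have "(\<Sum>w\<in>V. f w * D w) = 0"
  proof -
    have split: "(\<Sum>w\<in>V. f w * (a w + b w - 2 * c w)) = (\<Sum>w\<in>V. f w * a w) + (\<Sum>w\<in>V. f w * b w) - 2 * (\<Sum>w\<in>V. f w * c w)"
      for a b c :: "real ^ 'n \<Rightarrow> real"
      by (simp add: algebra_simps sum.distrib sum_subtractf sum_distrib_left)
    show ?thesis unfolding D_def split f by simp
  qed
  also have "(\<Sum>w\<in>V. f w * D w) = (\<Sum>w\<in>{v}. f w * D w)"
    using V D0 by (intro sum.mono_neutral_right) auto
  also have "\<dots> = f v * (2 * s * (v \<bullet> v))"
    using s(1) vv vx by (simp add: D_def inner_add_right inner_diff_right)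
  finally show ?thesis using s(1) vv by simp
qed

text \<open>The greatest common divisors of the proportional products \<open>w i * v j = v i * w j\<close> give \<open>\<bar>w i\<bar> = \<bar>v i\<bar>\<close>; the sign convention does the rest.\<close>

lemma primitive_not_parallel:
  fixes v w :: "int ^ 'd::{finite,linorder}"
  assumes "v \<in> primitive_vectors" "w \<in> primitive_vectors" "real_vec w = c *\<^sub>R real_vec v"
  shows "w = v"
proof -
  have wv: "real_of_int (w $ i) = c * real_of_int (v $ i)" for i
    using assms(3) by (simp add: real_vec_def vec_eq_iff)
  have cross: "w $ i * v $ j = v $ i * w $ j" for i j
  proof -
    have "real_of_int (w $ i * v $ j) = real_of_int (v $ i * w $ j)" by (simp add: wv)
    thus ?thesis by (simp only: of_int_eq_iff)
  qed
  have abs: "\<bar>w $ i\<bar> = \<bar>v $ i\<bar>" for i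
  proof -
    have "\<bar>w $ i\<bar> * Gcd (range (\<lambda>j. v $ j)) = Gcd (range (\<lambda>j. w $ i * v $ j))"
      using Gcd_range_smult[of "w $ i" v] by simp
    also have "\<dots> = Gcd (range (\<lambda>j. v $ i * w $ j))" by (simp only: cross)
    also have "\<dots> = \<bar>v $ i\<bar> * Gcd (range (\<lambda>j. w $ j))" using Gcd_range_smult[of "v $ i" w] by simp
    finally show ?thesis using assms by (simp add: primitive_vectors_def)
  qed
  obtain i where i: "v $ i > 0" "\<forall>j<i. v $ j = 0" using assms(1) by (auto simp: primitive_vectors_def)
  obtain k where k: "w $ k > 0" "\<forall>j<k. w $ j = 0" using assms(2) by (auto simp: primitive_vectors_def)
  have "i = k"
  proof (rule linorder_cases[of i k])
    assume "i < k" thus ?thesis using i k abs[of i] by auto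
  next
    assume "k < i" thus ?thesis using i k abs[of k] by auto
  qed
  hence "w $ i = v $ i" using i k abs[of i] by auto
  hence "c = 1" using wv[of i] i by auto
  thus ?thesis using wv by (simp add: vec_eq_iff)
qed

lemma inj_real_vec: "inj (real_vec :: int ^ 'd \<Rightarrow> real ^ 'd)"
  by (auto simp: inj_def real_vec_def vec_eq_iff)

lemma width_determines:
  assumes "multiplicity_function \<omega>" "multiplicity_function \<omega>'" and eq: "\<And>u. width \<omega> u = width \<omega>' u"
  shows "\<omega> = \<omega>'"
proof
  fix v
  define V where "V = {v. \<omega> v \<noteq> 0} \<union> {v. \<omega>' v \<noteq> 0}"
  have V: "finite V" "V \<subseteq> primitive_vectors"
    using assms(1,2) by (auto simp: V_def multiplicity_function_def)
  have w: "width \<omega> u = (\<Sum>v\<in>V. real (\<omega> v) * \<bar>real_vec v \<bullet> u\<bar>)" "width \<omega>' u = (\<Sum>v\<in>V. real (\<omega>' v) * \<bar>real_vec v \<bullet> u\<bar>)" for u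
    unfolding width_def using V(1) by (intro sum.mono_neutral_left; auto simp: V_def)+
  have inv: "inv real_vec (real_vec w) = w" for w :: "(int, 'a) vec" by (rule inv_f_f[OF inj_real_vec])
  show "\<omega> v = \<omega>' v"
  proof (cases "v \<in> V")
    case True
    define f where "f = (\<lambda>x. real (\<omega> (inv real_vec x)) - real (\<omega>' (inv real_vec x)))"
    have "f (real_vec v) = 0"
    proof (rule sum_abs_inner_eq_0_imp[of "real_vec ` V"])
      show "real_vec v \<noteq> 0" using V True by (force simp: real_vec_def vec_eq_iff primitive_vectors_def)
      fix u
      have "(\<Sum>x\<in>real_vec ` V. f x * \<bar>x \<bullet> u\<bar>) = (\<Sum>v\<in>V. f (real_vec v) * \<bar>real_vec v \<bullet> u\<bar>)"
        by (subst sum.reindex) (auto intro: inj_on_subset[OF inj_real_vec])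
      also have "\<dots> = width \<omega> u - width \<omega>' u"
        unfolding w f_def inv left_diff_distrib by (rule sum_subtractf)
      finally show "(\<Sum>x\<in>real_vec ` V. f x * \<bar>x \<bullet> u\<bar>) = 0" using eq by simp
    next
      fix w c assume "w \<in> real_vec ` V" "w \<noteq> real_vec v"
      then obtain w' where w': "w = real_vec w'" "w' \<in> V" "w' \<noteq> v" by blast
      show "w \<noteq> c *\<^sub>R real_vec v"
      proof
        assume "w = c *\<^sub>R real_vec v"
        hence "w' = v" unfolding w'(1) using primitive_not_parallel w'(2) V(2) True by (metis subsetD)
        with w'(3) show False by simp
      qed
    qed (use V True in auto)
    thus ?thesis by (simp add: f_def inv)
  qed (auto simp: V_def)
qed

lemma translates_determine_multiplicity:
  assumes "multiplicity_function \<omega>" "multiplicity_function \<omega>'"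
    and "(\<lambda>x. t + x) ` zonotope_of \<omega> = (\<lambda>x. t' + x) ` zonotope_of \<omega>'"
  shows "\<omega> = \<omega>'"
proof (rule width_determines[OF assms(1,2)])
  fix u
  obtain a where a: "(\<lambda>x. x \<bullet> u) ` ((\<lambda>x. t + x) ` zonotope_of \<omega>) = {a..a + width \<omega> u}"
    using inner_image_translate_zonotope_of[OF assms(1)] by blast
  obtain a' where a': "(\<lambda>x. x \<bullet> u) ` ((\<lambda>x. t' + x) ` zonotope_of \<omega>') = {a'..a' + width \<omega>' u}"
    using inner_image_translate_zonotope_of[OF assms(2)] by blast
  have "{a..a + width \<omega> u} = {a'..a' + width \<omega>' u}" unfolding a[symmetric] a'[symmetric] assms(3) ..
  thus "width \<omega> u = width \<omega>' u" by (rule interval_length_unique) (rule width_nonneg)+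
qed

lemma zonotope_of_split:
  assumes "multiplicity_function \<omega>"
  shows "zonotope_of \<omega> = {x + a *\<^sub>R real (\<omega> p) *\<^sub>R real_vec p | x a.
     x \<in> zonotope ({v. \<omega> v \<noteq> 0} - {p}) (\<lambda>v. int (\<omega> v) *s v) \<and> a \<in> {0..1}}"
proof -
  let ?S = "{v. \<omega> v \<noteq> 0}" and ?g = "\<lambda>v. int (\<omega> v) *s v"
  have fin: "finite ?S" by (rule multiplicity_functionD(1)[OF assms])
  have "zonotope_of \<omega> = zonotope (insert p (?S - {p})) ?g"
    unfolding zonotope_of_def using fin
    by (intro zonotope_mono_neutral[symmetric]) (auto simp: vec_eq_iff)
  also have "\<dots> = {x + a *\<^sub>R real_vec (?g p) | x a. x \<in> zonotope (?S - {p}) ?g \<and> a \<in> {0..1}}"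
    using fin by (intro zonotope_insert) auto
  finally show ?thesis by (simp add: real_vec_smult)
qed

text \<open>Parallel segments add up to a segment of the total length.\<close>

lemma zonotope_of_add_generator:
  assumes w: "multiplicity_function \<omega>" and p: "p \<in> primitive_vectors"
  shows "multiplicity_function (fun_upd \<omega> p (\<omega> p + g))"
    and "zonotope_of (fun_upd \<omega> p (\<omega> p + g)) = {x + a *\<^sub>R real g *\<^sub>R real_vec p | x a. x \<in> zonotope_of \<omega> \<and> a \<in> {0..1}}"
proof -
  let ?w = "fun_upd \<omega> p (\<omega> p + g)"
  have "{v. ?w v \<noteq> 0} \<subseteq> insert p {v. \<omega> v \<noteq> 0}" by auto
  thus w': "multiplicity_function ?w" using w p
    by (auto simp: multiplicity_function_def intro: finite_subset split: if_splits)
  have S: "{v. ?w v \<noteq> 0} - {p} = {v. \<omega> v \<noteq> 0} - {p}" by auto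
  define Z where "Z = zonotope ({v. \<omega> v \<noteq> 0} - {p}) (\<lambda>v. int (\<omega> v) *s v)"
  have Z: "zonotope ({v. ?w v \<noteq> 0} - {p}) (\<lambda>v. int (?w v) *s v) = Z"
  proof -
    have "(\<Sum>v\<in>{v. \<omega> v \<noteq> 0} - {p}. \<alpha> v *\<^sub>R real_vec (int (?w v) *s v)) =
       (\<Sum>v\<in>{v. \<omega> v \<noteq> 0} - {p}. \<alpha> v *\<^sub>R real_vec (int (\<omega> v) *s v))" for \<alpha>
      by (intro sum.cong) auto
    thus ?thesis unfolding Z_def S zonotope_def by simp
  qed
  have 1: "zonotope_of ?w = {x + a *\<^sub>R (real (\<omega> p) + real g) *\<^sub>R real_vec p | x a. x \<in> Z \<and> a \<in> {0..1}}"
    using zonotope_of_split[OF w', of p] unfolding Z by simp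
  have 2: "zonotope_of \<omega> = {x + a *\<^sub>R real (\<omega> p) *\<^sub>R real_vec p | x a. x \<in> Z \<and> a \<in> {0..1}}"
    using zonotope_of_split[OF w, of p] unfolding Z_def .
  show "zonotope_of ?w = {x + a *\<^sub>R real g *\<^sub>R real_vec p | x a. x \<in> zonotope_of \<omega> \<and> a \<in> {0..1}}"
  proof (intro equalityI subsetI)
    fix y assume "y \<in> zonotope_of ?w"
    then obtain x a where y: "y = x + a *\<^sub>R (real (\<omega> p) + real g) *\<^sub>R real_vec p" "x \<in> Z" "a \<in> {0..1}"
      unfolding 1 by blast
    have "y = (x + a *\<^sub>R real (\<omega> p) *\<^sub>R real_vec p) + a *\<^sub>R real g *\<^sub>R real_vec p"
      unfolding y(1) by (simp add: algebra_simps)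
    moreover have "x + a *\<^sub>R real (\<omega> p) *\<^sub>R real_vec p \<in> zonotope_of \<omega>" unfolding 2 using y by blast
    ultimately show "y \<in> {x + a *\<^sub>R real g *\<^sub>R real_vec p | x a. x \<in> zonotope_of \<omega> \<and> a \<in> {0..1}}"
      using y(3) by blast
  next
    fix y assume "y \<in> {x + a *\<^sub>R real g *\<^sub>R real_vec p | x a. x \<in> zonotope_of \<omega> \<and> a \<in> {0..1}}"
    then obtain x a b where y: "y = (x + a *\<^sub>R real (\<omega> p) *\<^sub>R real_vec p) + b *\<^sub>R real g *\<^sub>R real_vec p"
        "x \<in> Z" "a \<in> {0..1}" "b \<in> {0..1}" unfolding 2 by blast
    define c where "c = (a * real (\<omega> p) + b * real g) / (real (\<omega> p) + real g)"
    have n: "a * real (\<omega> p) \<ge> 0" "a * real (\<omega> p) \<le> real (\<omega> p)" "b * real g \<ge> 0" "b * real g \<le> real g"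
      using y(3,4) by (auto simp: mult_left_le_one_le)
    have c: "c \<in> {0..1}" using n by (auto simp: c_def divide_le_eq)
    have "c * (real (\<omega> p) + real g) = a * real (\<omega> p) + b * real g"
    proof (cases "real (\<omega> p) + real g = 0")
      case True thus ?thesis using n by simp
    next
      case False thus ?thesis by (simp add: c_def)
    qed
    hence "y = x + c *\<^sub>R (real (\<omega> p) + real g) *\<^sub>R real_vec p"
      unfolding y(1) by (simp add: scaleR_add_left[symmetric])
    thus "y \<in> zonotope_of ?w" unfolding 1 using y(2) c by blast
  qed
qed

lemma nonzero_vector_cases:
  fixes v :: "int ^ 'd::{finite,linorder}"
  assumes "v \<noteq> 0"
  obtains g p where "p \<in> primitive_vectors" "v = int g *s p" | g p where "p \<in> primitive_vectors" "v = - (int g *s p)"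
proof -
  have hs: "\<exists>g p. p \<in> primitive_vectors \<and> m = int g *s p" if "m \<in> half_space" for m :: "(int, 'd) vec"
  proof -
    have "m \<in> (\<lambda>(k, v). int (Suc k) *s v) ` (UNIV \<times> primitive_vectors)"
      unfolding bij_betw_imp_surj_on[OF bij_betw_half_space] by (rule that)
    then obtain k p where "p \<in> primitive_vectors" "m = int (Suc k) *s p" by auto
    thus ?thesis by blast
  qed
  have "v \<in> half_space \<or> v \<in> uminus ` half_space" using half_space_cases assms by blast
  thus ?thesis
  proof
    assume "v \<in> half_space" thus ?thesis using hs that(1) by blast
  next
    assume "v \<in> uminus ` half_space"
    then obtain m where "v = - m" "m \<in> half_space" by blast
    thus ?thesis using hs that(2) by blast
  qed
qed

text \<open>Each generator is a multiple of a primitive vector up to sign, and reversing a generator translates the zonotope.\<close>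

lemma lattice_zonotope_translate_of_multiplicity:
  fixes v :: "nat \<Rightarrow> int ^ 'd::{finite,linorder}"
  shows "\<exists>\<omega> t. multiplicity_function \<omega> \<and> zonotope {..<k} v = (\<lambda>x. t + x) ` zonotope_of \<omega>"
proof (induction k)
  case 0
  show ?case by (intro exI[of _ "\<lambda>_. 0"] exI[of _ 0]) (auto simp: multiplicity_function_def zonotope_of_def zonotope_def)
next
  case (Suc k)
  then obtain \<omega> t where w: "multiplicity_function \<omega>" and Zk: "zonotope {..<k} v = (\<lambda>x. t + x) ` zonotope_of \<omega>"
    by blast
  have "zonotope {..<Suc k} v = {x + a *\<^sub>R real_vec (v k) | x a. x \<in> zonotope {..<k} v \<and> a \<in> {0..1}}"
    unfolding lessThan_Suc by (rule zonotope_insert) auto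
  hence Z: "zonotope {..<Suc k} v = {(t + x) + a *\<^sub>R real_vec (v k) | x a. x \<in> zonotope_of \<omega> \<and> a \<in> {0..1}}"
    unfolding Zk by blast
  show ?case
  proof (cases "v k = 0")
    case True
    hence "real_vec (v k) = 0" by (simp add: real_vec_def vec_eq_iff)
    hence "zonotope {..<Suc k} v = (\<lambda>x. t + x) ` zonotope_of \<omega>"
      unfolding Z by (auto intro!: exI[of _ "0::real"])
    thus ?thesis using w by blast
  next
    case False
    thus ?thesis
    proof (cases rule: nonzero_vector_cases)
      case (1 g p)
      have rv: "real_vec (v k) = real g *\<^sub>R real_vec p" by (simp add: 1 real_vec_smult)
      have "zonotope {..<Suc k} v = (\<lambda>x. t + x) ` zonotope_of (fun_upd \<omega> p (\<omega> p + g))"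
        unfolding Z rv zonotope_of_add_generator(2)[OF w 1(1)] by (auto simp: image_iff add.assoc)
      thus ?thesis using zonotope_of_add_generator(1)[OF w 1(1)] by blast
    next
      case (2 g p)
      let ?s = "real g *\<^sub>R real_vec p"
      have rv: "real_vec (v k) = - ?s"
        by (simp add: 2 real_vec_smult[symmetric]) (simp add: real_vec_def vec_eq_iff)
      have "zonotope {..<Suc k} v = (\<lambda>x. (t - ?s) + x) ` zonotope_of (fun_upd \<omega> p (\<omega> p + g))"
      proof (intro equalityI subsetI)
        fix y assume "y \<in> zonotope {..<Suc k} v"
        then obtain x a where y: "y = (t + x) + a *\<^sub>R (- ?s)" "x \<in> zonotope_of \<omega>" "a \<in> {0..1}"
          unfolding Z rv by blast
        have "y = (t - ?s) + (x + (1 - a) *\<^sub>R ?s)" unfolding y(1) by (simp add: algebra_simps)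
        moreover have "x + (1 - a) *\<^sub>R ?s \<in> zonotope_of (fun_upd \<omega> p (\<omega> p + g))"
          unfolding zonotope_of_add_generator(2)[OF w 2(1)] mem_Collect_eq
          using y by (intro exI[of _ x] exI[of _ "1 - a"]) auto
        ultimately show "y \<in> (\<lambda>x. (t - ?s) + x) ` zonotope_of (fun_upd \<omega> p (\<omega> p + g))" by blast
      next
        fix y assume "y \<in> (\<lambda>x. (t - ?s) + x) ` zonotope_of (fun_upd \<omega> p (\<omega> p + g))"
        then obtain x a where y: "y = (t - ?s) + (x + a *\<^sub>R ?s)" "x \<in> zonotope_of \<omega>" "a \<in> {0..1}"
          unfolding zonotope_of_add_generator(2)[OF w 2(1)] by blast
        have "y = (t + x) + (1 - a) *\<^sub>R (- ?s)" unfolding y(1) by (simp add: algebra_simps)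
        thus "y \<in> zonotope {..<Suc k} v" unfolding Z rv mem_Collect_eq
          using y by (intro exI[of _ x] exI[of _ "1 - a"]) auto
      qed
      thus ?thesis using zonotope_of_add_generator(1)[OF w 2(1)] by blast
    qed
  qed
qed

definition translation_class :: "(int ^ 'd::{finite,linorder} \<Rightarrow> nat) \<Rightarrow> (real ^ 'd::{finite,linorder}) set set" where
  "translation_class \<omega> = {Q. translate_of (zonotope_of \<omega>) Q}"

lemma translation_class_eq: "translation_class \<omega> = range (\<lambda>t. (\<lambda>x. t + x) ` zonotope_of \<omega>)"
  by (auto simp: translation_class_def translate_of_def)

lemma zonotope_of_mem_translation_class: "zonotope_of \<omega> \<in> translation_class \<omega>"
  unfolding translation_class_eq by (rule image_eqI[of _ _ 0]) auto

lemma mem_translation_class_unique: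
  assumes "multiplicity_function \<omega>" "multiplicity_function \<omega>'" "zonotope_of \<omega>' \<in> translation_class \<omega>"
  shows "\<omega>' = \<omega>"
proof -
  obtain t where "zonotope_of \<omega>' = (\<lambda>x. t + x) ` zonotope_of \<omega>"
    using assms(3) by (auto simp: translation_class_eq)
  hence "(\<lambda>x. 0 + x) ` zonotope_of \<omega>' = (\<lambda>x. t + x) ` zonotope_of \<omega>" by simp
  thus ?thesis by (rule translates_determine_multiplicity[OF assms(2,1)])
qed

lemma occurrences_translation_class:
  assumes "multiplicity_function \<omega>"
  shows "occurrences v (translation_class \<omega>) = \<omega> v"
proof -
  have "(THE \<omega>'. multiplicity_function \<omega>' \<and> zonotope_of \<omega>' \<in> translation_class \<omega>) = \<omega>"
    using assms zonotope_of_mem_translation_class mem_translation_class_unique[OF assms]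
    by (intro the_equality) auto
  thus ?thesis by (simp add: occurrences_def)
qed

lemma lattice_zonotope_zonotope_of:
  assumes "multiplicity_function \<omega>"
  shows "lattice_zonotope (zonotope_of \<omega>)"
proof -
  let ?S = "{v. \<omega> v \<noteq> 0}"
  obtain h where h: "bij_betw h {0..<card ?S} ?S"
    using ex_bij_betw_nat_finite[OF multiplicity_functionD(1)[OF assms]] by blast
  have "zonotope {..<card ?S} (\<lambda>j. int (\<omega> (h j)) *s h j) = zonotope_of \<omega>"
    unfolding zonotope_of_def using zonotope_reindex[OF h, of "\<lambda>v. int (\<omega> v) *s v"]
    by (simp add: atLeast0LessThan)
  moreover have "translate_of (zonotope_of \<omega>) (zonotope_of \<omega>)"
    unfolding translate_of_def by (rule exI[of _ 0]) simp
  ultimately show ?thesis unfolding lattice_zonotope_def by metis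
qed

lemma inscribed_zonotopes_eq:
  "inscribed_zonotopes n = translation_class ` with_total (cube_side n :: int ^ 'd::{finite,linorder})"
proof (intro equalityI subsetI)
  fix C assume "C \<in> (inscribed_zonotopes n :: (real, 'd) vec set set set)"
  then obtain P where P: "lattice_zonotope P" "inscribed n P" "C = {Q. translate_of P Q}"
    by (auto simp: inscribed_zonotopes_def elim!: quotientE)
  from P(1) obtain k v t where "P = (\<lambda>x. t + x) ` zonotope {..<k::nat} (v :: nat \<Rightarrow> (int, 'd) vec)"
    by (auto simp: lattice_zonotope_def translate_of_def)
  moreover obtain \<omega> t' where w: "multiplicity_function \<omega>" "zonotope {..<k} v = (\<lambda>x. t' + x) ` zonotope_of \<omega>"
    using lattice_zonotope_translate_of_multiplicity by blast
  ultimately have Pw: "P = (\<lambda>x. (t + t') + x) ` zonotope_of \<omega>"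
    by (simp add: image_image add.assoc)
  have "\<omega> \<in> with_total (cube_side n)"
    using P(2) w(1) inscribed_iff[OF w(1)] unfolding Pw with_total_def by blast
  moreover have "C = translation_class \<omega>"
  proof (intro equalityI subsetI)
    fix Q assume "Q \<in> C"
    then obtain s where "Q = (\<lambda>x. s + x) ` P" by (auto simp: P(3) translate_of_def)
    hence "Q = (\<lambda>x. (s + (t + t')) + x) ` zonotope_of \<omega>" unfolding Pw by (simp add: image_image add.assoc)
    thus "Q \<in> translation_class \<omega>" unfolding translation_class_eq by (rule range_eqI)
  next
    fix Q assume "Q \<in> translation_class \<omega>"
    then obtain s where "Q = (\<lambda>x. s + x) ` zonotope_of \<omega>" by (auto simp: translation_class_eq)
    hence "Q = (\<lambda>x. (s - (t + t')) + x) ` P" unfolding Pw by (simp add: image_image)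
    thus "Q \<in> C" unfolding P(3) translate_of_def by blast
  qed
  ultimately show "C \<in> translation_class ` with_total (cube_side n)" by blast
next
  fix C assume "C \<in> translation_class ` with_total (cube_side n :: (int, 'd) vec)"
  then obtain \<omega> where w: "C = translation_class \<omega>" "multiplicity_function \<omega>" "coord_sum \<omega> = cube_side n"
    by (auto simp: with_total_def)
  have "inscribed n (zonotope_of \<omega>)" using inscribed_iff[OF w(2), of n 0] w(3) by simp
  hence "zonotope_of \<omega> \<in> {P. lattice_zonotope P \<and> inscribed n P}"
    using lattice_zonotope_zonotope_of[OF w(2)] by simp
  from quotientI[OF this, of "{(P, Q). translate_of P Q}"]
  show "C \<in> inscribed_zonotopes n" by (simp add: inscribed_zonotopes_def w(1) translation_class_def Image_def)
qed

section \<open>Mean and variance\<close>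

lemma expectation_random_zonotope:
  fixes v :: "int ^ 'd::{finite,linorder}"
  shows "measure_pmf.expectation (random_zonotope n) (\<lambda>C. f (occurrences v C)) =
    (\<Sum>\<omega>\<in>with_total (cube_side n :: int ^ 'd::{finite,linorder}). f (\<omega> v)) / zono_count (cube_side n :: int ^ 'd::{finite,linorder})"
proof -
  let ?T = "with_total (cube_side n :: (int, 'd) vec)"
  have inj: "inj_on translation_class ?T"
  proof (rule inj_onI)
    fix \<omega> \<omega>' assume *: "\<omega> \<in> ?T" "\<omega>' \<in> ?T" "translation_class \<omega> = translation_class \<omega>'"
    hence "zonotope_of \<omega> \<in> translation_class \<omega>'" using zonotope_of_mem_translation_class[of \<omega>] by simp
    thus "\<omega> = \<omega>'" using * by (intro mem_translation_class_unique) (auto simp: with_total_def)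
  qed
  have ne: "?T \<noteq> {}" using zono_count_cube_pos[of n, where 'd='d] by (auto simp: zono_count_def)
  have "measure_pmf.expectation (random_zonotope n) (\<lambda>C. f (occurrences v C)) =
     (\<Sum>C\<in>translation_class ` ?T. f (occurrences v C)) / real (card (translation_class ` ?T))"
    unfolding random_zonotope_def inscribed_zonotopes_eq using ne
    by (intro integral_pmf_of_set) auto
  also have "(\<Sum>C\<in>translation_class ` ?T. f (occurrences v C)) = (\<Sum>\<omega>\<in>?T. f (\<omega> v))"
    by (subst sum.reindex[OF inj]) (auto intro!: sum.cong simp: with_total_def occurrences_translation_class)
  finally show ?thesis by (simp add: card_image[OF inj] zono_count_def)
qed

lemma multiplicity_le_side:
  assumes v: "v \<in> primitive_vectors" and w: "\<omega> \<in> with_total (cube_side n)"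
  shows "\<omega> v \<le> n"
proof (cases "\<omega> v = 0")
  case False
  from v obtain i where i: "v $ i > 0" by (auto simp: primitive_vectors_def)
  have "int (\<omega> v) * 1 \<le> int (\<omega> v) * \<bar>v $ i\<bar>" using i by (intro mult_left_mono) auto
  also have "\<dots> \<le> coord_sum \<omega> $ i" using w False by (intro abs_le_coord_sum) (auto simp: with_total_def)
  finally show ?thesis using w by (simp add: with_total_def cube_side_def)
qed simp

text \<open>Summation by layers, that is, over the \<open>k\<close> with \<open>k < \<omega> v\<close>.\<close>

lemma sum_multiplicity_eq_survival:
  fixes v :: "int ^ 'd::{finite,linorder}" and g :: "nat \<Rightarrow> real"
  assumes v: "v \<in> primitive_vectors"
  shows "(\<Sum>\<omega>\<in>with_total (cube_side n). \<Sum>k<\<omega> v. g k) / zono_count (cube_side n :: int ^ 'd::{finite,linorder}) =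
    (\<Sum>k. g k * survival v n (Suc k))"
proof -
  let ?T = "with_total (cube_side n :: (int, 'd) vec)"
  have "(\<Sum>\<omega>\<in>?T. \<Sum>k<\<omega> v. g k) = (\<Sum>\<omega>\<in>?T. \<Sum>k<n. if Suc k \<le> \<omega> v then g k else 0)"
  proof (rule sum.cong[OF refl])
    fix \<omega> assume "\<omega> \<in> ?T"
    hence "\<omega> v \<le> n" by (rule multiplicity_le_side[OF v])
    thus "(\<Sum>k<\<omega> v. g k) = (\<Sum>k<n. if Suc k \<le> \<omega> v then g k else 0)"
      by (intro sum.mono_neutral_cong_left) auto
  qed
  also have "\<dots> = (\<Sum>k<n. \<Sum>\<omega>\<in>?T. if Suc k \<le> \<omega> v then g k else 0)" by (rule sum.swap)
  also have "\<dots> = (\<Sum>k<n. g k * real (card {\<omega>\<in>?T. \<omega> v \<ge> Suc k}))"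
    by (intro sum.cong refl) (simp add: sum.If_cases Int_def mult.commute)
  also have "\<dots> / zono_count (cube_side n :: (int, 'd) vec) = (\<Sum>k<n. g k * survival v n (Suc k))"
    unfolding card_multiplicity_ge[OF v] by (simp add: survival_def sum_divide_distrib)
  also have "\<dots> = (\<Sum>k. g k * survival v n (Suc k))"
    by (rule suminf_finite[symmetric]) (auto simp: survival_eq_0[OF v])
  finally show ?thesis .
qed

lemma occ_mean_eq:
  assumes "v \<in> primitive_vectors"
  shows "occ_mean v n = (\<Sum>k. survival v n (Suc k))"
  using sum_multiplicity_eq_survival[OF assms, where n = n and g = "\<lambda>_. 1"]
  unfolding occ_mean_def expectation_random_zonotope[where f = real] by simp

lemma square_eq_sum_odd: "(\<Sum>k<m. 2 * real k + 1) = real m ^ 2"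
  by (induction m) (auto simp: power2_eq_square algebra_simps)

lemma occ_variance_eq:
  assumes v: "v \<in> primitive_vectors"
  shows "occ_variance v n = (\<Sum>k. (2 * real k + 1) * survival v n (Suc k)) - (occ_mean v n) ^ 2"
proof -
  have fin: "finite (set_pmf (random_zonotope n :: (real, 'a) vec set set pmf))"
  proof -
    have "with_total (cube_side n :: (int, 'a) vec) \<noteq> {}"
      using zono_count_cube_pos[of n, where 'd='a] by (auto simp: zono_count_def)
    thus ?thesis unfolding random_zonotope_def inscribed_zonotopes_eq by (subst set_pmf_of_set) auto
  qed
  have "occ_variance v n = measure_pmf.expectation (random_zonotope n) (\<lambda>C. (real (occurrences v C)) ^ 2) - (occ_mean v n) ^ 2"
    unfolding occ_variance_def occ_mean_def
    by (rule measure_pmf.variance_eq) (intro integrable_measure_pmf_finite fin)+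
  also have "measure_pmf.expectation (random_zonotope n) (\<lambda>C. (real (occurrences v C)) ^ 2) =
      (\<Sum>k. (2 * real k + 1) * survival v n (Suc k))"
    unfolding expectation_random_zonotope[where f = "\<lambda>m. real m ^ 2"]
    unfolding square_eq_sum_odd[symmetric] by (rule sum_multiplicity_eq_survival[OF v])
  finally show ?thesis .
qed

theorem proposition6p1:
  fixes d :: nat and v\<^sub>0 :: "int ^ 'd::{finite,linorder}"
  assumes "CARD('d) = d" and "d \<ge> 2"
    and "v\<^sub>0 \<in> primitive_vectors"
  shows "(\<lambda>n. occ_mean v\<^sub>0 n) \<sim>[at_top]
           (\<lambda>n. real n powr (1 / (real d + 1)) /
                (kappa d powr (1 / (real d + 1)) * l1_norm v\<^sub>0)) \<and>
         (\<lambda>n. occ_variance v\<^sub>0 n) \<sim>[at_top]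
           (\<lambda>n. (real n powr (1 / (real d + 1)) /
                (kappa d powr (1 / (real d + 1)) * l1_norm v\<^sub>0)) ^ 2)"
proof -
  have d: "CARD('d) \<ge> 2" using assms by simp
  define b where "b = (\<lambda>n. tilt d n * l1_norm v\<^sub>0)"
  define M where "M = (\<lambda>n. real n powr (1 / (real d + 1)) / (kappa d powr (1 / (real d + 1)) * l1_norm v\<^sub>0))"
  have \<kappa>: "kappa d > 0" using assms by (intro kappa_pos) auto
  have l: "l1_norm v\<^sub>0 > 0" using l1_norm_ge_1[OF assms(3)] by linarith
  have bM: "b n * M n = 1" and M0: "M n \<noteq> 0" if "n > 0" for n
    using that \<kappa> l by (simp_all add: b_def M_def tilt_def powr_divide)
  note mom = survival_moments[OF d assms(3), unfolded assms(1)]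
  have mean: "(\<lambda>n. b n * occ_mean v\<^sub>0 n) \<longlonglongrightarrow> 1"
    using mom(1) unfolding b_def by (simp add: occ_mean_eq[OF assms(3)])
  have var: "(\<lambda>n. b n ^ 2 * occ_variance v\<^sub>0 n) \<longlonglongrightarrow> 1"
  proof -
    have mom2: "(\<lambda>n. b n ^ 2 * (\<Sum>k. (2 * real k + 1) * survival v\<^sub>0 n (Suc k))) \<longlonglongrightarrow> 2"
      unfolding b_def by (rule mom(2))
    have "(\<lambda>n. b n ^ 2 * (\<Sum>k. (2 * real k + 1) * survival v\<^sub>0 n (Suc k)) - (b n * occ_mean v\<^sub>0 n) ^ 2) \<longlonglongrightarrow> 2 - 1 ^ 2"
      by (intro tendsto_diff mom2 tendsto_power mean)
    thus ?thesis by (simp add: occ_variance_eq[OF assms(3)] right_diff_distrib power_mult_distrib)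
  qed
  have "(\<lambda>n. occ_mean v\<^sub>0 n) \<sim>[at_top] M"
  proof (rule asymp_equivI')
    show "(\<lambda>n. occ_mean v\<^sub>0 n / M n) \<longlonglongrightarrow> 1"
      using mean
    proof (rule Lim_transform_eventually)
      show "\<forall>\<^sub>F n in sequentially. b n * occ_mean v\<^sub>0 n = occ_mean v\<^sub>0 n / M n"
        using eventually_gt_at_top[of 0] by eventually_elim (use bM M0 in \<open>simp add: field_simps\<close>)
    qed
  qed
  moreover have "(\<lambda>n. occ_variance v\<^sub>0 n) \<sim>[at_top] (\<lambda>n. M n ^ 2)"
  proof (rule asymp_equivI')
    show "(\<lambda>n. occ_variance v\<^sub>0 n / M n ^ 2) \<longlonglongrightarrow> 1"
      using var
    proof (rule Lim_transform_eventually)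
      show "\<forall>\<^sub>F n in sequentially. b n ^ 2 * occ_variance v\<^sub>0 n = occ_variance v\<^sub>0 n / M n ^ 2"
        using eventually_gt_at_top[of 0]
      proof eventually_elim
        case (elim n)
        have "b n = 1 / M n" using bM[OF elim] M0[OF elim] by (simp add: eq_divide_eq)
        thus ?case by (simp add: power_divide)
      qed
    qed
  qed
  ultimately show ?thesis unfolding M_def by blast
qed

end
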